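(* Let $K$ be a field of characteristic zero. For every integer $e > 1$, setting $n = \binom{3e+2}{2}$, there exists an $8$-dimensional maximal singular subspace of the space $M_n(K)$ of $n \times n$-matrices over $K$.
   Context: A linear subspace $\mathcal{A} \subseteq M_n(K)$ is called singular if it contains only non-invertible matrices, and maximal singular if it is singular and no linear subspace of $M_n(K)$ properly containing it is singular. *)

theory Defs
  imports "Jordan_Normal_Form.VS_Connect"
begin

definition singular_subspace :: "nat \<Rightarrow> 'a :: field mat set \<Rightarrow> bool" where
  "singular_subspace n A \<longleftrightarrow>
     VectorSpace.subspace class_ring A (module_mat TYPE('a) n n) \<and>
     (\<forall>M \<in> A. \<not> invertible_mat M)"

definition maximal_singular_subspace :: "nat \<Rightarrow> 'a :: field mat set \<Rightarrow> bool" where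
  "maximal_singular_subspace n A \<longleftrightarrow>
     singular_subspace n A \<and> \<not> (\<exists>B. A \<subset> B \<and> singular_subspace n B)"

definition mat_subspace_dim :: "nat \<Rightarrow> 'a :: field mat set \<Rightarrow> nat" where
  "mat_subspace_dim n A =
     vectorspace.dim class_ring ((module_mat TYPE('a) n n)\<lparr>carrier := A\<rparr>)"

end

(*
Let sl_3 act on the polynomials of degree m = 3e in x, y, z, a space of dimension (3e+2 choose 2);
the image A of sl_3 in the matrices is the required space.

A is singular: if D is the derivation given by a traceless matrix, the Wronskian of x, y, z along D
is a cubic form f with D f = 0 (Cayley-Hamilton), so D kills f^e. It is nonzero for generic matrices,
and det D vanishes identically because it is a polynomial function.

A is maximal: let T lie in a singular space containing A. Perturbing a regular diagonal element of A
by T shows that the ((xyz)^e, (xyz)^e) entry of T vanishes, and the same holds for all conjugates of T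
under SL_3. These conditions define an sl_3-submodule of the operators. The orthogonal complement of A
in it with respect to the trace form, if nonzero, contains a highest weight vector (x d/dz)^k with k <> 1.
A conjugate of x d/dz is l d with l = x + y + z and d = p d/dx + q d/dy + r d/dz, p + q + r = 0, and the
entry of (l d)^k is k!^2 times the coefficient of t^k in P(pt) P(qt) P(rt), where
P(t) = L_e(-t) = sum_i (e choose i) t^i / i! is a Laguerre polynomial. For 1 <> k <= 3e this coefficient
is not identically zero in p, q, r: expand it to the appropriate order at q = 0; for k < 2e the differential
equation of P determines the coefficients of P(t) P(-t) up to nonzero factors.
*)
theory Submission
  imports Defs
begin

section \<open>Laguerre polynomials\<close>


text \<open>Lying in a larger singular space is a condition on determinants, nonlinear in T; it is
  traded for linear conditions that the group preserves. This explains the degree 3e: (xyz)^e then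
  has weight zero and spans the kernel of a regular diagonal element, so the first-order change of
  the determinant along T is a single diagonal entry. Neither algebraic closure nor complete
  reducibility is invoked: the eigenvalues that occur are integers, the only submodule to split off
  is A itself, on which the trace form is nondegenerate, and highest weight vectors are found as
  common kernels of nilpotent operators. The group appears only through the exponentials exp(t
  E_ij), i <> j, which are polynomial in t, so invariance under the Lie algebra is a comparison of
  coefficients. The Laguerre coefficients pair the binomials from d^k (xyz)^e with the inverse
  factorials from the multinomial expansion of l^k. The exponent k = 1 has to be an exception: x
  d/dz belongs to A, and the test function vanishes on all its conjugates.\<close>

definition laguerre :: "nat \<Rightarrow> nat \<Rightarrow> 'a::field_char_0" where
  "laguerre e i = of_nat (e choose i) / fact i"

text \<open>The ratio of consecutive Laguerre coefficients, cleared of denominators so that it also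
  covers i \<ge> e, where both sides vanish. Read coefficientwise, the differential equation below
  is this recurrence.\<close>

lemma laguerre_Suc: "of_nat (Suc i) ^ 2 * laguerre e (Suc i) = (of_nat e - of_nat i) * (laguerre e i :: 'a::field_char_0)"
proof -
  have "of_nat (Suc i) * of_nat (e choose Suc i) = (of_nat e - of_nat i) * (of_nat (e choose i) :: 'a)"
  proof (cases "i \<le> e")
    case True
    have "Suc i * (e choose Suc i) = (e - i) * (e choose i)"
      by (metis binomial_absorb_comp binomial_absorption mult.commute)
    then have "of_nat (Suc i * (e choose Suc i)) = (of_nat ((e - i) * (e choose i)) :: 'a)" by simp
    then show ?thesis by (simp only: of_nat_mult of_nat_diff[OF True])
  qed (simp add: binomial_eq_0)
  then show ?thesis
    unfolding laguerre_def power2_eq_square fact_Suc by (simp add: field_simps del: of_nat_Suc of_nat_add)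
qed

lemma laguerre_nonzero: "i \<le> e \<Longrightarrow> laguerre e i \<noteq> (0 :: 'a::field_char_0)"
  by (simp add: laguerre_def)

lemma laguerre_eq_0: "e < i \<Longrightarrow> laguerre e i = (0 :: 'a::field_char_0)"
  by (simp add: laguerre_def binomial_eq_0)

text \<open>This is L_e(- s t); the parameter makes P(t) and P(-t) the instances s = 1 and s = -1 of
  one differential equation.\<close>

definition laguerre_poly :: "nat \<Rightarrow> 'a \<Rightarrow> 'a::field_char_0 poly" where
  "laguerre_poly e s = (\<Sum>i\<le>e. monom (s ^ i * laguerre e i) i)"

lemma coeff_laguerre_poly: "coeff (laguerre_poly e s) i = s ^ i * laguerre e i"
  by (cases "i \<le> e") (auto simp: laguerre_poly_def coeff_sum laguerre_eq_0 if_distrib sum.If_cases)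

lemma laguerre_poly_ode:
  "[:0, 1:] * pderiv (pderiv (laguerre_poly e s)) + [:1, s:] * pderiv (laguerre_poly e s)
    = Polynomial.smult (s * of_nat e) (laguerre_poly e (s::'a::field_char_0))"
proof (rule poly_eqI)
  fix i
  have "of_nat (Suc i) * of_nat (Suc i) * laguerre e (Suc i) = (of_nat e - of_nat i) * (laguerre e i :: 'a)"
    using laguerre_Suc[of i e] by (simp add: power2_eq_square)
  then have *: "s ^ Suc i * (of_nat (Suc i) * of_nat (Suc i) * laguerre e (Suc i))
     = s ^ Suc i * ((of_nat e - of_nat i) * laguerre e i)" by simp
  show "coeff ([:0, 1:] * pderiv (pderiv (laguerre_poly e s)) + [:1, s:] * pderiv (laguerre_poly e s)) i
      = coeff (Polynomial.smult (s * of_nat e) (laguerre_poly e s)) i"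
    using * by (cases i) (simp_all add: coeff_pCons coeff_pderiv coeff_laguerre_poly algebra_simps)
qed

context
  fixes e :: nat and u v R N S :: "'a::field_char_0 poly"
  defines "u \<equiv> laguerre_poly e 1" and "v \<equiv> laguerre_poly e (-1)"
  defines "R \<equiv> u * v" and "N \<equiv> pderiv u * v - u * pderiv v" and "S \<equiv> pderiv u * pderiv v"
begin

text \<open>The differential equations of \<open>u\<close> and \<open>v\<close> give a closed linear system for \<open>R\<close>, \<open>N\<close> and \<open>S\<close>.\<close>

lemma laguerre_wronskian_recurrences:
  "of_nat (i + 1) * coeff N i = (2 * of_nat e - of_nat i) * coeff R i" (is ?A)
  "of_nat (i + 2) * coeff S i = - of_nat e * coeff N i" (is ?B)
  "of_nat (i + 2) ^ 2 * coeff R (i + 2) = 2 * coeff S i - coeff N i" (is ?C)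
proof -
  define x E :: "'a poly" where "x = [:0, 1:]" and "E = [:of_nat e:]"
  have U: "x * pderiv (pderiv u) + (1 + x) * pderiv u = E * u"
    using laguerre_poly_ode[of e 1] by (simp add: u_def x_def E_def one_pCons)
  have V: "x * pderiv (pderiv v) + (1 - x) * pderiv v = - E * v"
    using laguerre_poly_ode[of e "-1"] by (simp add: v_def x_def E_def one_pCons)
  have U': "x * pderiv (pderiv u) = E * u - (1 + x) * pderiv u" 
    using U by (metis add_diff_cancel_right')
  have V': "x * pderiv (pderiv v) = - E * v - (1 - x) * pderiv v" 
    using V by (metis add_diff_cancel_right')
  have "x * pderiv N + N = x * pderiv (pderiv u) * v - u * (x * pderiv (pderiv v)) + N"
    unfolding N_def by (simp add: pderiv_mult pderiv_diff algebra_simps)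
  also have "\<dots> = 2 * E * R - x * pderiv R"
    unfolding U' V' N_def R_def by (simp add: pderiv_mult algebra_simps)
  finally have "coeff (x * pderiv N + N) i = coeff (2 * E * R - x * pderiv R) i" by simp
  then show ?A
    unfolding x_def E_def
    by (cases i) (simp_all add: coeff_pCons coeff_pderiv algebra_simps numeral_poly)
  have "x * pderiv S + 2 * S = x * pderiv (pderiv u) * pderiv v + pderiv u * (x * pderiv (pderiv v)) + 2 * S"
    unfolding S_def by (simp add: pderiv_mult pderiv_diff algebra_simps)
  also have "\<dots> = - E * N"
    unfolding U' V' N_def S_def by (simp add: pderiv_mult algebra_simps)
  finally have "coeff (x * pderiv S + 2 * S) i = coeff (- E * N) i" by simp
  then show ?B
    unfolding x_def E_def
    by (cases i) (simp_all add: coeff_pCons coeff_pderiv algebra_simps numeral_poly)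
  have "x * pderiv (pderiv R) + pderiv R
      = x * pderiv (pderiv u) * v + u * (x * pderiv (pderiv v)) + 2 * x * S + pderiv R"
    unfolding S_def R_def by (simp add: pderiv_mult pderiv_add algebra_simps)
  also have "\<dots> = x * (2 * S - N)"
    unfolding U' V' N_def S_def R_def by (simp add: pderiv_mult algebra_simps)
  finally have "coeff (x * pderiv (pderiv R) + pderiv R) (Suc i) = coeff (x * (2 * S - N)) (Suc i)" by simp
  then show ?C
    unfolding x_def
    by (simp add: coeff_pCons coeff_pderiv algebra_simps numeral_poly power2_eq_square)
qed

text \<open>Eliminating \<open>N\<close> and \<open>S\<close> from the three relations leaves a
  recurrence for R = P(t) P(-t) alone, of step two and with a single term on each side. The factor
  2e - i vanishes at i = 2e, the degree of \<open>R\<close>.\<close>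

lemma laguerre_square_coeff_Suc_Suc:
  "of_nat ((i + 1) * (i + 2) ^ 3) * coeff R (i + 2)
    = - (2 * of_nat e - of_nat i) * of_nat (i + 2 + 2 * e) * coeff R i"
proof -
  define a b c :: 'a where "a = of_nat (i + 1)" and "b = of_nat (i + 2)" and "c = of_nat e"
  have A: "a * coeff N i = (2 * c - of_nat i) * coeff R i"
    and B: "b * coeff S i = - c * coeff N i"
    and C: "b ^ 2 * coeff R (i + 2) = 2 * coeff S i - coeff N i"
    using laguerre_wronskian_recurrences[of i] unfolding a_def b_def c_def by auto
  have "a * b ^ 3 * coeff R (i + 2) = a * b * (b ^ 2 * coeff R (i + 2))"
    by (simp add: power2_eq_square power3_eq_cube)
  also have "\<dots> = a * (2 * (b * coeff S i) - b * coeff N i)" unfolding C by (simp add: algebra_simps)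
  also have "\<dots> = - (b + 2 * c) * (a * coeff N i)" unfolding B by (simp add: algebra_simps)
  also have "\<dots> = - (b + 2 * c) * ((2 * c - of_nat i) * coeff R i)" unfolding A ..
  finally have D: "a * b ^ 3 * coeff R (i + 2) = - (b + 2 * c) * ((2 * c - of_nat i) * coeff R i)" .
  have e1: "of_nat ((i + 1) * (i + 2) ^ 3) = a * b ^ 3" unfolding a_def b_def by (metis of_nat_mult of_nat_power)
  have e2: "of_nat (i + 2 + 2 * e) = b + 2 * c" unfolding b_def c_def by simp
  show ?thesis unfolding e1 e2 D by (simp add: c_def algebra_simps)
qed

text \<open>The recurrence starts from the constant term 1, and below index 2e none of its factors
  vanishes in characteristic zero.\<close>

lemma laguerre_square_coeff_even: "j \<le> e \<Longrightarrow> coeff R (2 * j) \<noteq> 0"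
proof (induction j)
  case 0
  show ?case by (simp add: R_def u_def v_def coeff_mult_0 coeff_laguerre_poly laguerre_nonzero)
next
  case (Suc j)
  have "2 * e - 2 * j > 0" using Suc by simp
  then have "(of_nat (2 * e - 2 * j) :: 'a) \<noteq> 0" by (simp del: of_nat_diff)
  then have "(2 * of_nat e - of_nat (2 * j) :: 'a) \<noteq> 0"
    using Suc by (simp add: of_nat_diff)
  moreover have "of_nat (2 * j + 2 + 2 * e) \<noteq> (0::'a)" using of_nat_neq_0 
    by (metis add_2_eq_Suc' add_Suc)
  ultimately have "- (2 * of_nat e - of_nat (2 * j)) * of_nat (2 * j + 2 + 2 * e) * coeff R (2 * j) \<noteq> 0"
    using Suc by (metis (no_types, lifting) Suc_leD mult_eq_0_iff neg_equal_0_iff_equal)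
  then show ?case using laguerre_square_coeff_Suc_Suc[of "2 * j"] by (metis add_2_eq_Suc' mult_Suc_right add.commute mult_zero_right)
qed

text \<open>P(t) P(-t) is an even function. The recurrence spreads this from the linear coefficient,
  where the contributions e and -e cancel.\<close>

lemma laguerre_square_coeff_odd: "coeff R (2 * j + 1) = 0"
proof (induction j)
  case 0
  show ?case by (simp add: R_def u_def v_def coeff_mult coeff_laguerre_poly)
next
  case (Suc j)
  have "of_nat ((2 * j + 1 + 1) * (2 * j + 1 + 2) ^ 3) * coeff R (2 * j + 1 + 2) = 0"
    unfolding laguerre_square_coeff_Suc_Suc Suc by simp
  moreover have "of_nat ((2 * j + 1 + 1) * (2 * j + 1 + 2) ^ 3) \<noteq> (0::'a)"
    unfolding of_nat_eq_0_iff by simp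
  ultimately show ?case by simp
qed

text \<open>The expression is the derivative in q, at q = 0, of the coefficient of t^(2j + 1) in
  P((-1 - q) t) P(q t) P(t): the middle factor gives e R, the first one v' u. As \<open>R\<close> is
  even, v' u may be replaced by - N / 2 in even degrees, and the recurrence for \<open>N\<close>
  gives j (2e + 1) R / (2j + 1). This is zero for j = 0, the exceptional exponent k = 1.\<close>

lemma laguerre_first_variation_nonzero:
  assumes "1 \<le> j" "j \<le> e"
  shows "of_nat e * coeff R (2 * j) + coeff (pderiv v * u) (2 * j) \<noteq> 0"
proof -
  have "pderiv R = pderiv v * u + pderiv v * u + N"
    by (simp add: R_def N_def pderiv_mult algebra_simps)
  then have "coeff (pderiv R) (2 * j) = coeff (pderiv v * u) (2 * j) + coeff (pderiv v * u) (2 * j) + coeff N (2 * j)"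
    by (simp only: coeff_add)
  moreover have "coeff (pderiv R) (2 * j) = 0"
    using laguerre_square_coeff_odd[of j] by (simp add: coeff_pderiv)
  ultimately have 1: "2 * coeff (pderiv v * u) (2 * j) = - coeff N (2 * j)"
    by (simp add: eq_neg_iff_add_eq_0)
  have "of_nat (2 * j + 1) * (2 * (of_nat e * coeff R (2 * j) + coeff (pderiv v * u) (2 * j)))
     = of_nat (2 * j + 1) * 2 * of_nat e * coeff R (2 * j) - of_nat (2 * j + 1) * coeff N (2 * j)"
    unfolding distrib_left 1 by (simp add: algebra_simps)
  also have "\<dots> = 2 * of_nat j * of_nat (2 * e + 1) * coeff R (2 * j)"
    unfolding laguerre_wronskian_recurrences by (simp add: algebra_simps)
  also have "\<dots> \<noteq> 0"
    using laguerre_square_coeff_even[of j] assms of_nat_neq_0[of "2 * e"] by (simp add: add.commute)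
  finally show ?thesis by (metis mult_zero_right)
qed

end

section \<open>Nonvanishing of the coefficients of the triple Laguerre product\<close>

lemma coeff_neg_linear_power:
  "coeff ([:-1, -1:] ^ i) (Suc 0) = of_nat i * (-1 :: 'a::comm_ring_1) ^ i"
  by (induction i) (simp_all add: coeff_0_power algebra_simps)

text \<open>With r = 1, q = t and p = -1 - t the sum is a polynomial \<open>Q\<close> in t. The
  field is infinite, so it is enough that one coefficient of \<open>Q\<close> is nonzero.\<close>

lemma laguerre_triple_nonzero:
  assumes k: "k \<le> 3 * e" "k \<noteq> 1"
  shows "\<exists>t::'a::field_char_0. (\<Sum>i\<le>k. \<Sum>j\<le>k-i.
      laguerre e i * laguerre e j * laguerre e (k - i - j) * ((- 1 - t) ^ i * t ^ j)) \<noteq> 0"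
proof (rule ccontr)
  assume "\<not> ?thesis"
  then have vanish: "\<And>t::'a. (\<Sum>i\<le>k. \<Sum>j\<le>k-i.
      laguerre e i * laguerre e j * laguerre e (k - i - j) * ((- 1 - t) ^ i * t ^ j)) = 0" by blast
  define q where "q i = ([:-1, -1:] :: 'a poly) ^ i" for i
  define Q where "Q = (\<Sum>i\<le>k. \<Sum>j\<le>k-i. Polynomial.smult (laguerre e i * laguerre e j * laguerre e (k - i - j)) (monom 1 j * q i))"
  have "poly Q t = 0" for t
    using vanish[of t] by (simp add: Q_def q_def poly_sum poly_monom algebra_simps)
  then have "Q = 0" by (simp add: poly_all_0_iff_0[symmetric])
  then have Q0: "coeff Q b = 0" for b by simp
  have coeffQ: "coeff Q b = (\<Sum>i\<le>k. \<Sum>j\<le>k-i. laguerre e i * laguerre e j * laguerre e (k - i - j) *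
      (if j \<le> b then coeff (q i) (b - j) else 0))" for b
    by (auto simp: Q_def coeff_sum coeff_monom_mult intro!: sum.cong)
  let ?u = "laguerre_poly e (1::'a)" and ?v = "laguerre_poly e (-1::'a)"
  \<comment> \<open>The coefficient of t^0 settles even k, that of t^1 settles odd k, and that of
    t^(k - 2e) settles k \<ge> 2e. In the odd case the hypothesis \<open>k \<noteq> 1\<close>
    becomes j \<ge> 1.\<close>
  consider (even) j where "k = 2 * j" "j \<le> e" | (odd) j where "k = 2 * j + 1" "1 \<le> j" "j \<le> e"
    | (large) "2 * e \<le> k"
  proof (cases "2 * e \<le> k")
    case False
    then show ?thesis using that k by (cases "even k") (auto elim!: evenE oddE)
  qed
  then show False
  proof cases
    case (even j)
    have "coeff Q 0 = (\<Sum>i\<le>k. laguerre e i * laguerre e (k - i) * (-1) ^ i)"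
      unfolding coeffQ
    proof (rule sum.cong[OF refl])
      fix i assume "i \<in> {..k}"
      have "(\<Sum>j\<le>k-i. laguerre e i * laguerre e j * laguerre e (k - i - j) * (if j \<le> 0 then coeff (q i) (0 - j) else 0))
        = (\<Sum>j\<in>{0}. laguerre e i * laguerre e j * laguerre e (k - i - j) * (if j \<le> 0 then coeff (q i) (0 - j) else 0))"
        by (rule sum.mono_neutral_right) auto
      also have "\<dots> = laguerre e i * laguerre e (k - i) * (-1) ^ i" by (simp add: q_def coeff_0_power laguerre_def)
      finally show "(\<Sum>j\<le>k-i. laguerre e i * laguerre e j * laguerre e (k - i - j) * (if j \<le> 0 then coeff (q i) (0 - j) else 0))
        = laguerre e i * laguerre e (k - i) * (-1) ^ i" .
    qed
    also have "\<dots> = coeff (?v * ?u) k"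
      by (simp only: coeff_mult coeff_laguerre_poly) (simp add: algebra_simps)
    finally show False
      using laguerre_square_coeff_even[OF even(2), where ?'a='a] Q0[of 0] even by (simp add: mult.commute)
  next
    case (odd j)
    have "coeff Q 1 = (\<Sum>i\<le>k. laguerre e i * laguerre e (k - i) * (of_nat i * (-1) ^ i)
        + (if i < k then of_nat e * (laguerre e i * laguerre e (k - 1 - i) * (-1) ^ i) else 0))"
      unfolding coeffQ
    proof (rule sum.cong[OF refl])
      fix i assume i: "i \<in> {..k}"
      have "(\<Sum>j\<le>k-i. laguerre e i * laguerre e j * laguerre e (k - i - j) * (if j \<le> 1 then coeff (q i) (1 - j) else 0))
        = (\<Sum>j\<in>{0..min 1 (k - i)}. laguerre e i * laguerre e j * laguerre e (k - i - j) * (if j \<le> 1 then coeff (q i) (1 - j) else 0))"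
        by (rule sum.mono_neutral_right) auto
      also have "\<dots> = laguerre e i * laguerre e (k - i) * (of_nat i * (-1) ^ i)
        + (if i < k then of_nat e * (laguerre e i * laguerre e (k - 1 - i) * (-1) ^ i) else 0)"
      proof (cases "i < k")
        case True
        then have m: "min 1 (k - i) = Suc 0" and m': "k - i - Suc 0 = k - Suc i" by auto
        show ?thesis using True unfolding m 
          by (simp add: m' coeff_neg_linear_power q_def coeff_0_power laguerre_def)
      next
        case False
        then have "min 1 (k - i) = 0" by auto
        then show ?thesis using False i by (simp add: coeff_neg_linear_power q_def laguerre_def)
      qed
      finally show "(\<Sum>j\<le>k-i. laguerre e i * laguerre e j * laguerre e (k - i - j) * (if j \<le> 1 then coeff (q i) (1 - j) else 0))
        = laguerre e i * laguerre e (k - i) * (of_nat i * (-1) ^ i)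
        + (if i < k then of_nat e * (laguerre e i * laguerre e (k - 1 - i) * (-1) ^ i) else 0)" .
    qed
    also have "\<dots> = (\<Sum>i\<le>k. laguerre e i * laguerre e (k - i) * (of_nat i * (-1) ^ i))
        + of_nat e * (\<Sum>i\<le>2*j. laguerre e i * laguerre e (2 * j - i) * (-1) ^ i)"
      using odd(1) by (simp add: sum.distrib sum_distrib_left lessThan_Suc_atMost)
    also have "(\<Sum>i\<le>2*j. laguerre e i * laguerre e (2 * j - i) * (-1) ^ i) = coeff (?u * ?v) (2 * j)"
      unfolding mult.commute[of ?u] by (simp only: coeff_mult coeff_laguerre_poly) (simp add: algebra_simps)
    \<comment> \<open>The weights i (-1)^i are the derivatives of (-1 - t)^i at 0; together they
      assemble into t v'(t).\<close>
    also have "(\<Sum>i\<le>k. laguerre e i * laguerre e (k - i) * (of_nat i * (-1) ^ i))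
        = coeff (pCons 0 (pderiv ?v) * ?u) k"
      unfolding coeff_mult 
      by (rule sum.cong) (auto simp: coeff_pCons coeff_pderiv coeff_laguerre_poly algebra_simps split: nat.split)
    also have "\<dots> = coeff (pderiv ?v * ?u) (2 * j)" using odd(1) by simp
    finally show False
      using laguerre_first_variation_nonzero[OF odd(2,3), where ?'a='a] Q0[of 1] by (simp add: add.commute)
  next
    case large
    define b where "b = k - 2 * e"
    have b: "b \<le> e" "k = 2 * e + b" using k large by (auto simp: b_def)
    have "coeff Q b = (\<Sum>i\<le>k. if i = e then laguerre e e * laguerre e b * laguerre e e * (-1) ^ e else 0)"
      unfolding coeffQ
    proof (rule sum.cong[OF refl])
      fix i assume i: "i \<in> {..k}"
      have "(\<Sum>j\<le>k-i. laguerre e i * laguerre e j * laguerre e (k - i - j) * (if j \<le> b then coeff (q i) (b - j) else 0))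
        = (\<Sum>j\<le>k-i. if j = b then (if i = e then laguerre e e * laguerre e b * laguerre e e * (-1) ^ e else 0) else 0)"
      proof (rule sum.cong[OF refl])
        fix j assume j: "j \<in> {..k-i}"
        \<comment> \<open>The indices i, j and k - i - j add up to 2e + b, while nonzero terms bound
          them by e, b and e; so all three bounds are attained.\<close>
        consider "e < i" | "e < k - i - j" | "b < j" | "i = e" "j = b" "k - i - j = e"
          using i j b by auto linarith
        then show "laguerre e i * laguerre e j * laguerre e (k - i - j) * (if j \<le> b then coeff (q i) (b - j) else 0)
          = (if j = b then (if i = e then laguerre e e * laguerre e b * laguerre e e * (-1) ^ e else 0) else 0)"
          by cases (use b in \<open>auto simp: laguerre_eq_0 q_def coeff_0_power\<close>)
      qed
      also have "\<dots> = (if i = e then laguerre e e * laguerre e b * laguerre e e * (-1) ^ e else 0)"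
        using b by (auto simp: sum.delta)
      finally show "(\<Sum>j\<le>k-i. laguerre e i * laguerre e j * laguerre e (k - i - j) * (if j \<le> b then coeff (q i) (b - j) else 0))
        = (if i = e then laguerre e e * laguerre e b * laguerre e e * (-1) ^ e else 0)" .
    qed
    also have "\<dots> = laguerre e e * laguerre e b * laguerre e e * (-1) ^ e" using b by simp
    finally show False using Q0[of b] b by (simp add: laguerre_nonzero)
  qed
qed

section \<open>Differential operators on polynomials in three variables\<close>


type_synonym 'a poly3 = "'a poly poly poly"

definition cst :: "'a \<Rightarrow> 'a::comm_ring_1 poly3" where
  "cst c = [:[:[:c:]:]:]"

text \<open>The nesting is K[x][y][z] with z outermost; exponents are always listed in the order x,
  y, z.\<close>

definition coeff3 :: "'a::comm_ring_1 poly3 \<Rightarrow> nat \<Rightarrow> nat \<Rightarrow> nat \<Rightarrow> 'a" where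
  "coeff3 f a b c = coeff (coeff (coeff f c) b) a"

definition mon3 :: "nat \<Rightarrow> nat \<Rightarrow> nat \<Rightarrow> 'a::comm_ring_1 poly3" where
  "mon3 a b c = monom (monom (monom 1 a) b) c"

lemma poly3_eqI: "(\<And>a b c. coeff3 f a b c = coeff3 g a b c) \<Longrightarrow> f = g"
  unfolding coeff3_def by (intro poly_eqI) auto

lemma coeff3_simps [simp]:
  "coeff3 0 a b c = 0" "coeff3 (f + g) a b c = coeff3 f a b c + coeff3 g a b c"
  "coeff3 (f - g) a b c = coeff3 f a b c - coeff3 g a b c" "coeff3 (- f) a b c = - coeff3 f a b c"
  "coeff3 (cst k * f) a b c = k * coeff3 f a b c"
  by (simp_all add: coeff3_def cst_def)

lemma coeff3_sum: "coeff3 (sum h S) a b c = (\<Sum>s\<in>S. coeff3 (h s) a b c)"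
  by (simp add: coeff3_def coeff_sum)

lemma coeff3_mon3: "coeff3 (mon3 a b c) a' b' c' = (if a = a' \<and> b = b' \<and> c = c' then 1 else 0)"
  by (simp add: coeff3_def mon3_def)

lemma cst_hom [simp]: "cst 0 = 0" "cst 1 = 1" "cst (x + y) = cst x + cst y" "cst (x * y) = cst x * cst y"
  "cst (- x) = - cst x" "cst (x - y) = cst x - cst y"
  by (simp_all add: cst_def one_pCons)

lemma cst_eq_0_iff [simp]: "cst x = 0 \<longleftrightarrow> x = 0"
  by (simp add: cst_def)

text \<open>Bundling the linear endomorphisms of the polynomial ring as a type makes the class
  \<open>ring_1\<close> available for the noncommutative computations below. Operators on the forms of degree
  \<open>n\<close> are modelled by the corner \<open>hproj n * L * hproj n\<close> of this ring.\<close>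

typedef (overloaded) 'a endo =
  "{L :: 'a::comm_ring_1 poly3 \<Rightarrow> 'a poly3.
     (\<forall>f g. L (f + g) = L f + L g) \<and> (\<forall>c f. L (cst c * f) = cst c * L f)}"
  morphisms app Endo
  by (rule exI[of _ "\<lambda>_. 0"]) simp

lemma app_plus [simp]: "app L (f + g) = app L f + app L g"
  and app_cst [simp]: "app L (cst c * f) = cst c * app L f"
  using app[of L] by auto

lemma app_0 [simp]: "app L 0 = 0"
  using app_plus[of L 0 0] by simp

lemma app_minus [simp]: "app L (- f) = - app L f"
  using app_plus[of L f "- f"] by (simp add: eq_neg_iff_add_eq_0 add.commute)

lemma app_diff [simp]: "app L (f - g) = app L f - app L g"
  using app_plus[of L f "- g"] by simp

lemma app_sum: "app L (sum h S) = (\<Sum>s\<in>S. app L (h s))"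
  by (induction S rule: infinite_finite_induct) auto

lemma app_Endo:
  assumes "\<And>f g. L (f + g) = L f + L g" "\<And>c f. L (cst c * f) = cst c * L f"
  shows "app (Endo L) = L"
  using assms by (simp add: Endo_inverse)

lemma endo_eqI: "(\<And>f. app L f = app M f) \<Longrightarrow> L = M"
  by (metis app_inject ext)

instantiation endo :: (comm_ring_1) ring_1
begin

definition "0 = Endo (\<lambda>_. 0)"
definition "1 = Endo (\<lambda>f. f)"
definition "L + M = Endo (\<lambda>f. app L f + app M f)"
definition "L - M = Endo (\<lambda>f. app L f - app M f)"
definition "- L = Endo (\<lambda>f. - app L f)"
definition "L * M = Endo (\<lambda>f. app L (app M f))"

lemma app_ring_ops:
  "app 0 f = 0" "app 1 f = f" "app (L + M) f = app L f + app M f" "app (L - M) f = app L f - app M f"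
  "app (- L) f = - app L f" "app (L * M) f = app L (app M f)"
  by (simp_all add: zero_endo_def one_endo_def plus_endo_def minus_endo_def uminus_endo_def
      times_endo_def Endo_inverse distrib_left right_diff_distrib add_diff_add add_ac)

instance
proof
  have "app (0::'a endo) 1 \<noteq> app 1 1" unfolding app_ring_ops by simp
  then show "(0::'a endo) \<noteq> 1" by metis
qed (rule endo_eqI, simp add: app_ring_ops)+

end

lemmas app_ops [simp] = app_ring_ops

lemma app_sum_left: "app (sum h S) f = (\<Sum>s\<in>S. app (h s) f)"
  by (induction S rule: infinite_finite_induct) auto

definition mul :: "'a::comm_ring_1 poly3 \<Rightarrow> 'a endo" where
  "mul g = Endo (\<lambda>f. g * f)"

lemma app_mul [simp]: "app (mul g) f = g * f"
  unfolding mul_def by (subst app_Endo) (simp_all add: algebra_simps)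

text \<open>Scalars enter as central elements, so that linear combinations of operators can be
  written within the ring class.\<close>

abbreviation sc :: "'a::comm_ring_1 \<Rightarrow> 'a endo" where
  "sc c \<equiv> mul (cst c)"

lemma sc_commute: "L * sc c = sc c * L"
  by (rule endo_eqI) simp

lemma mul_hom: "mul 0 = 0" "mul 1 = 1" "mul (f + g) = mul f + mul g" "mul (f * g) = mul f * mul g"
    "mul (f - g) = mul f - mul g" "mul (- f) = - mul f"
  by (rule endo_eqI, simp add: algebra_simps)+

lemma mul_power: "mul (f ^ k) = mul f ^ k"
  by (induction k) (simp_all add: mul_hom)

lemma mul_commute: "mul f * mul g = mul g * mul f"
  by (rule endo_eqI) (simp add: algebra_simps)

text \<open>Applied coefficientwise, a derivation of the coefficient ring is a derivation of the
  polynomial ring. Iterating this carries \<open>pderiv\<close> through the outer layers of the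
  nested polynomial type.\<close>

lemma derivation_map_poly:
  fixes d :: "'b::comm_ring_1 \<Rightarrow> 'b"
  assumes add: "\<And>x y. d (x + y) = d x + d y" and mult: "\<And>x y. d (x * y) = d x * y + x * d y"
  shows "map_poly d (p + q) = map_poly d p + map_poly d q"
    and "map_poly d (p * q) = map_poly d p * q + p * map_poly d q"
proof -
  have d0: "d 0 = 0" using add[of 0 0] by simp
  have dsum: "d (sum h S) = (\<Sum>s\<in>S. d (h s))" for h :: "nat \<Rightarrow> 'b" and S
    by (induction S rule: infinite_finite_induct) (auto simp: d0 add)
  show "map_poly d (p + q) = map_poly d p + map_poly d q"
    by (rule poly_eqI) (simp add: coeff_map_poly d0 add)
  show "map_poly d (p * q) = map_poly d p * q + p * map_poly d q"
    by (rule poly_eqI) (simp add: coeff_map_poly d0 coeff_mult dsum mult sum.distrib)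
qed

section \<open>Coordinates, partial derivatives and linear vector fields\<close>

datatype axis = AX | AY | AZ

lemma UNIV_axis: "UNIV = {AX, AY, AZ}"
  by (auto intro: axis.exhaust)

instance axis :: finite
  by standard (simp add: UNIV_axis)

lemma sum_axis: "(\<Sum>i\<in>UNIV. h i) = h AX + h AY + h AZ"
  by (simp add: UNIV_axis add.assoc)

fun var :: "axis \<Rightarrow> 'a::comm_ring_1 poly3" where
  "var AX = [:[:[:0, 1:]:]:]"
| "var AY = [:[:0, 1:]:]"
| "var AZ = [:0, 1:]"

fun dvar :: "axis \<Rightarrow> 'a::field_char_0 poly3 \<Rightarrow> 'a poly3" where
  "dvar AX f = map_poly (map_poly pderiv) f"
| "dvar AY f = map_poly pderiv f"
| "dvar AZ f = pderiv f"

lemma dvar_add: "dvar i (f + g) = dvar i f + dvar i g"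
  and dvar_mult: "dvar i (f * g) = dvar i f * g + f * dvar i g"
proof -
  have add: "pderiv (p + q) = pderiv p + pderiv q" and mult: "pderiv (p * q) = pderiv p * q + p * pderiv q"
    for p q :: "'b::idom poly"
    by (simp_all add: pderiv_add pderiv_mult)
  note 1 = derivation_map_poly[OF add mult]
  note 2 = derivation_map_poly[OF 1]
  show "dvar i (f + g) = dvar i f + dvar i g"
    by (cases i) (simp_all add: add 1 2)
  show "dvar i (f * g) = dvar i f * g + f * dvar i g"
    by (cases i) (simp_all add: mult 1 2)
qed

lemma coeff3_dvar:
  "coeff3 (dvar i f) a b c = (case i of AX \<Rightarrow> of_nat (a + 1) * coeff3 f (a + 1) b c
     | AY \<Rightarrow> of_nat (b + 1) * coeff3 f a (b + 1) c | AZ \<Rightarrow> of_nat (c + 1) * coeff3 f a b (c + 1))"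
  by (cases i) (simp_all add: coeff3_def coeff_map_poly coeff_pderiv algebra_simps of_nat_poly)

lemma coeff3_var:
  "coeff3 (var i * f) a b c = (case i of AX \<Rightarrow> (if a = 0 then 0 else coeff3 f (a - 1) b c)
     | AY \<Rightarrow> (if b = 0 then 0 else coeff3 f a (b - 1) c) | AZ \<Rightarrow> (if c = 0 then 0 else coeff3 f a b (c - 1)))"
  by (cases i; cases a; cases b; cases c; simp add: coeff3_def)

lemma dvar_var: "dvar i (var j) = (if i = j then 1 else 0)"
  by (cases i; cases j; simp add: map_poly_pCons pderiv_pCons one_pCons)

declare var.simps [simp del] dvar.simps [simp del]

lemma dvar_cst: "dvar i (cst x * f) = cst x * dvar i f"
  by (rule poly3_eqI) (cases i; simp add: coeff3_dvar mult.left_commute)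

definition dd :: "axis \<Rightarrow> 'a::field_char_0 endo" where
  "dd i = Endo (dvar i)"

lemma app_dd [simp]: "app (dd i) f = dvar i f"
  unfolding dd_def by (subst app_Endo) (simp_all add: dvar_add dvar_cst)

abbreviation mm :: "axis \<Rightarrow> 'a::comm_ring_1 endo" where
  "mm i \<equiv> mul (var i)"

lemma dd_mul: "dd i * mul g = mul g * dd i + mul (dvar i g)"
  by (rule endo_eqI) (simp add: dvar_mult algebra_simps)

lemma dd_mm: "dd i * mm j = mm j * dd i + (if i = j then 1 else 0)"
  unfolding dd_mul dvar_var by (simp add: mul_hom)

lemma dd_commute: "dd i * dd j = (dd j * dd i :: 'a::field_char_0 endo)"
proof (intro endo_eqI poly3_eqI)
  fix f :: "'a poly3" and a b c
  show "coeff3 (app (dd i * dd j) f) a b c = coeff3 (app (dd j * dd i) f) a b c"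
    by (cases i; cases j; simp add: coeff3_dvar algebra_simps)
qed

definition vfield :: "axis \<Rightarrow> axis \<Rightarrow> 'a::field_char_0 endo" where
  "vfield i j = mm i * dd j"

lemma vfield_mult: "vfield i j * vfield k l = mm i * mm k * (dd j * dd l) + (if j = k then vfield i l else 0)"
proof -
  have "vfield i j * vfield k l = mm i * (dd j * mm k) * dd l" by (simp add: vfield_def mult.assoc)
  also have "\<dots> = mm i * mm k * (dd j * dd l) + (if j = k then vfield i l else 0)"
    unfolding dd_mm by (simp add: vfield_def distrib_left distrib_right mult.assoc)
  finally show ?thesis .
qed

text \<open>After normal ordering the second-order parts of the two products agree, because
  multiplications commute and so do partial derivatives. What is left are the relations of the
  matrix units of gl_3.\<close>

lemma vfield_commutator:
  "vfield i j * vfield k l - vfield k l * vfield i j = (if j = k then vfield i l else 0) - (if i = l then vfield k j else (0 :: 'a::field_char_0 endo))"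
proof -
  have "mm k * mm i * (dd l * dd j) = (mm i * mm k * (dd j * dd l) :: 'a endo)"
    by (metis dd_commute mul_commute)
  then show ?thesis unfolding vfield_mult by auto
qed

section \<open>Forms of a fixed degree\<close>

definition homog_indices :: "nat \<Rightarrow> (nat \<times> nat \<times> nat) set" where
  "homog_indices n = {(a, b, c). a + b + c = n}"

lemma finite_homog_indices [simp]: "finite (homog_indices n)"
  by (rule finite_subset[of _ "{..n} \<times> {..n} \<times> {..n}"]) (auto simp: homog_indices_def)

definition hproj :: "nat \<Rightarrow> 'a::comm_ring_1 endo" where
  "hproj n = Endo (\<lambda>f. \<Sum>(a, b, c)\<in>homog_indices n. cst (coeff3 f a b c) * mon3 a b c)"

lemma app_hproj: "app (hproj n) f = (\<Sum>(a, b, c)\<in>homog_indices n. cst (coeff3 f a b c) * mon3 a b c)"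
  unfolding hproj_def
  by (subst app_Endo) (simp_all add: case_prod_beta sum.distrib sum_distrib_left distrib_right mult.assoc)

lemma coeff3_hproj: "coeff3 (app (hproj n) f) a b c = (if a + b + c = n then coeff3 f a b c else 0)"
proof -
  have "coeff3 (app (hproj n) f) a b c = (\<Sum>x\<in>homog_indices n. if x = (a, b, c) then coeff3 f a b c else 0)"
    unfolding app_hproj coeff3_sum by (intro sum.cong refl) (auto simp: coeff3_mon3 split: if_splits)
  also have "\<dots> = (if a + b + c = n then coeff3 f a b c else 0)"
    using finite_homog_indices[of n] by (simp add: sum.delta) (simp add: homog_indices_def)
  finally show ?thesis .
qed

lemma hproj_idem: "hproj n * hproj n = hproj n"
  by (intro endo_eqI poly3_eqI) (simp add: coeff3_hproj)

lemma coeff3_vfield: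
  "coeff3 (app (vfield i j) f) a b c = (case i of
      AX \<Rightarrow> if a = 0 then 0 else coeff3 (dvar j f) (a - 1) b c
    | AY \<Rightarrow> if b = 0 then 0 else coeff3 (dvar j f) a (b - 1) c
    | AZ \<Rightarrow> if c = 0 then 0 else coeff3 (dvar j f) a b (c - 1))"
  by (simp add: vfield_def coeff3_var)

lemma hproj_vfield: "hproj n * vfield i j = (vfield i j * hproj n :: 'a::field_char_0 endo)"
proof (intro endo_eqI poly3_eqI)
  fix f :: "'a poly3" and a b c
  show "coeff3 (app (hproj n * vfield i j) f) a b c = coeff3 (app (vfield i j * hproj n) f) a b c"
    by (cases i; cases j; cases a; cases b; cases c) (auto simp: coeff3_hproj coeff3_vfield coeff3_dvar)
qed

text \<open>The matrix unit E_ij of gl_3 acting on forms of degree \<open>n\<close>. The projection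
  makes it nilpotent for \<open>i \<noteq> j\<close>; on all polynomials no power of x_i d/dx_j
  vanishes.\<close>

definition elem_op :: "nat \<Rightarrow> axis \<Rightarrow> axis \<Rightarrow> 'a::field_char_0 endo" where
  "elem_op n i j = vfield i j * hproj n"

lemma hproj_elem_op [simp]: "hproj n * elem_op n i j = elem_op n i j" "elem_op n i j * hproj n = elem_op n i j"
proof -
  show "elem_op n i j * hproj n = elem_op n i j" by (simp add: elem_op_def mult.assoc hproj_idem)
  have "hproj n * elem_op n i j = hproj n * vfield i j * hproj n" by (simp add: elem_op_def mult.assoc)
  also have "\<dots> = elem_op n i j" unfolding hproj_vfield by (simp add: elem_op_def mult.assoc hproj_idem)
  finally show "hproj n * elem_op n i j = elem_op n i j" .
qed

lemma elem_op_mult: "elem_op n i j * elem_op n k l = vfield i j * vfield k l * hproj n"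
proof -
  have "elem_op n i j * elem_op n k l = vfield i j * (hproj n * elem_op n k l)" by (simp add: elem_op_def mult.assoc)
  then show ?thesis by (simp only: hproj_elem_op) (simp add: elem_op_def mult.assoc)
qed

lemma elem_op_commutator:
  "elem_op n i j * elem_op n k l - elem_op n k l * elem_op n i j = (if j = k then elem_op n i l else 0) - (if i = l then elem_op n k j else 0)"
proof -
  have "elem_op n i j * elem_op n k l - elem_op n k l * elem_op n i j = (vfield i j * vfield k l - vfield k l * vfield i j) * hproj n"
    by (simp add: elem_op_mult left_diff_distrib)
  also have "\<dots> = (if j = k then elem_op n i l else 0) - (if i = l then elem_op n k j else 0)"
    unfolding vfield_commutator by (simp add: elem_op_def left_diff_distrib)
  finally show ?thesis .
qed

section \<open>Exponentials of nilpotent operators\<close>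


definition ad :: "'r::ring_1 \<Rightarrow> 'r \<Rightarrow> 'r" where
  "ad N T = N * T - T * N"

definition divpow :: "'a::field_char_0 endo \<Rightarrow> nat \<Rightarrow> 'a endo" where
  "divpow N k = sc (1 / fact k) * N ^ k"

lemma sc_mult: "sc x * (sc y * L) = sc (x * y) * L"
  by (rule endo_eqI) (simp add: mult.assoc)

lemma sc_left_commute: "L * (sc c * M) = sc c * (L * M)"
  by (metis mult.assoc sc_commute)

lemma sc_inject: "c \<noteq> 0 \<Longrightarrow> sc (c :: 'a::field_char_0) * L = sc c * M \<longleftrightarrow> L = M"
  by (metis cst_hom(2) left_inverse mul_hom(2) mult_1 sc_mult)

lemma sc_2: "sc (2 :: 'a::field_char_0) * L = L + L"
proof -
  have "sc (1 + 1 :: 'a) * L = L + L" by (simp only: cst_hom mul_hom distrib_right mult_1_left)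
  then show ?thesis by (simp only: one_add_one)
qed

lemma divpow_0 [simp]: "divpow N 0 = 1"
  by (simp add: divpow_def mul_hom)

lemma divpow_1 [simp]: "divpow N (Suc 0) = N"
  by (simp add: divpow_def mul_hom)

lemma divpow_Suc: "sc (of_nat (Suc k)) * divpow N (Suc k) = N * divpow N k"
  unfolding divpow_def sc_mult sc_left_commute[of N]
  by (simp add: fact_Suc del: of_nat_Suc cst_hom)

lemma divpow_zero: "N ^ Suc m = 0 \<Longrightarrow> m < k \<Longrightarrow> divpow N k = 0"
  unfolding divpow_def by (metis Suc_leI le_iff_add mult_zero_left mult_zero_right power_add)

lemma divpow_mult: "divpow N k * divpow N l = sc (of_nat (k + l choose k)) * divpow N (k + l)"
proof -
  have "divpow N k * divpow N l = sc (1 / fact k * (1 / fact l)) * N ^ (k + l)"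
    by (simp add: divpow_def sc_left_commute[of "N ^ k"] sc_mult mult.assoc power_add del: cst_hom)
  also have "1 / fact k * (1 / fact l) = (of_nat (k + l choose k) * (1 / fact (k + l)) :: 'a)"
    by (simp add: binomial_fact field_simps)
  finally show ?thesis by (simp add: divpow_def sc_mult del: cst_hom)
qed

text \<open>The truncation at \<open>m\<close> is exact when \<open>N ^ Suc m = 0\<close>.\<close>

definition exp_op :: "nat \<Rightarrow> 'a::field_char_0 endo \<Rightarrow> 'a \<Rightarrow> 'a endo" where
  "exp_op m N s = (\<Sum>k\<le>m. sc (s ^ k) * divpow N k)"

lemma sc_sum: "sc (sum h S) = (\<Sum>x\<in>S. sc (h x))"
  by (induction S rule: infinite_finite_induct) (simp_all add: mul_hom)

text \<open>On the square of index pairs the terms with \<open>k + l > m\<close> vanish by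
  nilpotency; the remaining triangle is summed along its diagonals with the binomial
  theorem.\<close>

lemma exp_op_add:
  assumes N: "N ^ Suc m = 0"
  shows "exp_op m N s * exp_op m N t = exp_op m N (s + t)"
proof -
  let ?f = "\<lambda>k l. sc (s ^ k * t ^ l * of_nat (k + l choose k)) * divpow N (k + l)"
  have "exp_op m N s * exp_op m N t = (\<Sum>k\<le>m. \<Sum>l\<le>m. ?f k l)"
    unfolding exp_op_def sum_product
    by (simp add: sc_left_commute[of "divpow N _"] sc_mult mult.assoc divpow_mult del: cst_hom)
  also have "\<dots> = (\<Sum>(k, l)\<in>{..m} \<times> {..m}. ?f k l)" by (simp add: sum.cartesian_product)
  also have "\<dots> = (\<Sum>(k, l)\<in>{(k, l). k + l \<le> m}. ?f k l)"
  proof (rule sum.mono_neutral_right)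
    show "\<forall>p\<in>{..m} \<times> {..m} - {(k, l). k + l \<le> m}. (case p of (k, l) \<Rightarrow> ?f k l) = 0"
    proof
      fix p assume "p \<in> {..m} \<times> {..m} - {(k, l). k + l \<le> m}"
      then have "m < fst p + snd p" by auto
      then show "(case p of (k, l) \<Rightarrow> ?f k l) = 0"
        using divpow_zero[OF N, of "fst p + snd p"] by (simp add: case_prod_beta)
    qed
  qed auto
  also have "\<dots> = (\<Sum>n\<le>m. \<Sum>k\<le>n. ?f k (n - k))" by (rule sum.triangle_reindex_eq)
  also have "\<dots> = exp_op m N (s + t)"
    unfolding exp_op_def
  proof (rule sum.cong[OF refl])
    fix n
    have "(\<Sum>k\<le>n. ?f k (n - k)) = sc (\<Sum>k\<le>n. s ^ k * t ^ (n - k) * of_nat (n choose k)) * divpow N n"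
      unfolding sc_sum sum_distrib_right by (rule sum.cong) auto
    then show "(\<Sum>k\<le>n. ?f k (n - k)) = sc ((s + t) ^ n) * divpow N n"
      by (simp add: binomial_ring mult_ac)
  qed
  finally show ?thesis .
qed

lemma exp_op_0: "exp_op m N 0 = 1"
proof -
  have "exp_op m N 0 = (\<Sum>k\<in>{0}. sc (0 ^ k) * divpow N k)"
    unfolding exp_op_def by (rule sum.mono_neutral_right) (auto simp: mul_hom power_0_left)
  then show ?thesis by (simp add: mul_hom)
qed

lemma exp_op_inverse: "N ^ Suc m = 0 \<Longrightarrow> exp_op m N s * exp_op m N (- s) = 1"
  "N ^ Suc m = 0 \<Longrightarrow> exp_op m N (- s) * exp_op m N s = 1"
  by (simp_all add: exp_op_add exp_op_0)

text \<open>Left multiplication by \<open>N\<close> is right multiplication by \<open>N\<close> plus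
  \<open>ad N\<close>, and the latter two commute. The binomial theorem for divided powers then
  stops after the quadratic term in \<open>ad N\<close>. Starting the index at two avoids truncated
  subtraction.\<close>

lemma divpow_times:
  assumes "ad N (ad N (ad N T)) = 0"
  shows "divpow N (Suc (Suc k)) * T
    = T * divpow N (Suc (Suc k)) + ad N T * divpow N (Suc k) + sc (1 / 2) * (ad N (ad N T) * divpow N k)"
proof -
  define T1 T2 where "T1 = ad N T" and "T2 = ad N (ad N T)"
  have c: "N * T = T * N + T1" "N * T1 = T1 * N + T2" "N * T2 = T2 * N"
    using assms unfolding T1_def T2_def ad_def by (simp_all add: algebra_simps)
  have D: "N * (divpow N j) = sc (of_nat (Suc j)) * divpow N (Suc j)" for j
    by (rule divpow_Suc[symmetric])
  have n1: "divpow N 1 * T = T * divpow N 1 + T1" by (simp add: c)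
  show "divpow N (Suc (Suc k)) * T
    = T * divpow N (Suc (Suc k)) + T1 * divpow N (Suc k) + sc (1 / 2) * (T2 * divpow N k)"
  proof (induction k)
    case 0
    have "sc 2 * (divpow N 2 * T) = N * (divpow N 1 * T)"
      using divpow_Suc[of 1 N] by (simp add: numeral_2_eq_2 mult.assoc[symmetric])
    also have "\<dots> = (N * T) * N + N * T1"
      unfolding n1 by (simp add: distrib_left mult.assoc)
    also have "\<dots> = T * (N * N) + (T1 * N + T1 * N) + T2"
      unfolding c by (simp add: distrib_right mult.assoc add.assoc)
    also have "T1 * N + T1 * N = sc 2 * (T1 * N)" by (rule sc_2[symmetric])
    also have "N * N = sc 2 * divpow N 2" using divpow_Suc[of 1 N] by (simp add: numeral_2_eq_2)
    also have "T * (sc 2 * divpow N 2) + sc 2 * (T1 * N) + T2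
      = sc 2 * (T * divpow N 2 + T1 * divpow N 1 + sc (1 / 2) * (T2 * divpow N 0))"
      by (simp add: distrib_left sc_left_commute[of T] sc_mult mul_hom del: cst_hom(4))
    finally show ?case by (simp add: sc_inject numeral_2_eq_2)
  next
    case (Suc k)
    define K where "K = (of_nat k :: 'a)"
    let ?D0 = "divpow N k" and ?D1 = "divpow N (Suc k)" and ?D2 = "divpow N (Suc (Suc k))" and ?D3 = "divpow N (Suc (Suc (Suc k)))"
    have D0: "N * ?D0 = sc (K + 1) * ?D1" and D1: "N * ?D1 = sc (K + 2) * ?D2"
      and D2: "N * ?D2 = sc (K + 3) * ?D3"
      unfolding D K_def by (simp_all add: algebra_simps del: cst_hom)
    have "sc (K + 3) * (?D3 * T) = N * (?D2 * T)" by (simp add: D2[symmetric] mult.assoc[symmetric] del: cst_hom)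
    also have "\<dots> = N * T * ?D2 + N * T1 * ?D1 + sc (1/2) * (N * T2 * ?D0)"
      unfolding Suc.IH by (simp add: distrib_left sc_left_commute[of N] mult.assoc del: cst_hom)
    also have "\<dots> = T * (N * ?D2) + T1 * ?D2 + (T1 * (N * ?D1) + T2 * ?D1) + sc (1/2) * (T2 * (N * ?D0))"
      unfolding c by (simp add: distrib_right mult.assoc)
    also have "\<dots> = sc (K + 3) * (T * ?D3) + T1 * ?D2 + (sc (K + 2) * (T1 * ?D2) + T2 * ?D1)
        + sc (1 / 2) * (sc (K + 1) * (T2 * ?D1))"
      unfolding D0 D1 D2 sc_left_commute[of T] sc_left_commute[of T1] sc_left_commute[of T2] by simp
    also have "\<dots> = sc (K + 3) * (T * ?D3) + sc (K + 3) * (T1 * ?D2) + sc (K + 3) * (sc (1 / 2) * (T2 * ?D1))"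
    proof -
      have "sc (K + 3) * (T1 * ?D2) = T1 * ?D2 + sc (K + 2) * (T1 * ?D2)"
      proof -
        have "K + 3 = 1 + (K + 2)" by simp
        then have "sc (K + 3) = 1 + sc (K + 2)" by (metis cst_hom(2,3) mul_hom(2,3))
        then show ?thesis by (simp add: distrib_right del: cst_hom)
      qed
      moreover have "sc (K + 3) * (sc (1 / 2) * (T2 * ?D1)) = T2 * ?D1 + sc (1 / 2) * (sc (K + 1) * (T2 * ?D1))"
      proof -
        have "(K + 3) * (1 / 2) = 1 + 1 / 2 * (K + 1)" by (simp add: field_simps)
        then have "sc (K + 3) * (sc (1 / 2) * (T2 * ?D1)) = sc (1 + 1 / 2 * (K + 1)) * (T2 * ?D1)"
          by (simp only: sc_mult)
        also have "\<dots> = T2 * ?D1 + sc (1 / 2 * (K + 1)) * (T2 * ?D1)"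
          by (simp only: cst_hom(2) cst_hom(3)[of 1] mul_hom distrib_right mult_1_left)
        finally show ?thesis by (simp only: sc_mult)
      qed
      ultimately show ?thesis by (simp add: add_ac)
    qed
    finally show ?case
    proof -
      assume "sc (K + 3) * (?D3 * T) = sc (K + 3) * (T * ?D3) + sc (K + 3) * (T1 * ?D2) + sc (K + 3) * (sc (1 / 2) * (T2 * ?D1))"
      then have *: "sc (K + 3) * (?D3 * T) = sc (K + 3) * (T * ?D3 + T1 * ?D2 + sc (1 / 2) * (T2 * ?D1))"
        by (simp only: distrib_left)
      have "K + 3 = of_nat (k + 3)" by (simp add: K_def)
      then have "K + 3 \<noteq> 0" by (metis add_is_0 of_nat_eq_0_iff zero_neq_numeral)
      from * show ?thesis unfolding sc_inject[OF \<open>K + 3 \<noteq> 0\<close>] .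
    qed
  qed
qed

text \<open>This is exp(s N) T exp(- s N) = exp(s ad N) T, with the series on the right ending at
  s^2.\<close>

lemma exp_op_times:
  assumes N: "N ^ Suc m = 0" and T: "ad N (ad N (ad N T)) = 0"
  shows "exp_op m N s * T = (T + sc s * ad N T + sc (s ^ 2 / 2) * ad N (ad N T)) * exp_op m N s"
proof -
  \<comment> \<open>The three sums that arise have upper limits m, m + 1 and m + 2; by nilpotency
    they all give the same exponential.\<close>
  have ext: "exp_op m N s = exp_op m' N s" if "m \<le> m'" for m'
    unfolding exp_op_def by (rule sum.mono_neutral_left) (use that divpow_zero[OF N] in auto)
  have c: "N * T = T * N + ad N T"
    unfolding ad_def by (simp add: algebra_simps)
  let ?d = "\<lambda>k. sc (s ^ k) * divpow N k"
  have "exp_op m N s * T = (\<Sum>k\<le>Suc (Suc m). ?d k * T)"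
    unfolding ext[of "Suc (Suc m)", simplified] unfolding exp_op_def sum_distrib_right ..
  also have "\<dots> = T + sc s * (T * N) + sc s * ad N T + (\<Sum>k\<le>m. ?d (Suc (Suc k)) * T)"
    unfolding sum.atMost_Suc_shift by (simp add: mult.assoc c mul_hom distrib_left add.assoc)
  also have "(\<Sum>k\<le>m. ?d (Suc (Suc k)) * T) = (\<Sum>k\<le>m. T * ?d (Suc (Suc k)))
      + (\<Sum>k\<le>m. sc s * ad N T * ?d (Suc k)) + (\<Sum>k\<le>m. sc (s ^ 2 / 2) * ad N (ad N T) * ?d k)"
    unfolding sum.distrib[symmetric]
    by (rule sum.cong[OF refl])
      (simp add: mult.assoc divpow_times[OF T] sc_left_commute[of T] sc_left_commute[of "ad N _"] sc_mult distrib_left power2_eq_square mult_ac del: cst_hom)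
  also have "T + sc s * (T * N) + sc s * ad N T + ((\<Sum>k\<le>m. T * ?d (Suc (Suc k)))
      + (\<Sum>k\<le>m. sc s * ad N T * ?d (Suc k)) + (\<Sum>k\<le>m. sc (s ^ 2 / 2) * ad N (ad N T) * ?d k))
     = (\<Sum>k\<le>Suc (Suc m). T * ?d k) + (\<Sum>k\<le>Suc m. sc s * ad N T * ?d k)
        + (\<Sum>k\<le>m. sc (s ^ 2 / 2) * ad N (ad N T) * ?d k)"
    unfolding sum.atMost_Suc_shift by (simp add: mul_hom sc_left_commute[of T] add_ac)
  also have "\<dots> = T * exp_op (Suc (Suc m)) N s + sc s * ad N T * exp_op (Suc m) N s
       + sc (s ^ 2 / 2) * ad N (ad N T) * exp_op m N s"
    by (simp only: exp_op_def sum_distrib_left)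
  also have "\<dots> = (T + sc s * ad N T + sc (s ^ 2 / 2) * ad N (ad N T)) * exp_op m N s"
    using ext[of "Suc m"] ext[of "Suc (Suc m)"] by (simp add: distrib_right)
  finally show ?thesis .
qed

section \<open>Nilpotency of the off-diagonal operators\<close>

definition exponent_of :: "axis \<Rightarrow> nat \<Rightarrow> nat \<Rightarrow> nat \<Rightarrow> nat" where
  "exponent_of i a b c = (case i of AX \<Rightarrow> a | AY \<Rightarrow> b | AZ \<Rightarrow> c)"

text \<open>Each application of x_i d/dx_j contributes a factor x_i, and the derivative in another
  variable never removes one; so the image of the k-th power is divisible by x_i^k.\<close>

lemma coeff3_vfield_power_zero:
  assumes "i \<noteq> j"
  shows "exponent_of i a b c < k \<Longrightarrow> coeff3 (app (vfield i j ^ k) f) a b c = 0"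
proof (induction k arbitrary: a b c)
  case (Suc k)
  show ?case
    using assms Suc.prems Suc.IH unfolding exponent_of_def
    by (cases i; cases j) (auto simp: coeff3_vfield coeff3_dvar)
qed simp

lemma vfield_power_hproj: "hproj n * vfield i j ^ k = vfield i j ^ k * hproj n"
  by (induction k) (simp_all, metis mult.assoc hproj_vfield)

lemma elem_op_power: "elem_op n i j ^ k * hproj n = (vfield i j ^ k * hproj n :: 'a::field_char_0 endo)"
proof (induction k)
  case (Suc k)
  have "elem_op n i j ^ Suc k * hproj n = (elem_op n i j * (elem_op n i j ^ k * hproj n) :: 'a endo)" by (simp add: mult.assoc)
  also have "\<dots> = vfield i j * (hproj n * vfield i j ^ k) * hproj n" by (simp only: Suc) (simp only: elem_op_def mult.assoc)
  also have "\<dots> = vfield i j ^ Suc k * hproj n" unfolding vfield_power_hproj by (simp add: mult.assoc hproj_idem)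
  finally show ?case .
qed simp

text \<open>A nonzero form of degree \<open>n\<close> is not divisible by x_i^(n + 1).\<close>

lemma elem_op_nilpotent: "i \<noteq> j \<Longrightarrow> (elem_op n i j :: 'a::field_char_0 endo) ^ Suc n = 0"
proof -
  assume ij: "i \<noteq> j"
  have "elem_op n i j ^ Suc n = (elem_op n i j ^ Suc n * hproj n :: 'a endo)"
    unfolding power_Suc2 mult.assoc hproj_elem_op ..
  also have "\<dots> = hproj n * vfield i j ^ Suc n" unfolding elem_op_power vfield_power_hproj ..
  also have "\<dots> = 0"
  proof (intro endo_eqI poly3_eqI)
    fix f :: "'a poly3" and a b c
    show "coeff3 (app (hproj n * vfield i j ^ Suc n) f) a b c = coeff3 (app 0 f) a b c"
      using coeff3_vfield_power_zero[OF ij, of a b c "Suc n" f]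
      by (cases i) (auto simp: coeff3_hproj exponent_of_def simp del: power_Suc)
  qed
  finally show ?thesis .
qed

section \<open>The image of the special linear Lie algebra\<close>


definition gl_op :: "nat \<Rightarrow> (axis \<Rightarrow> axis \<Rightarrow> 'a) \<Rightarrow> 'a::field_char_0 endo" where
  "gl_op n A = (\<Sum>i\<in>UNIV. \<Sum>j\<in>UNIV. sc (A i j) * elem_op n i j)"

definition trace3 :: "(axis \<Rightarrow> axis \<Rightarrow> 'a) \<Rightarrow> 'a::field_char_0" where
  "trace3 A = (\<Sum>i\<in>UNIV. A i i)"

definition sl :: "nat \<Rightarrow> 'a::field_char_0 endo set" where
  "sl n = {gl_op n A | A. trace3 A = 0}"

lemma gl_op_add: "gl_op n A + gl_op n B = gl_op n (\<lambda>i j. A i j + B i j)"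
  by (simp add: gl_op_def mul_hom distrib_right sum.distrib)

lemma gl_op_sc: "sc c * gl_op n A = gl_op n (\<lambda>i j. c * A i j)"
  by (simp add: gl_op_def sum_distrib_left sc_mult del: cst_hom)

lemma gl_op_sl: "trace3 A = 0 \<Longrightarrow> gl_op n A \<in> sl n"
  by (auto simp: sl_def)

lemma slE:
  assumes "L \<in> sl n" obtains A where "L = gl_op n A" "trace3 A = 0"
  using assms by (auto simp: sl_def)

lemma sl_zero: "0 \<in> sl n"
  using gl_op_sl[of "\<lambda>_ _. 0" n] by (simp add: trace3_def gl_op_def mul_hom)

lemma sl_add: "L \<in> sl n \<Longrightarrow> M \<in> sl n \<Longrightarrow> L + M \<in> sl n"
  by (elim slE) (auto simp: gl_op_add trace3_def sum.distrib intro!: gl_op_sl)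

lemma sl_sc: "L \<in> sl n \<Longrightarrow> sc c * L \<in> sl n"
  by (elim slE) (auto simp: gl_op_sc trace3_def sum_distrib_left[symmetric] intro!: gl_op_sl)

lemma hproj_sc_left: "hproj n * (sc c * L) = sc c * (hproj n * L)"
  by (rule sc_left_commute)

lemma hproj_gl_op [simp]: "hproj n * gl_op n A = gl_op n A" "gl_op n A * hproj n = gl_op n A"
  by (simp_all add: gl_op_def sum_distrib_left sum_distrib_right hproj_sc_left mult.assoc)

text \<open>The matrix commutator E_ij A - A E_ij.\<close>

definition ad_mat :: "axis \<Rightarrow> axis \<Rightarrow> (axis \<Rightarrow> axis \<Rightarrow> 'a::field_char_0) \<Rightarrow> axis \<Rightarrow> axis \<Rightarrow> 'a" where
  "ad_mat i j A k l = (if k = i then A j l else 0) - (if l = j then A k i else 0)"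

lemma ad_add: "ad N (S + T) = ad N S + ad N T"
  and ad_diff: "ad N (S - T) = ad N S - ad N T"
  and ad_0: "ad N 0 = 0"
  by (simp_all add: ad_def algebra_simps)

lemma ad_sc: "ad N (sc c * T) = sc c * ad N T"
  by (simp add: ad_def sc_left_commute[of N] mult.assoc right_diff_distrib)

lemma ad_elem_op: "ad (elem_op n i j) (elem_op n k l) = (if j = k then elem_op n i l else 0) - (if i = l then elem_op n k j else 0)"
  by (simp add: ad_def elem_op_commutator)

lemma ad_gl_op: "ad (elem_op n i j) (gl_op n A) = gl_op n (ad_mat i j A)"
  by (cases i; cases j; simp add: gl_op_def sum_axis ad_mat_def ad_add ad_sc ad_elem_op mul_hom algebra_simps)

lemma trace3_ad_mat: "trace3 (ad_mat i j A) = 0"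
  by (cases i; cases j; simp add: trace3_def sum_axis ad_mat_def)

lemma ad_sl: "L \<in> sl n \<Longrightarrow> ad (elem_op n i j) L \<in> sl n"
  by (elim slE) (auto simp: ad_gl_op trace3_ad_mat intro!: gl_op_sl)

text \<open>For \<open>i \<noteq> j\<close> the matrix unit squares to zero, and every term of the
  threefold commutator has it at least twice on one side. Hence conjugation by exp(t E_ij) is
  quadratic in t on \<open>sl n\<close>.\<close>

lemma ad_sl_cube: "i \<noteq> j \<Longrightarrow> L \<in> sl n \<Longrightarrow> ad (elem_op n i j) (ad (elem_op n i j) (ad (elem_op n i j) L)) = 0"
proof -
  assume ij: "i \<noteq> j" and "L \<in> sl n"
  then obtain A where L: "L = gl_op n A" by (auto simp: sl_def)
  have "ad_mat i j (ad_mat i j (ad_mat i j A)) = (\<lambda>_ _. 0)"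
    using ij by (auto simp: ad_mat_def fun_eq_iff)
  then show ?thesis unfolding L ad_gl_op by (simp add: gl_op_def mul_hom)
qed

definition sing :: "nat \<Rightarrow> 'a::field_char_0 endo \<Rightarrow> bool" where
  "sing n L \<longleftrightarrow> (\<exists>f. f \<noteq> 0 \<and> app (hproj n) f = f \<and> app L f = 0)"

text \<open>The span of \<open>sl n\<close> and \<open>T\<close> is singular. Of a singular space
  containing A the maximality argument retains only this, for one \<open>T\<close> at a
  time.\<close>

definition sl_singular :: "nat \<Rightarrow> 'a::field_char_0 endo \<Rightarrow> bool" where
  "sl_singular n T \<longleftrightarrow> (\<forall>L\<in>sl n. \<forall>s. sing n (sc s * T + L))"

text \<open>For \<open>i = j\<close> it does nothing, so that arbitrary lists of parameters can be
  folded without side conditions.\<close>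

definition conj_op :: "nat \<Rightarrow> axis \<times> axis \<times> 'a \<Rightarrow> 'a::field_char_0 endo \<Rightarrow> 'a endo" where
  "conj_op n w T = (case w of (i, j, t) \<Rightarrow> if i = j then T else exp_op n (elem_op n i j) t * T * exp_op n (elem_op n i j) (- t))"

lemma divpow_hproj: "hproj n * divpow (elem_op n i j) k = (divpow (elem_op n i j) k * hproj n :: 'a::field_char_0 endo)"
proof -
  have "hproj n * elem_op n i j ^ k = (elem_op n i j ^ k * hproj n :: 'a endo)"
  proof (induction k)
    case (Suc k)
    have "hproj n * elem_op n i j ^ Suc k = (hproj n * elem_op n i j * elem_op n i j ^ k :: 'a endo)" by (simp only: power_Suc mult.assoc)
    also have "\<dots> = elem_op n i j * hproj n * elem_op n i j ^ k" by simp
    also have "\<dots> = elem_op n i j * elem_op n i j ^ k * hproj n" by (simp only: mult.assoc Suc)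
    finally show ?case by simp
  qed simp
  then show ?thesis by (simp add: divpow_def hproj_sc_left mult.assoc)
qed

lemma exp_op_hproj: "hproj n * exp_op m (elem_op n i j) t = exp_op m (elem_op n i j) t * hproj n"
  by (simp add: exp_op_def sum_distrib_left sum_distrib_right hproj_sc_left divpow_hproj mult.assoc)

text \<open>Conjugation by exp(t E_ij) maps \<open>sl n\<close> to itself, so a pencil through the
  conjugate of \<open>T\<close> is the conjugate of a pencil through \<open>T\<close>, and the
  exponential carries kernel vectors over.\<close>

lemma sl_singular_conj_op:
  fixes T :: "'a::field_char_0 endo"
  assumes "sl_singular n T"
  shows "sl_singular n (conj_op n w T)"
proof -
  obtain i j t where w: "w = (i, j, t)" by (cases w)
  show ?thesis
  proof (cases "i = j")
    case True
    then show ?thesis using assms by (simp add: conj_op_def w)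
  next
    case False
    let ?X = "exp_op n (elem_op n i j) t" and ?Y = "exp_op n (elem_op n i j) (- t)"
    have nil: "elem_op n i j ^ Suc n = (0 :: 'a endo)" by (rule elem_op_nilpotent[OF False])
    have XY: "?X * ?Y = 1" "?Y * ?X = 1" using exp_op_inverse[OF nil] by auto
    show ?thesis unfolding sl_singular_def
    proof (intro ballI allI)
      fix L :: "'a endo" and s assume L: "L \<in> sl n"
      \<comment> \<open>The conjugate of \<open>L\<close> by the inverse exponential, written out so
        that its membership in \<open>sl n\<close> is visible.\<close>
      define L' where "L' = L + sc (- t) * ad (elem_op n i j) L + sc ((- t) ^ 2 / 2) * ad (elem_op n i j) (ad (elem_op n i j) L)"
      have L': "L' \<in> sl n" unfolding L'_def by (intro sl_add sl_sc ad_sl L)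
      have YL: "?Y * L = L' * ?Y"
        unfolding L'_def by (rule exp_op_times[OF nil ad_sl_cube[OF False L]])
      obtain f where f: "f \<noteq> 0" "app (hproj n) f = f" "app (sc s * T + L') f = 0"
        using assms L' unfolding sl_singular_def sing_def by blast
      have "?X * L' = L * ?X"
      proof -
        have "?X * L' = ?X * (L' * ?Y) * ?X" by (simp add: mult.assoc XY)
        also have "\<dots> = L * ?X" unfolding YL[symmetric] by (simp add: mult.assoc[symmetric] XY)
        finally show ?thesis .
      qed
      have "(sc s * (?X * T * ?Y) + L) * ?X = sc s * (?X * T) + L * ?X"
        by (simp add: distrib_right mult.assoc XY)
      also have "\<dots> = ?X * (sc s * T + L')"
        unfolding \<open>?X * L' = L * ?X\<close>[symmetric] by (simp add: distrib_left sc_left_commute[of ?X])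
      finally have "app ((sc s * (?X * T * ?Y) + L) * ?X) f = app (?X * (sc s * T + L')) f" by simp
      then have "app (sc s * (?X * T * ?Y) + L) (app ?X f) = 0"
        using f(3) by (simp del: app_plus add: app_ring_ops(3))
      moreover have "app ?X f \<noteq> 0"
      proof
        assume "app ?X f = 0"
        then have "app (?Y * ?X) f = 0" by simp
        then show False unfolding XY using f by simp
      qed
      moreover have "app (hproj n) (app ?X f) = app ?X f"
      proof -
        have "app (hproj n * ?X) f = app (?X * hproj n) f" by (simp only: exp_op_hproj)
        then show ?thesis using f(2) by simp
      qed
      ultimately show "sing n (sc s * conj_op n w T + L)"
        unfolding sing_def w conj_op_def using False by auto
    qed
  qed
qed

section \<open>Operators and matrices\<close>


text \<open>Determinants commute with evaluation, and a polynomial with infinitely many roots is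
  zero.\<close>

lemma det_poly_vanish:
  fixes P :: "'a::field_char_0 poly mat"
  assumes P: "P \<in> carrier_mat n n"
    and inf: "infinite {s. det (map_mat (\<lambda>p. poly p s) P) = 0}"
  shows "det (map_mat (\<lambda>p. poly p t) P) = 0"
proof -
  have h: "det (map_mat (\<lambda>p. poly p s) P) = poly (det P) s" for s
  proof -
    interpret comm_ring_hom "\<lambda>p. poly p s" by unfold_locales auto
    show ?thesis by (rule hom_det)
  qed
  have "det P = 0"
  proof (rule ccontr)
    assume "det P \<noteq> 0"
    then have "finite {s. poly (det P) s = 0}" by (rule poly_roots_finite)
    then show False using inf by (simp add: h)
  qed
  then show ?thesis by (simp add: h)
qed

lemma det_pencil_vanish:
  fixes A T :: "'a::field_char_0 mat"
  assumes A: "A \<in> carrier_mat n n" "T \<in> carrier_mat n n"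
    and inf: "infinite {s. det (A + s \<cdot>\<^sub>m T) = 0}"
  shows "det A = 0"
proof -
  define P where "P = mat n n (\<lambda>(i, j). [:A $$ (i, j), T $$ (i, j):])"
  have "map_mat (\<lambda>p. poly p s) P = A + s \<cdot>\<^sub>m T" for s
    by (rule eq_matI) (use A in \<open>auto simp: P_def\<close>)
  moreover have "A + 0 \<cdot>\<^sub>m T = A" by (rule eq_matI) (use A in auto)
  ultimately show ?thesis
    using det_poly_vanish[of P n 0] inf by (simp add: P_def)
qed

lemma diagonal_pencil_vanish:
  fixes A T :: "'a::field_char_0 mat"
  assumes A: "A \<in> carrier_mat n n" "T \<in> carrier_mat n n" and i0: "i0 < n"
    and diag: "\<And>i j. i < n \<Longrightarrow> j < n \<Longrightarrow> i \<noteq> j \<Longrightarrow> A $$ (i, j) = 0"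
    and zero: "\<And>i. i < n \<Longrightarrow> A $$ (i, i) = 0 \<longleftrightarrow> i = i0"
    and sing: "\<And>s. det (A + s \<cdot>\<^sub>m T) = 0"
  shows "T $$ (i0, i0) = 0"
proof -
  (* Row i0 of A + s T is s times that of T; dividing it by s leaves a matrix whose determinant at s = 0
     is a nonzero multiple of the (i0, i0) entry of T. *)
  define P where "P = mat n n (\<lambda>(i, j). if i = i0 then [:T $$ (i, j):] else [:A $$ (i, j), T $$ (i, j):])"
  define Q where "Q s = map_mat (\<lambda>p. poly p s) P" for s
  have Q: "Q s \<in> carrier_mat n n" for s by (simp add: Q_def P_def)
  have ent: "(Q s *\<^sub>v v) $ i = (\<Sum>j<n. (if i = i0 then T $$ (i, j) else A $$ (i, j) + s * T $$ (i, j)) * v $ j)"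
    if "i < n" "v \<in> carrier_vec n" for s v i
    using that by (simp add: Q_def P_def scalar_prod_def lessThan_atLeast0 if_distrib cong: if_cong)
      (auto intro!: sum.cong)
  have "det (Q s) = 0" if s: "s \<noteq> 0" for s
  proof -
    \<comment> \<open>For nonzero s a kernel vector of the pencil also lies in the kernel of
      \<open>Q s\<close>, since the two matrices differ only by the factor s in row
      \<open>i0\<close>.\<close>
    obtain v where v: "v \<in> carrier_vec n" "v \<noteq> 0\<^sub>v n" "(A + s \<cdot>\<^sub>m T) *\<^sub>v v = 0\<^sub>v n"
      using sing[of s] det_0_iff_vec_prod_zero[of "A + s \<cdot>\<^sub>m T" n] A by auto
    have row: "(\<Sum>j<n. (A $$ (i, j) + s * T $$ (i, j)) * v $ j) = 0" if "i < n" for i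
    proof -
      have "((A + s \<cdot>\<^sub>m T) *\<^sub>v v) $ i = (\<Sum>j<n. (A $$ (i, j) + s * T $$ (i, j)) * v $ j)"
        using that A v(1) by (auto simp: scalar_prod_def lessThan_atLeast0 intro!: sum.cong)
      then show ?thesis using v(3) that by simp
    qed
    have "A $$ (i0, j) = 0" if "j < n" for j using diag[OF i0 that] zero[OF i0] by (cases "j = i0") auto
    then have "s * (\<Sum>j<n. T $$ (i0, j) * v $ j) = 0"
      using row[OF i0] by (simp add: sum_distrib_left mult.assoc)
    then have "(\<Sum>j<n. T $$ (i0, j) * v $ j) = 0" using s by simp
    then have "Q s *\<^sub>v v = 0\<^sub>v n"
    proof (intro eq_vecI)
      fix i assume "i < dim_vec (0\<^sub>v n :: 'a vec)"
      then have i: "i < n" by simp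
      show "(Q s *\<^sub>v v) $ i = 0\<^sub>v n $ i"
        unfolding ent[OF i v(1)] using row[OF i] i \<open>(\<Sum>j<n. T $$ (i0, j) * v $ j) = 0\<close>
        by (cases "i = i0") simp_all
    qed (use Q[of s] in auto)
    then show ?thesis using det_0_iff_vec_prod_zero[OF Q] v by blast
  qed
  then have "{s. s \<noteq> 0} \<subseteq> {s. det (Q s) = 0}" by auto
  moreover have "infinite {s::'a. s \<noteq> 0}"
  proof -
    have "{s::'a. s \<noteq> 0} = UNIV - {0}" by auto
    then show ?thesis using infinite_UNIV_char_0[where 'a='a] by (simp add: infinite_remove)
  qed
  ultimately have "infinite {s. det (Q s) = 0}" by (meson finite_subset)
  then have "det (Q 0) = 0"
    using det_poly_vanish[of P n 0] unfolding Q_def by (simp add: P_def)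
  then obtain v where v: "v \<in> carrier_vec n" "v \<noteq> 0\<^sub>v n" "Q 0 *\<^sub>v v = 0\<^sub>v n"
    using det_0_iff_vec_prod_zero[OF Q] by blast
  \<comment> \<open>At s = 0 the other rows are those of the diagonal matrix \<open>A\<close>,
    nonzero on the diagonal, so the kernel vector is supported at \<open>i0\<close>.\<close>
  have v0: "v $ i = 0" if i: "i < n" "i \<noteq> i0" for i
  proof -
    have "0 = (\<Sum>j<n. A $$ (i, j) * v $ j)" using ent[OF i(1) v(1), of 0] v(3) i by simp
    also have "\<dots> = (\<Sum>j\<in>{i}. A $$ (i, j) * v $ j)"
      by (rule sum.mono_neutral_right) (use i diag in auto)
    finally show ?thesis using zero[OF i(1)] i by simp
  qed
  have "0 = (\<Sum>j<n. T $$ (i0, j) * v $ j)" using ent[OF i0 v(1), of 0] v(3) i0 by simp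
  also have "\<dots> = (\<Sum>j\<in>{i0}. T $$ (i0, j) * v $ j)"
    by (rule sum.mono_neutral_right) (use i0 v0 in auto)
  finally have "T $$ (i0, i0) * v $ i0 = 0" by simp
  moreover have "v $ i0 \<noteq> 0"
  proof
    assume "v $ i0 = 0"
    then have "v $ i = 0" if "i < n" for i using v0[OF that] by (cases "i = i0") auto
    then have "v = 0\<^sub>v n" using v(1) by (intro eq_vecI) auto
    then show False using v(2) by simp
  qed
  ultimately show ?thesis by simp
qed

section \<open>Matrices of operators in the monomial basis\<close>

definition coeff_at :: "'a::comm_ring_1 poly3 \<Rightarrow> nat \<times> nat \<times> nat \<Rightarrow> 'a" where
  "coeff_at f x = coeff3 f (fst x) (fst (snd x)) (snd (snd x))"

definition mon_at :: "nat \<times> nat \<times> nat \<Rightarrow> 'a::comm_ring_1 poly3" where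
  "mon_at x = mon3 (fst x) (fst (snd x)) (snd (snd x))"

lemma coeff_at_mon_at: "coeff_at (mon_at x) y = (if x = y then 1 else 0)"
  by (auto simp: coeff_at_def mon_at_def coeff3_mon3 prod_eq_iff)

lemma coeff_at_simps [simp]:
  "coeff_at 0 x = 0" "coeff_at (f + g) x = coeff_at f x + coeff_at g x" "coeff_at (f - g) x = coeff_at f x - coeff_at g x"
  "coeff_at (cst k * f) x = k * coeff_at f x"
  by (simp_all add: coeff_at_def)

lemma coeff_at_sum: "coeff_at (sum h S) x = (\<Sum>s\<in>S. coeff_at (h s) x)"
  by (simp add: coeff_at_def coeff3_sum)

lemma coeff_at_eqI: "(\<And>x. coeff_at f x = coeff_at g x) \<Longrightarrow> f = g"
  by (rule poly3_eqI) (metis coeff_at_def fst_conv snd_conv)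

lemma app_hproj_coeff_at: "app (hproj n) f = (\<Sum>x\<in>homog_indices n. cst (coeff_at f x) * mon_at x)"
  by (simp add: app_hproj coeff_at_def mon_at_def case_prod_beta)

lemma coeff_at_hproj: "coeff_at (app (hproj n) f) x = (if x \<in> homog_indices n then coeff_at f x else 0)"
  by (cases x) (simp add: coeff_at_def coeff3_hproj homog_indices_def)

lemma app_eq_sum: "app (L * hproj n) f = (\<Sum>x\<in>homog_indices n. cst (coeff_at f x) * app L (mon_at x))"
  by (simp add: app_hproj_coeff_at app_sum)

definition ndim :: "nat \<Rightarrow> nat" where
  "ndim n = card (homog_indices n)"

text \<open>The choice of enumeration is immaterial: only its bijectivity is used.\<close>

definition index_enum :: "nat \<Rightarrow> nat \<Rightarrow> nat \<times> nat \<times> nat" where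
  "index_enum n = (SOME h. bij_betw h {..<ndim n} (homog_indices n))"

lemma index_enum_bij: "bij_betw (index_enum n) {..<ndim n} (homog_indices n)"
proof -
  have "\<exists>h. bij_betw h {..<ndim n} (homog_indices n)"
    using ex_bij_betw_nat_finite[of "homog_indices n"] by (simp add: ndim_def lessThan_atLeast0)
  then show ?thesis unfolding index_enum_def by (rule someI_ex)
qed

lemma index_enum_in: "r < ndim n \<Longrightarrow> index_enum n r \<in> homog_indices n"
  using index_enum_bij[of n] by (auto simp: bij_betw_def)

lemma index_enum_inj: "r < ndim n \<Longrightarrow> c < ndim n \<Longrightarrow> index_enum n r = index_enum n c \<longleftrightarrow> r = c"
  using index_enum_bij[of n] by (auto simp: bij_betw_def inj_on_def)

lemma index_enum_surj: "x \<in> homog_indices n \<Longrightarrow> \<exists>r<ndim n. index_enum n r = x"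
  using index_enum_bij[of n] unfolding bij_betw_def by (metis imageE lessThan_iff)

lemma sum_index_enum: "(\<Sum>x\<in>homog_indices n. h x) = (\<Sum>r<ndim n. h (index_enum n r))"
  using sum.reindex_bij_betw[OF index_enum_bij] by metis

definition mat_of :: "nat \<Rightarrow> 'a::comm_ring_1 endo \<Rightarrow> 'a mat" where
  "mat_of n L = mat (ndim n) (ndim n) (\<lambda>(r, c). coeff_at (app L (mon_at (index_enum n c))) (index_enum n r))"

text \<open>Inverse of \<open>mat_of\<close> on the corner; monomials of degrees other than
  \<open>n\<close> are sent to zero.\<close>

definition op_of :: "nat \<Rightarrow> 'a::comm_ring_1 mat \<Rightarrow> 'a endo" where
  "op_of n M = Endo (\<lambda>f. \<Sum>r<ndim n. \<Sum>c<ndim n. cst (M $$ (r, c) * coeff_at f (index_enum n c)) * mon_at (index_enum n r))"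

lemma app_op_of:
  "app (op_of n M) f = (\<Sum>r<ndim n. \<Sum>c<ndim n. cst (M $$ (r, c) * coeff_at f (index_enum n c)) * mon_at (index_enum n r))"
  unfolding op_of_def
  by (subst app_Endo) (simp_all add: sum.distrib sum_distrib_left distrib_left distrib_right mult.assoc mult.left_commute)

lemma mat_of_carrier [simp]: "mat_of n L \<in> carrier_mat (ndim n) (ndim n)"
  by (simp add: mat_of_def)

lemma mat_of_linear:
  "mat_of n (L + M) = mat_of n L + mat_of n M" "mat_of n (sc k * L) = k \<cdot>\<^sub>m mat_of n L"
  "mat_of n 0 = 0\<^sub>m (ndim n) (ndim n)"
  by (rule eq_matI; simp add: mat_of_def)+

lemma coeff_at_op_of_mon_at:
  assumes "c < ndim n" "r < ndim n"
  shows "coeff_at (app (op_of n M) (mon_at (index_enum n c))) (index_enum n r) = M $$ (r, c)"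
proof -
  have "coeff_at (app (op_of n M) (mon_at (index_enum n c))) (index_enum n r)
    = (\<Sum>r'<ndim n. \<Sum>c'<ndim n. if r' = r \<and> c' = c then M $$ (r, c) else 0)"
    unfolding app_op_of coeff_at_sum
    by (intro sum.cong refl) (use assms in \<open>auto simp: coeff_at_mon_at index_enum_inj\<close>)
  also have "\<dots> = (\<Sum>r'<ndim n. if r' = r then M $$ (r, c) else 0)"
    by (intro sum.cong refl) (use assms in auto)
  finally show ?thesis using assms by simp
qed

lemma mat_of_op_of: "M \<in> carrier_mat (ndim n) (ndim n) \<Longrightarrow> mat_of n (op_of n M) = M"
  by (rule eq_matI) (simp_all add: mat_of_def coeff_at_op_of_mon_at)

lemma op_of_corner: "hproj n * op_of n M = op_of n M" "op_of n M * hproj n = op_of n M"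
proof -
  have 1: "app (hproj n) (mon_at (index_enum n r)) = mon_at (index_enum n r)" if "r < ndim n" for r
    by (rule coeff_at_eqI) (use index_enum_in[OF that] in \<open>auto simp: coeff_at_hproj coeff_at_mon_at\<close>)
  show "hproj n * op_of n M = op_of n M"
    by (rule endo_eqI) (simp add: app_op_of app_sum 1 del: cst_hom)
  show "op_of n M * hproj n = op_of n M"
    by (rule endo_eqI) (simp add: app_op_of coeff_at_hproj index_enum_in del: cst_hom)
qed

lemma corner_eqI:
  assumes "L * hproj n = L" "hproj n * L = L" "M * hproj n = M" "hproj n * M = M"
    and "\<And>x y. x \<in> homog_indices n \<Longrightarrow> y \<in> homog_indices n \<Longrightarrow> coeff_at (app L (mon_at x)) y = coeff_at (app M (mon_at x)) y"
  shows "L = M"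
proof -
  have z: "coeff_at (app L f) y = 0 \<and> coeff_at (app M f) y = 0" if "y \<notin> homog_indices n" for y f
  proof -
    have "app L f = app (hproj n) (app L f)" "app M f = app (hproj n) (app M f)"
      using app_ring_ops(6)[of "hproj n" L f] app_ring_ops(6)[of "hproj n" M f] unfolding assms(2,4) by auto
    then show ?thesis using that coeff_at_hproj[of n "app L f" y] coeff_at_hproj[of n "app M f" y] by simp
  qed
  have "app L (mon_at x) = app M (mon_at x)" if "x \<in> homog_indices n" for x
  proof (rule coeff_at_eqI)
    fix y show "coeff_at (app L (mon_at x)) y = coeff_at (app M (mon_at x)) y"
      using assms(5)[OF that, of y] z[of y] by (cases "y \<in> homog_indices n") simp_all
  qed
  then have "app (L * hproj n) f = app (M * hproj n) f" for f
    unfolding app_eq_sum by simp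
  then show ?thesis using assms(1,3) by (intro endo_eqI) simp
qed

lemma op_of_mat_of:
  assumes "L * hproj n = L" "hproj n * L = L"
  shows "op_of n (mat_of n L) = L"
proof (rule corner_eqI[OF op_of_corner(2,1) assms])
  fix x y assume "x \<in> homog_indices n" "y \<in> homog_indices n"
  then obtain r c where "r < ndim n" "c < ndim n" "x = index_enum n c" "y = index_enum n r" using index_enum_surj by metis
  then show "coeff_at (app (op_of n (mat_of n L)) (mon_at x)) y = coeff_at (app L (mon_at x)) y"
    by (simp add: coeff_at_op_of_mon_at) (simp add: mat_of_def)
qed

text \<open>Coordinates translate kernel vectors into forms of degree \<open>n\<close> and back.
  Since \<open>L\<close> maps into the forms of degree \<open>n\<close>, an image is zero as soon as
  its coordinates of that degree are.\<close>

lemma sing_iff_det: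
  fixes L :: "'a::field_char_0 endo"
  assumes "L * hproj n = L" "hproj n * L = L"
  shows "sing n L \<longleftrightarrow> det (mat_of n L) = 0"
proof -
  have mv: "(mat_of n L *\<^sub>v v) $ r = coeff_at (app L (\<Sum>c<ndim n. cst (v $ c) * mon_at (index_enum n c))) (index_enum n r)"
    if "r < ndim n" "v \<in> carrier_vec (ndim n)" for r v
  proof -
    have "(mat_of n L *\<^sub>v v) $ r = (\<Sum>c<ndim n. coeff_at (app L (mon_at (index_enum n c))) (index_enum n r) * v $ c)"
      using that by (simp add: mat_of_def scalar_prod_def lessThan_atLeast0)
    also have "\<dots> = coeff_at (app L (\<Sum>c<ndim n. cst (v $ c) * mon_at (index_enum n c))) (index_enum n r)"
      unfolding app_sum coeff_at_sum app_cst coeff_at_simps by (intro sum.cong refl mult.commute)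
    finally show ?thesis .
  qed
  have 1: "det (mat_of n L) = 0" if s: "sing n L"
  proof -
    obtain f where f: "f \<noteq> 0" "app (hproj n) f = f" "app L f = 0"
      using s[unfolded sing_def] by (elim exE conjE)
    define v where "v = vec (ndim n) (\<lambda>r. coeff_at f (index_enum n r))"
    have fv: "f = (\<Sum>c<ndim n. cst (v $ c) * mon_at (index_enum n c))"
    proof -
      have "f = app (hproj n) f" using f(2) by simp
      also have "\<dots> = (\<Sum>c<ndim n. cst (v $ c) * mon_at (index_enum n c))"
        unfolding app_hproj_coeff_at sum_index_enum by (intro sum.cong) (simp_all add: v_def)
      finally show ?thesis .
    qed
    have "mat_of n L *\<^sub>v v = 0\<^sub>v (ndim n)"
    proof (rule eq_vecI)
      fix r assume "r < dim_vec (0\<^sub>v (ndim n) :: 'a vec)"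
      then have "r < ndim n" by simp
      moreover have "v \<in> carrier_vec (ndim n)" by (simp add: v_def)
      ultimately have "(mat_of n L *\<^sub>v v) $ r = coeff_at (app L f) (index_enum n r)"
        using mv[of r v] unfolding fv[symmetric] by blast
      then show "(mat_of n L *\<^sub>v v) $ r = 0\<^sub>v (ndim n) $ r"
        unfolding f(3) using \<open>r < ndim n\<close> by simp
    qed (simp add: mat_of_def)
    moreover have "v \<noteq> 0\<^sub>v (ndim n)"
    proof
      assume "v = 0\<^sub>v (ndim n)"
      then have "f = 0" using fv by simp
      then show False using f by simp
    qed
    ultimately show ?thesis
      using det_0_iff_vec_prod_zero[OF mat_of_carrier, of n L] vec_carrier[of "ndim n"]
      unfolding v_def by blast
  qed
  have 2: "sing n L" if d: "det (mat_of n L) = 0"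
  proof -
    obtain v where v: "v \<in> carrier_vec (ndim n)" "v \<noteq> 0\<^sub>v (ndim n)" "mat_of n L *\<^sub>v v = 0\<^sub>v (ndim n)"
      using d det_0_iff_vec_prod_zero[OF mat_of_carrier, of n L] by blast
    define f where "f = (\<Sum>c<ndim n. cst (v $ c) * mon_at (index_enum n c))"
    have coeff3: "coeff_at f (index_enum n r) = v $ r" if "r < ndim n" for r
    proof -
      have "coeff_at f (index_enum n r) = (\<Sum>c<ndim n. if c = r then v $ r else 0)"
        unfolding f_def coeff_at_sum by (intro sum.cong refl) (use that in \<open>auto simp: coeff_at_mon_at index_enum_inj\<close>)
      then show ?thesis using that by simp
    qed
    have "f \<noteq> 0"
    proof
      assume "f = 0"
      then have "v = 0\<^sub>v (ndim n)" using coeff3 v(1) by (intro eq_vecI) auto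
      then show False using v(2) by simp
    qed
    moreover have "app (hproj n) f = f"
    proof -
      have "app (hproj n) f = (\<Sum>c<ndim n. cst (v $ c) * mon_at (index_enum n c))"
        unfolding app_hproj_coeff_at sum_index_enum by (intro sum.cong) (simp_all add: coeff3)
      then show ?thesis by (simp only: f_def)
    qed
    moreover have "app L f = 0"
    proof (rule coeff_at_eqI)
      fix x
      show "coeff_at (app L f) x = coeff_at 0 x"
      proof (cases "x \<in> homog_indices n")
        case True
        then obtain r where r: "r < ndim n" "x = index_enum n r" using index_enum_surj by blast
        then show ?thesis using mv[OF r(1) v(1)] unfolding v(3) f_def[symmetric] by simp
      next
        case False
        then show ?thesis using coeff_at_hproj[of n "app L f" x] assms(2) app_ring_ops(6)[of "hproj n" L f] by simp
      qed
    qed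
    ultimately show ?thesis unfolding sing_def by (intro exI[of _ f]) simp
  qed
  show ?thesis using 1 2 by (rule iffI)
qed

section \<open>Singularity\<close>


text \<open>The derivation before restriction to one degree: the Leibniz rule relates forms of
  different degrees, so it has to be used here and not for \<open>gl_op n\<close>.\<close>

definition gl_field :: "(axis \<Rightarrow> axis \<Rightarrow> 'a) \<Rightarrow> 'a::field_char_0 endo" where
  "gl_field A = (\<Sum>i\<in>UNIV. \<Sum>j\<in>UNIV. sc (A i j) * vfield i j)"

lemma gl_op_gl_field: "gl_op n A = gl_field A * hproj n"
  by (simp add: gl_op_def gl_field_def elem_op_def sum_distrib_right mult.assoc)

lemma app_gl_field: "app (gl_field A) f = (\<Sum>i\<in>UNIV. \<Sum>j\<in>UNIV. cst (A i j) * (var i * dvar j f))"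
  by (simp add: gl_field_def app_sum_left vfield_def)

lemma app_gl_field_mult: "app (gl_field A) (f * g) = app (gl_field A) f * g + f * app (gl_field A) g"
  by (simp add: app_gl_field dvar_mult sum_axis algebra_simps)

lemma app_gl_field_cst [simp]: "app (gl_field A) (cst c) = 0"
  using app_cst[of "gl_field A" c 1] app_gl_field_mult[of A 1 1] by simp

lemma app_gl_field_var: "app (gl_field A) (var j) = cst (A AX j) * var AX + cst (A AY j) * var AY + cst (A AZ j) * var AZ"
  by (cases j; simp add: app_gl_field dvar_var sum_axis)

text \<open>Powers of an eigenvector of a derivation are again eigenvectors. This is used for the
  Euler field, where it gives the degree of a power, and with c = 0 for the derivation that kills
  its Wronskian.\<close>

lemma app_gl_field_power: "app (gl_field A) f = cst c * f \<Longrightarrow> app (gl_field A) (f ^ k) = cst (of_nat k * c) * f ^ k"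
proof (induction k)
  case 0
  show ?case using app_gl_field_cst[of A 1] by simp
next
  case (Suc k)
  have "app (gl_field A) (f ^ Suc k) = cst c * f * f ^ k + f * (cst (of_nat k * c) * f ^ k)"
    by (simp only: power_Suc app_gl_field_mult Suc)
  also have "\<dots> = (cst c + cst (of_nat k * c)) * f ^ Suc k"
    by (simp add: algebra_simps del: cst_hom)
  also have "cst c + cst (of_nat k * c) = cst (of_nat (Suc k) * c)"
    by (simp add: algebra_simps)
  finally show ?case .
qed

definition euler :: "'a::field_char_0 endo" where
  "euler = gl_field (\<lambda>i j. if i = j then 1 else 0)"

lemma coeff3_euler: "coeff3 (app euler f) a b c = of_nat (a + b + c) * coeff3 f a b c"
  by (simp add: euler_def app_gl_field sum_axis coeff3_var coeff3_dvar algebra_simps)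

text \<open>Degrees are the eigenvalues of the Euler field, distinct in characteristic zero; so
  homogeneity can be proved with the Leibniz rule.\<close>

lemma euler_homogeneous: "app euler f = cst (of_nat n) * f \<Longrightarrow> app (hproj n) f = f"
proof (rule poly3_eqI)
  fix a b c
  assume "app euler f = cst (of_nat n) * f"
  then have "of_nat (a + b + c) * coeff3 f a b c = of_nat n * coeff3 f a b c"
    using coeff3_euler[of f a b c] by (simp only: coeff3_simps)
  then have "a + b + c = n \<or> coeff3 f a b c = 0"
    by (metis mult_cancel_right of_nat_eq_iff)
  then show "coeff3 (app (hproj n) f) a b c = coeff3 f a b c" by (auto simp: coeff3_hproj)
qed

text \<open>The determinant with rows (x, y, z), (Dx, Dy, Dz) and (DDx, DDy, DDz), expanded along
  the first row.\<close>

definition wronskian :: "(axis \<Rightarrow> axis \<Rightarrow> 'a) \<Rightarrow> 'a::field_char_0 poly3" where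
  "wronskian A = (let D = app (gl_field A); x = var AX; y = var AY; z = var AZ in
     x * (D y * D (D z) - D z * D (D y)) - y * (D x * D (D z) - D z * D (D x))
     + z * (D x * D (D y) - D y * D (D x)))"

text \<open>On linear forms D acts by a 3 x 3 matrix; as its trace is zero, the characteristic
  polynomial has no quadratic term.\<close>

lemma gl_field_cayley_hamilton:
  fixes A :: "axis \<Rightarrow> axis \<Rightarrow> 'a::field_char_0"
  assumes "trace3 A = 0"
  shows "\<exists>p q. \<forall>i. app (gl_field A) (app (gl_field A) (app (gl_field A) (var i))) = p * app (gl_field A) (var i) + q * var i"
proof -
  define a b c d e f g h where "a = cst (A AX AX)" and "b = cst (A AY AX)" and "c = cst (A AZ AX)"
    and "d = cst (A AX AY)" and "e = cst (A AY AY)" and "f = cst (A AZ AY)"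
    and "g = cst (A AX AZ)" and "h = cst (A AY AZ)"
  have "A AZ AZ = - (A AX AX + A AY AY)"
    using assms by (simp only: trace3_def sum_axis eq_neg_iff_add_eq_0 add_ac)
  then have k: "cst (A AZ AZ) = - a - e" by (simp add: a_def e_def)
  let ?D = "app (gl_field A)" and ?x = "var AX :: 'a poly3" and ?y = "var AY :: 'a poly3" and ?z = "var AZ :: 'a poly3"
  have D: "?D ?x = a * ?x + b * ?y + c * ?z" "?D ?y = d * ?x + e * ?y + f * ?z"
    "?D ?z = g * ?x + h * ?y + (- a - e) * ?z"
    unfolding k[symmetric] by (simp_all only: app_gl_field_var a_def b_def c_def d_def e_def f_def g_def h_def)
  have lin: "?D (a * u) = a * ?D u" "?D (b * u) = b * ?D u" "?D (c * u) = c * ?D u"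
    "?D (d * u) = d * ?D u" "?D (e * u) = e * ?D u" "?D (f * u) = f * ?D u" "?D (g * u) = g * ?D u"
    "?D (h * u) = h * ?D u" "?D ((- a - e) * u) = (- a - e) * ?D u" for u
    unfolding a_def b_def c_def d_def e_def f_def g_def h_def k[unfolded a_def e_def, symmetric] by (rule app_cst)+
  \<comment> \<open>Minus the sum of the principal 2 x 2 minors; \<open>q\<close> is the
    determinant.\<close>
  define p where "p = - (a * e - b * d + a * (- a - e) - c * g + e * (- a - e) - f * h)"
  define q where "q = a * (e * (- a - e) - f * h) - b * (d * (- a - e) - f * g) + c * (d * h - e * g)"
  have "?D (?D (?D (var i))) = p * ?D (var i) + q * var i" for i
    by (cases i) (simp_all only: D lin app_plus, simp_all add: p_def q_def algebra_simps)
  then show ?thesis by blast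
qed

text \<open>Differentiating a Wronskian changes only its last row, here into the third derivatives,
  which are a combination of the first two rows.\<close>

lemma wronskian_annihilated:
  assumes "trace3 A = 0"
  shows "app (gl_field A) (wronskian A) = 0"
proof -
  obtain p q where pq: "\<And>i. app (gl_field A) (app (gl_field A) (app (gl_field A) (var i))) = p * app (gl_field A) (var i) + q * var i"
    using gl_field_cayley_hamilton[OF assms] by blast
  show ?thesis
    by (simp add: wronskian_def Let_def app_gl_field_mult pq) (simp add: algebra_simps)
qed

lemma euler_var: "app euler (var i) = var i"
  by (cases i) (simp_all add: euler_def app_gl_field_var)

lemma euler_gl_field: "app euler (app (gl_field A) f) = app (gl_field A) (app euler f)"
proof -
  have "gl_field A * euler - euler * gl_field A = 0"
    unfolding euler_def gl_field_def sum_axis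
    by (simp add: mul_hom algebra_simps sc_left_commute[of "vfield _ _"])
       (simp add: vfield_mult dd_commute mul_commute algebra_simps)
  then show ?thesis by (metis app_ring_ops(6) eq_iff_diff_eq_0)
qed

lemma euler_wronskian: "app euler (wronskian A) = cst 3 * wronskian A"
proof -
  have D1: "app euler (app (gl_field A) (var i)) = app (gl_field A) (var i)" for i
    by (simp add: euler_gl_field euler_var)
  have D2: "app euler (app (gl_field A) (app (gl_field A) (var i))) = app (gl_field A) (app (gl_field A) (var i))" for i
    by (simp add: euler_gl_field[of A "app (gl_field A) (var i)"] D1)
  have m: "app euler (u * v) = app euler u * v + u * app euler v" for u v :: "'a poly3"
    unfolding euler_def by (rule app_gl_field_mult)
  have c3: "cst 3 = (3 :: 'a poly3)" by (simp add: cst_def numeral_poly)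
  show ?thesis
    by (simp add: wronskian_def Let_def m D1 D2 euler_var c3) (simp add: algebra_simps)
qed

text \<open>Evaluation at (1, 0, 0); on a cubic form it reads off the coefficient of x^3, enough to
  certify that the form is nonzero.\<close>

definition ev1 :: "'a::comm_ring_1 poly3 \<Rightarrow> 'a" where
  "ev1 f = poly (poly (poly f 0) 0) 1"

lemma ev1_hom [simp]: "ev1 (f + g) = ev1 f + ev1 g" "ev1 (f - g) = ev1 f - ev1 g" "ev1 (f * g) = ev1 f * ev1 g"
  "ev1 (cst c) = c" "ev1 (var AX) = 1" "ev1 (var AY) = 0" "ev1 (var AZ) = 0"
  by (simp_all add: ev1_def cst_def var.simps)

lemma ev1_wronskian:
  "ev1 (wronskian A) = (A AX AY)^2 * A AY AZ + A AX AY * A AX AZ * (A AZ AZ - A AY AY) - A AZ AY * (A AX AZ)^2"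
  by (simp add: wronskian_def Let_def app_gl_field_var power2_eq_square) (simp add: algebra_simps)

lemma sing_gl_op_of_wronskian:
  assumes "trace3 A = 0" "wronskian A \<noteq> 0"
  shows "sing (3 * m) (gl_op (3 * m) A)"
  unfolding sing_def
proof (intro exI conjI)
  let ?f = "wronskian A ^ m"
  show "?f \<noteq> 0" using assms by simp
  have "app euler ?f = cst (of_nat (3 * m)) * ?f"
    using app_gl_field_power[OF euler_wronskian[unfolded euler_def], of A m] unfolding euler_def by (simp add: mult.commute)
  then show hproj: "app (hproj (3 * m)) ?f = ?f" by (rule euler_homogeneous)
  show "app (gl_op (3 * m) A) ?f = 0"
    using app_gl_field_power[of A "wronskian A" 0 m] wronskian_annihilated[OF assms(1)] hproj
    by (simp add: gl_op_gl_field)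
qed

text \<open>The Wronskian may vanish, for instance for a diagonal matrix with a repeated entry. So
  the matrix is moved along a traceless direction \<open>N\<close>; the determinant is a polynomial
  in s with infinitely many zeros and therefore vanishes at s = 0 too.\<close>

lemma det_sl:
  fixes L :: "'a::field_char_0 endo"
  assumes "L \<in> sl (3 * m)"
  shows "det (mat_of (3 * m) L) = 0"
proof -
  obtain A where A: "L = gl_op (3 * m) A" "trace3 A = 0" using assms by (rule slE)
  \<comment> \<open>Chosen so that the Wronskian of \<open>B s\<close> at (1, 0, 0) is a cubic in s
    with leading coefficient 1, whatever \<open>A\<close> is.\<close>
  define N :: "axis \<Rightarrow> axis \<Rightarrow> 'a" where
    "N i j = (if i = AX \<and> j = AY \<or> i = AY \<and> j = AZ then 1 else 0)" for i j
  define B where "B s i j = A i j + s * N i j" for s i j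
  have B: "gl_op (3 * m) (B s) = L + sc s * gl_op (3 * m) N" for s
    unfolding A(1) gl_op_sc gl_op_add B_def ..
  have trB: "trace3 (B s) = 0" for s
    using A(2) by (simp add: trace3_def sum_axis B_def N_def)
  define q where "q = [:A AX AY, 1:]^2 * [:A AY AZ, 1:]
    + [:A AX AY, 1:] * [:A AX AZ * (A AZ AZ - A AY AY):] - [:A AZ AY * (A AX AZ)^2:]"
  have "ev1 (wronskian (B s)) = poly q s" for s
    by (simp add: ev1_wronskian B_def N_def q_def algebra_simps)
  then have rank_neutral: "poly q s \<noteq> 0 \<Longrightarrow> wronskian (B s) \<noteq> 0" for s
    by (metis ev1_hom(4) cst_hom(1))
  have "coeff q 3 = 1" by (simp add: q_def power2_eq_square numeral_3_eq_3)
  then have "q \<noteq> 0" by auto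
  then have "finite {s. poly q s = 0}" by (rule poly_roots_finite)
  then have "infinite (UNIV - {s. poly q s = 0})"
    using infinite_UNIV_char_0[where 'a='a] by (rule Diff_infinite_finite)
  moreover have "UNIV - {s. poly q s = 0} \<subseteq> {s. det (mat_of (3 * m) L + s \<cdot>\<^sub>m mat_of (3 * m) (gl_op (3 * m) N)) = 0}"
  proof clarify
    fix s assume "poly q s \<noteq> 0"
    then have "sing (3 * m) (gl_op (3 * m) (B s))" by (intro sing_gl_op_of_wronskian trB rank_neutral)
    then have "det (mat_of (3 * m) (gl_op (3 * m) (B s))) = 0" by (subst (asm) sing_iff_det) simp_all
    then show "det (mat_of (3 * m) L + s \<cdot>\<^sub>m mat_of (3 * m) (gl_op (3 * m) N)) = 0"
      unfolding B mat_of_linear .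
  qed
  ultimately have "infinite {s. det (mat_of (3 * m) L + s \<cdot>\<^sub>m mat_of (3 * m) (gl_op (3 * m) N)) = 0}"
    by (meson finite_subset)
  then show ?thesis by (rule det_pencil_vanish[OF mat_of_carrier mat_of_carrier])
qed

section \<open>Rank neutral directions\<close>


definition corner :: "nat \<Rightarrow> 'a::field_char_0 endo set" where
  "corner n = {T. hproj n * T = T \<and> T * hproj n = T}"

lemma corner_add: "S \<in> corner n \<Longrightarrow> T \<in> corner n \<Longrightarrow> S + T \<in> corner n"
  and corner_diff: "S \<in> corner n \<Longrightarrow> T \<in> corner n \<Longrightarrow> S - T \<in> corner n"
  and corner_sc: "T \<in> corner n \<Longrightarrow> sc c * T \<in> corner n"
  by (auto simp: corner_def distrib_left distrib_right left_diff_distrib right_diff_distrib hproj_sc_left mult.assoc)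

lemma corner_mult: "S \<in> corner n \<Longrightarrow> T \<in> corner n \<Longrightarrow> S * T \<in> corner n"
  unfolding corner_def mem_Collect_eq by (metis mult.assoc)

lemma elem_op_corner: "elem_op n i j \<in> corner n" and gl_op_corner: "gl_op n A \<in> corner n"
  by (simp_all add: corner_def)

lemma ad_corner: "N \<in> corner n \<Longrightarrow> T \<in> corner n \<Longrightarrow> ad N T \<in> corner n"
  unfolding ad_def by (intro corner_diff corner_mult)

lemma sl_corner: "L \<in> sl n \<Longrightarrow> L \<in> corner n"
  by (elim slE) (simp add: gl_op_corner)

lemma conj_op_corner: "T \<in> corner n \<Longrightarrow> conj_op n w T \<in> corner n"
proof -
  assume T: "T \<in> corner n"
  obtain i j t where w: "w = (i, j, t)" by (cases w)
  let ?X = "exp_op n (elem_op n i j)"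
  have "hproj n * (?X t * T * ?X (- t)) = ?X t * (hproj n * T) * ?X (- t)"
    by (simp only: mult.assoc[symmetric] exp_op_hproj)
  moreover have "?X t * T * ?X (- t) * hproj n = ?X t * (T * hproj n) * ?X (- t)"
    by (simp only: mult.assoc exp_op_hproj[symmetric])
  ultimately show ?thesis using T by (simp add: conj_op_def w corner_def)
qed

lemma conj_op_add: "conj_op n w (S + T) = conj_op n w S + conj_op n w T"
  by (cases w) (simp add: conj_op_def algebra_simps)

lemma conj_op_sc: "conj_op n w (sc c * T) = sc c * conj_op n w T"
proof -
  obtain i j t where w: "w = (i, j, t)" by (cases w)
  show ?thesis by (simp add: conj_op_def w sc_left_commute[of "exp_op n (elem_op n i j) t"] mult.assoc)
qed

definition middle_entry :: "nat \<Rightarrow> 'a::field_char_0 endo \<Rightarrow> 'a" where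
  "middle_entry m T = coeff_at (app T (mon_at (m, m, m))) (m, m, m)"

lemma middle_entry_linear: "middle_entry m (S + T) = middle_entry m S + middle_entry m T" "middle_entry m (sc c * T) = c * middle_entry m T"
  by (simp_all add: middle_entry_def)

text \<open>These are the eigenvalues of the regular element \<open>diag (1, M, -1 - M)\<close>, \<open>M = 3 m + 1\<close>, on
  monomials: its kernel on forms of degree \<open>3 m\<close> is spanned by \<open>(x y z)\<^sup>m\<close>.\<close>

lemma generic_weight_zero:
  assumes "a + b + c = 3 * m"
  shows "(of_nat a + of_nat (3 * m + 1) * of_nat b - (1 + of_nat (3 * m + 1)) * of_nat c = (0 :: 'a::field_char_0))
    \<longleftrightarrow> a = m \<and> b = m \<and> c = m" (is "?l = 0 \<longleftrightarrow> _")
proof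
  define M :: int where "M = 3 * int m + 1"
  have "?l = of_int (int a + M * int b - (1 + M) * int c)"
    unfolding M_def by simp
  moreover assume "?l = 0"
  ultimately have "int a + M * int b - (1 + M) * int c = 0" by (metis of_int_eq_0_iff)
  then have eq: "int a - int c = M * (int c - int b)" by (simp add: algebra_simps)
  \<comment> \<open>\<open>M\<close> divides a - c and exceeds 3m, the largest possible absolute
    value of a - c.\<close>
  have "int a - int c = 0"
  proof (rule ccontr)
    assume "int a - int c \<noteq> 0"
    moreover have "M dvd int a - int c" unfolding eq by simp
    ultimately have "\<bar>M\<bar> \<le> \<bar>int a - int c\<bar>" by (rule dvd_imp_le_int)
    then show False using assms unfolding M_def by linarith
  qed
  moreover from this have "int c - int b = 0" using eq unfolding M_def by simp
  ultimately show "a = m \<and> b = m \<and> c = m" using assms by simp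
next
  assume "a = m \<and> b = m \<and> c = m"
  then show "?l = 0" by (simp add: algebra_simps)
qed

text \<open>The regular diagonal element has corank one with kernel spanned by (xyz)^m, so this
  entry of \<open>T\<close> is, up to a nonzero factor, the derivative of the determinant along
  \<open>T\<close> at that element.\<close>

lemma middle_entry_sl_singular:
  fixes T :: "'a::field_char_0 endo"
  assumes "sl_singular (3 * m) T" "T \<in> corner (3 * m)"
  shows "middle_entry m T = 0"
proof -
  let ?n = "3 * m"
  define M :: 'a where "M = of_nat (3 * m + 1)"
  define A :: "axis \<Rightarrow> axis \<Rightarrow> 'a" where
    "A i j = (if i = j then case i of AX \<Rightarrow> 1 | AY \<Rightarrow> M | AZ \<Rightarrow> - 1 - M else 0)" for i j
  define wt where "wt x = (case x of (a, b, c) \<Rightarrow> of_nat a + M * of_nat b - (1 + M) * of_nat c)" for x :: "nat \<times> nat \<times> nat"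
  have tr: "trace3 A = 0" by (simp add: trace3_def sum_axis A_def)
  have cfA: "coeff_at (app (gl_op ?n A) (mon_at x)) x' = (if x = x' then wt x else 0)" if "x \<in> homog_indices ?n" for x x'
  proof -
    have "app (hproj ?n) (mon_at x) = (mon_at x :: 'a poly3)"
      by (rule coeff_at_eqI) (use that in \<open>auto simp: coeff_at_hproj coeff_at_mon_at\<close>)
    moreover have "coeff_at (app (gl_field A) f) x' = wt x' * coeff_at f x'" for f
      by (cases x') (simp add: wt_def coeff_at_def app_gl_field sum_axis A_def coeff3_var coeff3_dvar algebra_simps)
    ultimately show ?thesis by (simp add: gl_op_gl_field coeff_at_mon_at)
  qed
  have "(m, m, m) \<in> homog_indices ?n" by (simp add: homog_indices_def)
  then obtain r0 where r0: "r0 < ndim ?n" "index_enum ?n r0 = (m, m, m)" using index_enum_surj by blast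
  have "mat_of ?n T $$ (r0, r0) = 0"
  proof (rule diagonal_pencil_vanish[OF mat_of_carrier mat_of_carrier r0(1)])
    fix r c assume "r < ndim ?n" "c < ndim ?n" "r \<noteq> c"
    then show "mat_of ?n (gl_op ?n A) $$ (r, c) = 0"
      by (simp add: mat_of_def cfA index_enum_in index_enum_inj)
  next
    fix r assume r: "r < ndim ?n"
    obtain a b c where x: "index_enum ?n r = (a, b, c)" by (cases "index_enum ?n r")
    have abc: "a + b + c = 3 * m" using index_enum_in[OF r] by (simp add: x homog_indices_def)
    have "mat_of ?n (gl_op ?n A) $$ (r, r) = wt (index_enum ?n r)" using r by (simp add: mat_of_def cfA index_enum_in)
    moreover have "wt (index_enum ?n r) = 0 \<longleftrightarrow> index_enum ?n r = (m, m, m)"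
      using generic_weight_zero[OF abc, where 'a='a] by (simp add: x wt_def M_def)
    ultimately show "mat_of ?n (gl_op ?n A) $$ (r, r) = 0 \<longleftrightarrow> r = r0"
      using index_enum_inj[OF r r0(1)] by (simp add: r0(2))
  next
    fix s
    have "sing ?n (sc s * T + gl_op ?n A)"
      using assms(1) gl_op_sl[OF tr] by (simp add: sl_singular_def)
    moreover have "sc s * T + gl_op ?n A \<in> corner ?n" by (intro corner_add corner_sc assms gl_op_corner)
    ultimately have "det (mat_of ?n (sc s * T + gl_op ?n A)) = 0"
      using sing_iff_det[of "sc s * T + gl_op ?n A" ?n] by (simp add: corner_def)
    also have "mat_of ?n (sc s * T + gl_op ?n A) = mat_of ?n (gl_op ?n A) + s \<cdot>\<^sub>m mat_of ?n T"
      unfolding mat_of_linear by (rule comm_add_mat[of _ "ndim ?n" "ndim ?n"]) simp_all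
    finally show "det (mat_of ?n (gl_op ?n A) + s \<cdot>\<^sub>m mat_of ?n T) = 0" .
  qed
  then show ?thesis using r0 by (simp add: mat_of_def middle_entry_def)
qed

text \<open>Conjugation invariance is built into the definition; invariance under \<open>ad\<close> follows by taking
  the linear coefficient in the parameter of a unipotent conjugation.\<close>

definition rank_neutral :: "nat \<Rightarrow> 'a::field_char_0 endo set" where
  "rank_neutral m = {T \<in> corner (3 * m). \<forall>ws. middle_entry m (fold (conj_op (3 * m)) ws T) = 0}"

lemma fold_conj_op_linear:
  "fold (conj_op n) ws (S + T) = fold (conj_op n) ws S + fold (conj_op n) ws T"
  "fold (conj_op n) ws (sc c * T) = sc c * fold (conj_op n) ws T"
  by (induction ws arbitrary: S T) (simp_all add: conj_op_add conj_op_sc)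

lemma rank_neutral_add: "S \<in> rank_neutral m \<Longrightarrow> T \<in> rank_neutral m \<Longrightarrow> S + T \<in> rank_neutral m"
  and rank_neutral_sc: "T \<in> rank_neutral m \<Longrightarrow> sc c * T \<in> rank_neutral m"
  by (auto simp: rank_neutral_def fold_conj_op_linear middle_entry_linear intro: corner_add corner_sc)

lemma rank_neutral_conj_op: "T \<in> rank_neutral m \<Longrightarrow> conj_op (3 * m) w T \<in> rank_neutral m"
proof -
  assume T: "T \<in> rank_neutral m"
  then have "middle_entry m (fold (conj_op (3 * m)) (w # ws) T) = 0" for ws unfolding rank_neutral_def by blast
  then show ?thesis using T by (simp add: rank_neutral_def conj_op_corner)
qed

lemma rank_neutral_middle_entry: "T \<in> rank_neutral m \<Longrightarrow> middle_entry m T = 0"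
proof -
  assume "T \<in> rank_neutral m"
  then have "middle_entry m (fold (conj_op (3 * m)) [] T) = 0" unfolding rank_neutral_def by blast
  then show ?thesis by simp
qed

lemma sl_singular_rank_neutral:
  assumes "sl_singular (3 * m) T" "T \<in> corner (3 * m)"
  shows "T \<in> rank_neutral m"
proof -
  have "sl_singular (3 * m) (fold (conj_op (3 * m)) ws T) \<and> fold (conj_op (3 * m)) ws T \<in> corner (3 * m)" for ws
    using assms by (induction ws arbitrary: T) (simp_all add: sl_singular_conj_op conj_op_corner)
  then show ?thesis using assms by (simp add: rank_neutral_def middle_entry_sl_singular)
qed

lemma rank_neutral_ad:
  fixes T :: "'a::field_char_0 endo"
  assumes T: "T \<in> rank_neutral m" and ij: "i \<noteq> j" and m: "m > 0"
  shows "ad (elem_op (3 * m) i j) T \<in> rank_neutral m"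
proof -
  let ?n = "3 * m" and ?N = "elem_op (3 * m) i j :: 'a endo"
  have "middle_entry m (fold (conj_op ?n) ws (ad ?N T)) = 0" for ws
  proof -
    define psi where "psi S = middle_entry m (fold (conj_op ?n) ws S)" for S
    have psi: "psi (S + S') = psi S + psi S'" "psi (sc c * S) = c * psi S" for S S' c
      by (simp_all add: psi_def fold_conj_op_linear middle_entry_linear)
    have psi0: "psi 0 = 0" using psi(2)[of 0 0] by simp
    have psi_sum: "psi (sum h S) = (\<Sum>x\<in>S. psi (h x))" for h :: "nat \<Rightarrow> 'a endo" and S
      by (induction S rule: infinite_finite_induct) (simp_all add: psi psi0)
    define c where "c k l = psi (divpow ?N k * T * divpow ?N l)" for k l
    \<comment> \<open>The functional \<open>psi\<close> along the conjugates of \<open>T\<close> by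
      exp(s N), as a polynomial in s.\<close>
    define Q where "Q = (\<Sum>k\<le>?n. \<Sum>l\<le>?n. monom ((-1) ^ l * c k l) (k + l))"
    have "poly Q s = 0" for s
    proof -
      have "conj_op ?n (i, j, s) T = (\<Sum>k\<le>?n. \<Sum>l\<le>?n. sc (s ^ k * (- s) ^ l) * (divpow ?N k * T * divpow ?N l))"
        using ij by (simp add: conj_op_def exp_op_def sum_distrib_left sum_distrib_right mult.assoc
            sc_left_commute[of T] sc_left_commute[of "divpow ?N _"] sc_mult del: cst_hom)
          (subst sum.swap, simp add: mult.commute)
      then have "psi (conj_op ?n (i, j, s) T) = (\<Sum>k\<le>?n. \<Sum>l\<le>?n. s ^ k * (- s) ^ l * c k l)"
        by (simp add: psi_sum psi c_def del: cst_hom)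
      moreover have "psi (conj_op ?n (i, j, s) T) = 0"
        using rank_neutral_conj_op[OF T, of "(i, j, s)"] by (simp add: psi_def rank_neutral_def)
      moreover have "s ^ k * (- s) ^ l * c k l = (-1) ^ l * c k l * s ^ (k + l)" for k l
        by (simp add: power_minus[of s l] power_add mult_ac)
      ultimately show ?thesis by (simp add: Q_def poly_sum poly_monom)
    qed
    then have "Q = 0" by (simp add: poly_all_0_iff_0[symmetric])
    then have "0 = coeff Q 1" by simp
    also have "\<dots> = (\<Sum>k\<le>?n. \<Sum>l\<le>?n. if k + l = 1 then (-1) ^ l * c k l else 0)"
      by (simp add: Q_def coeff_sum)
    also have "\<dots> = (\<Sum>p\<in>{..?n} \<times> {..?n}. if fst p + snd p = 1 then (-1) ^ snd p * c (fst p) (snd p) else 0)"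
      by (simp add: sum.cartesian_product case_prod_beta)
    \<comment> \<open>Only these two index pairs contribute to the linear term, and m > 0 keeps both
      within the truncation.\<close>
    also have "\<dots> = (\<Sum>p\<in>{(1, 0), (0, 1)}. if fst p + snd p = 1 then (-1) ^ snd p * c (fst p) (snd p) else 0)"
      by (rule sum.mono_neutral_right) (use m in \<open>auto simp: add_is_1\<close>)
    also have "\<dots> = c 1 0 - c 0 1" by simp
    also have "\<dots> = psi (?N * T) + psi (sc (-1) * (T * ?N))" unfolding psi(2) by (simp add: c_def)
    also have "\<dots> = psi (ad ?N T)" unfolding psi(1)[symmetric] by (simp add: ad_def mul_hom)
    finally show ?thesis by (simp add: psi_def)
  qed
  moreover have "ad ?N T \<in> corner ?n" using T by (intro ad_corner elem_op_corner) (simp add: rank_neutral_def)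
  ultimately show ?thesis by (simp add: rank_neutral_def)
qed

section \<open>Traces and the orthogonal complement of A\<close>

definition trace_op :: "nat \<Rightarrow> 'a::field_char_0 endo \<Rightarrow> 'a" where
  "trace_op n T = (\<Sum>x\<in>homog_indices n. coeff_at (app T (mon_at x)) x)"

lemma trace_op_linear: "trace_op n (S + T) = trace_op n S + trace_op n T" "trace_op n (S - T) = trace_op n S - trace_op n T" "trace_op n (sc c * T) = c * trace_op n T"
  by (simp_all add: trace_op_def sum.distrib sum_subtractf sum_distrib_left)

lemma trace_op_commute:
  assumes "hproj n * L = L" "hproj n * M = M"
  shows "trace_op n (L * M) = trace_op n (M * L)"
proof -
  have *: "trace_op n (L * M) = (\<Sum>x\<in>homog_indices n. \<Sum>y\<in>homog_indices n. coeff_at (app M (mon_at x)) y * coeff_at (app L (mon_at y)) x)"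
    if "hproj n * M = M" for L M :: "'a endo"
  proof -
    have "app (L * M) (mon_at x) = (\<Sum>y\<in>homog_indices n. cst (coeff_at (app M (mon_at x)) y) * app L (mon_at y))" for x
    proof -
      have "app M (mon_at x) = app (hproj n) (app M (mon_at x))"
        using that app_ring_ops(6)[of "hproj n" M "mon_at x"] by simp
      then have "app (L * M) (mon_at x) = app (L * hproj n) (app M (mon_at x))" by simp
      then show ?thesis by (simp only: app_eq_sum)
    qed
    then show ?thesis by (simp add: trace_op_def coeff_at_sum)
  qed
  show ?thesis
    unfolding *[OF assms(2)] *[OF assms(1)] by (subst sum.swap) (simp add: mult.commute)
qed

definition rank_neutral_perp :: "nat \<Rightarrow> 'a::field_char_0 endo set" where
  "rank_neutral_perp m = {T \<in> rank_neutral m. \<forall>L\<in>sl (3 * m). trace_op (3 * m) (T * L) = 0}"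

lemma rank_neutral_perp_add: "S \<in> rank_neutral_perp m \<Longrightarrow> T \<in> rank_neutral_perp m \<Longrightarrow> S + T \<in> rank_neutral_perp m"
  and rank_neutral_perp_sc: "T \<in> rank_neutral_perp m \<Longrightarrow> sc c * T \<in> rank_neutral_perp m"
  by (auto simp: rank_neutral_perp_def distrib_right mult.assoc trace_op_linear rank_neutral_add rank_neutral_sc)

lemma rank_neutral_perp_diff: "S \<in> rank_neutral_perp m \<Longrightarrow> T \<in> rank_neutral_perp m \<Longrightarrow> S - T \<in> rank_neutral_perp m"
  using rank_neutral_perp_add[of S m "sc (-1) * T"] rank_neutral_perp_sc[of T m "-1"] by (simp add: mul_hom)

lemma rank_neutral_perp_corner: "T \<in> rank_neutral_perp m \<Longrightarrow> T \<in> corner (3 * m)"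
  by (simp add: rank_neutral_perp_def rank_neutral_def)

text \<open>The trace form is invariant: moving \<open>ad N\<close> from one argument to the other
  only changes the sign, and \<open>ad N\<close> preserves \<open>sl\<close>.\<close>

lemma rank_neutral_perp_ad:
  fixes T :: "'a::field_char_0 endo"
  assumes T: "T \<in> rank_neutral_perp m" and ij: "i \<noteq> j" and m: "m > 0"
  shows "ad (elem_op (3 * m) i j) T \<in> rank_neutral_perp m"
proof -
  let ?n = "3 * m" and ?N = "elem_op (3 * m) i j :: 'a endo"
  have "trace_op ?n (ad ?N T * L) = 0" if L: "L \<in> sl ?n" for L
  proof -
    have "trace_op ?n (?N * (T * L)) = trace_op ?n (T * L * ?N)"
      using rank_neutral_perp_corner[OF T] by (intro trace_op_commute) (simp_all add: corner_def mult.assoc[symmetric])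
    then have "trace_op ?n (ad ?N T * L) = - trace_op ?n (T * ad ?N L)"
      by (simp add: ad_def left_diff_distrib right_diff_distrib trace_op_linear mult.assoc)
    also have "trace_op ?n (T * ad ?N L) = 0" using T ad_sl[OF L] by (simp add: rank_neutral_perp_def)
    finally show ?thesis by simp
  qed
  then show ?thesis using T rank_neutral_ad[OF _ ij m, of T] by (simp add: rank_neutral_perp_def)
qed

text \<open>Unipotent conjugations give only the off-diagonal operators directly; E_ii - E_jj is the
  commutator of two of these.\<close>

lemma rank_neutral_perp_ad_cartan:
  fixes T :: "'a::field_char_0 endo"
  assumes T: "T \<in> rank_neutral_perp m" and ij: "i \<noteq> j" and m: "m > 0"
  shows "ad (elem_op (3 * m) i i - elem_op (3 * m) j j) T \<in> rank_neutral_perp m"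
proof -
  let ?e = "elem_op (3 * m) :: axis \<Rightarrow> axis \<Rightarrow> 'a endo"
  have "ad (?e i j) (ad (?e j i) T) - ad (?e j i) (ad (?e i j) T) = ad (?e i j * ?e j i - ?e j i * ?e i j) T"
    by (simp add: ad_def algebra_simps)
  also have "?e i j * ?e j i - ?e j i * ?e i j = ?e i i - ?e j j"
    by (simp add: elem_op_commutator)
  finally show ?thesis
    using rank_neutral_perp_diff rank_neutral_perp_ad[OF rank_neutral_perp_ad[OF T ij[symmetric] m] ij m] rank_neutral_perp_ad[OF rank_neutral_perp_ad[OF T ij m] ij[symmetric] m]
    by metis
qed

section \<open>The trace form\<close>


text \<open>A product of two matrix units has nonzero diagonal entries only if it has weight zero.
  In E_ij E_ji the right factor first raises the j-th exponent, whence the factor with + 1.\<close>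

lemma trace_op_elem_op:
  "trace_op n (elem_op n i j * elem_op n k l :: 'a::field_char_0 endo) = (\<Sum>(a, b, c)\<in>homog_indices n.
    if i = j \<and> k = l then of_nat (exponent_of i a b c * exponent_of k a b c)
    else if i = l \<and> j = k then of_nat (exponent_of i a b c * (exponent_of j a b c + 1)) else 0)"
  unfolding trace_op_def
proof (rule sum.cong[OF refl], clarify)
  fix a b c assume x: "(a, b, c) \<in> homog_indices n"
  have "app (hproj n) (mon_at (a, b, c)) = (mon_at (a, b, c) :: 'a poly3)"
    by (rule coeff_at_eqI) (use x in \<open>auto simp: coeff_at_hproj coeff_at_mon_at\<close>)
  then have "coeff_at (app (elem_op n i j * elem_op n k l :: 'a endo) (mon_at (a, b, c))) (a, b, c)
    = coeff3 (app (vfield i j) (app (vfield k l) (mon3 a b c))) a b c"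
    unfolding elem_op_mult by (simp add: coeff_at_def mon_at_def)
  also have "\<dots> = (if i = j \<and> k = l then of_nat (exponent_of i a b c * exponent_of k a b c)
    else if i = l \<and> j = k then of_nat (exponent_of i a b c * (exponent_of j a b c + 1)) else 0)"
    by (cases i; cases j; cases k; cases l; cases a; cases b; cases c;
        simp add: coeff3_vfield coeff3_dvar coeff3_mon3 exponent_of_def algebra_simps)
  finally show "coeff_at (app (elem_op n i j * elem_op n k l :: 'a endo) (mon_at (a, b, c))) (a, b, c)
    = (if i = j \<and> k = l then of_nat (exponent_of i a b c * exponent_of k a b c)
    else if i = l \<and> j = k then of_nat (exponent_of i a b c * (exponent_of j a b c + 1)) else 0)" .
qed

text \<open>Labels for the eight coordinates of a traceless matrix, whose last diagonal entry is
  determined by the others. The two diagonal pairs stand for the Cartan subalgebra.\<close>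

definition sl_index :: "(axis \<times> axis) set" where
  "sl_index = {(AX, AX), (AX, AY), (AX, AZ), (AY, AX), (AY, AY), (AY, AZ), (AZ, AX), (AZ, AY)}"

text \<open>A basis of \<open>sl\<close> that is dual to its transpose, up to scalars, under the trace form.\<close>

definition orth_basis :: "nat \<Rightarrow> axis \<times> axis \<Rightarrow> 'a::field_char_0 endo" where
  "orth_basis n p = (if p = (AX, AX) then elem_op n AX AX - elem_op n AY AY
    else if p = (AY, AY) then elem_op n AX AX + elem_op n AY AY - sc 2 * elem_op n AZ AZ
    else elem_op n (fst p) (snd p))"

definition coord_mat :: "(axis \<times> axis \<Rightarrow> 'a) \<Rightarrow> axis \<Rightarrow> axis \<Rightarrow> 'a::field_char_0" where
  "coord_mat c k l = (if k = AZ \<and> l = AZ then - c (AX, AX) - c (AY, AY) else c (k, l))"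

lemma trace_op_sum_elem_op:
  "trace_op n (elem_op n i j * elem_op n k l :: 'a::field_char_0 endo) = 0" if "i \<noteq> j \<or> k \<noteq> l" "i \<noteq> l \<or> j \<noteq> k"
  unfolding trace_op_elem_op by (rule sum.neutral) (use that in auto)

text \<open>The field carries no order, so positivity is established for natural numbers and then
  transported by characteristic zero.\<close>

lemma homog_sum_pos:
  fixes h :: "nat \<times> nat \<times> nat \<Rightarrow> nat"
  assumes "x \<in> homog_indices n" "h x > 0"
  shows "(of_nat (\<Sum>x\<in>homog_indices n. h x) :: 'a::field_char_0) \<noteq> 0"
proof -
  have "h x \<le> (\<Sum>x\<in>homog_indices n. h x)" by (rule member_le_sum) (use assms in auto)
  then have "(\<Sum>x\<in>homog_indices n. h x) \<noteq> 0" using assms(2) by linarith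
  then show ?thesis by (simp only: of_nat_eq_0_iff not_False_eq_True)
qed

lemma trace_op_root_pair:
  assumes "i \<noteq> j" "n > 0"
  shows "trace_op n (elem_op n i j * elem_op n j i :: 'a::field_char_0 endo) \<noteq> 0"
proof -
  define h where "h x = (case x of (a, b, c) \<Rightarrow> exponent_of i a b c * (exponent_of j a b c + 1))" for x
  have "trace_op n (elem_op n i j * elem_op n j i :: 'a endo) = of_nat (\<Sum>x\<in>homog_indices n. h x)"
    using assms(1) unfolding trace_op_elem_op of_nat_sum by (intro sum.cong) (auto simp: h_def)
  \<comment> \<open>The witness consists of the exponents of x_i^n.\<close>
  moreover have "\<exists>x\<in>homog_indices n. h x > 0"
    by (rule bexI[of _ "(exponent_of i n 0 0, exponent_of i 0 n 0, exponent_of i 0 0 n)"])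
      (use assms in \<open>cases i; simp add: h_def exponent_of_def homog_indices_def\<close>)+
  ultimately show ?thesis using homog_sum_pos[where h = h, where 'a = 'a] by metis
qed

lemma trace_op_diag:
  fixes p q :: "axis \<Rightarrow> 'a::field_char_0"
  shows "trace_op n (gl_op n (\<lambda>i j. if i = j then p i else 0) * gl_op n (\<lambda>i j. if i = j then q i else 0))
    = (\<Sum>(a, b, c)\<in>homog_indices n. (p AX * of_nat a + p AY * of_nat b + p AZ * of_nat c)
        * (q AX * of_nat a + q AY * of_nat b + q AZ * of_nat c))"
  unfolding trace_op_def
proof (rule sum.cong[OF refl], clarify)
  fix a b c assume x: "(a, b, c) \<in> homog_indices n"
  let ?D = "\<lambda>p. (\<lambda>i j. if i = j then p i else 0) :: axis \<Rightarrow> axis \<Rightarrow> 'a"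
  have 1: "app (hproj n) (mon_at (a, b, c)) = (mon_at (a, b, c) :: 'a poly3)"
    by (rule coeff_at_eqI) (use x in \<open>auto simp: coeff_at_hproj coeff_at_mon_at\<close>)
  have 2: "coeff_at (app (gl_field (?D p)) f) (a, b, c) = (p AX * of_nat a + p AY * of_nat b + p AZ * of_nat c) * coeff_at f (a, b, c)"
    for p f
    by (simp add: coeff_at_def app_gl_field sum_axis coeff3_var coeff3_dvar algebra_simps)
  have "gl_op n (?D p) * gl_op n (?D q) = gl_field (?D p) * gl_op n (?D q)"
    unfolding gl_op_gl_field[of n "?D p"] by (simp only: mult.assoc hproj_gl_op)
  then show "coeff_at (app (gl_op n (?D p) * gl_op n (?D q)) (mon_at (a, b, c))) (a, b, c)
    = (p AX * of_nat a + p AY * of_nat b + p AZ * of_nat c) * (q AX * of_nat a + q AY * of_nat b + q AZ * of_nat c)"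
    by (simp add: gl_op_gl_field 1 2 coeff_at_mon_at)
qed

lemma orth_basis_diag:
  "orth_basis n (AX, AX) = gl_op n (\<lambda>i j. if i = j then case i of AX \<Rightarrow> 1 | AY \<Rightarrow> -1 | AZ \<Rightarrow> 0 else (0 :: 'a::field_char_0))"
  "orth_basis n (AY, AY) = gl_op n (\<lambda>i j. if i = j then case i of AX \<Rightarrow> 1 | AY \<Rightarrow> 1 | AZ \<Rightarrow> -2 else (0 :: 'a))"
  by (simp_all add: orth_basis_def gl_op_def sum_axis mul_hom)

text \<open>The two norms are sums of squares of integers, with a positive term at x^n. The mixed
  sum changes sign when x and y are exchanged, since a - b is antisymmetric and a + b - 2c
  symmetric.\<close>

lemma trace_op_cartan:
  assumes "n > 0"
  shows "trace_op n (orth_basis n (AX, AX) * orth_basis n (AX, AX) :: 'a::field_char_0 endo) \<noteq> 0"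
    "trace_op n (orth_basis n (AY, AY) * orth_basis n (AY, AY) :: 'a endo) \<noteq> 0"
    "trace_op n (orth_basis n (AX, AX) * orth_basis n (AY, AY) :: 'a endo) = 0"
    "trace_op n (orth_basis n (AY, AY) * orth_basis n (AX, AX) :: 'a endo) = 0"
proof -
  have n0: "(n, 0, 0) \<in> homog_indices n" by (simp add: homog_indices_def)
  have sq: "(\<Sum>(a, b, c)\<in>homog_indices n. (of_int (h a b c) :: 'a) ^ 2) \<noteq> 0" if "h n 0 0 \<noteq> 0" for h :: "nat \<Rightarrow> nat \<Rightarrow> nat \<Rightarrow> int"
  proof -
    have "(\<Sum>(a, b, c)\<in>homog_indices n. (of_int (h a b c) :: 'a) ^ 2)
      = of_nat (\<Sum>x\<in>homog_indices n. nat (h (fst x) (fst (snd x)) (snd (snd x)) ^ 2))"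
      unfolding of_nat_sum
    proof (rule sum.cong[OF refl], clarify)
      fix a b c
      have "of_nat (nat (h a b c ^ 2)) = (of_int (h a b c ^ 2) :: 'a)" by (simp only: of_nat_nat zero_le_power2)
      then show "(of_int (h a b c) :: 'a) ^ 2 = of_nat (nat (h (fst (a, b, c)) (fst (snd (a, b, c))) (snd (snd (a, b, c))) ^ 2))"
        by simp
    qed
    then show ?thesis using homog_sum_pos[OF n0, of "\<lambda>x. nat (h (fst x) (fst (snd x)) (snd (snd x)) ^ 2)"] that
      by simp
  qed
  have "trace_op n (orth_basis n (AX, AX) * orth_basis n (AX, AX) :: 'a endo) = (\<Sum>(a, b, c)\<in>homog_indices n. (of_int (int a - int b)) ^ 2)"
    unfolding orth_basis_diag trace_op_diag by (simp add: power2_eq_square)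
  then show "trace_op n (orth_basis n (AX, AX) * orth_basis n (AX, AX) :: 'a endo) \<noteq> 0"
    using sq[of "\<lambda>a b c. int a - int b"] assms by simp
  have "trace_op n (orth_basis n (AY, AY) * orth_basis n (AY, AY) :: 'a endo) = (\<Sum>(a, b, c)\<in>homog_indices n. (of_int (int a + int b - 2 * int c)) ^ 2)"
    unfolding orth_basis_diag trace_op_diag by (simp add: power2_eq_square)
  then show "trace_op n (orth_basis n (AY, AY) * orth_basis n (AY, AY) :: 'a endo) \<noteq> 0"
    using sq[of "\<lambda>a b c. int a + int b - 2 * int c"] assms by simp
  define q :: "nat \<Rightarrow> nat \<Rightarrow> nat \<Rightarrow> 'a" where "q a b c = (of_nat a - of_nat b) * (of_nat a + of_nat b - 2 * of_nat c)" for a b c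
  have "(\<Sum>(a, b, c)\<in>homog_indices n. q a b c) = (\<Sum>(a, b, c)\<in>homog_indices n. q b a c)"
    by (rule sum.reindex_bij_witness[of _ "\<lambda>(a, b, c). (b, a, c)" "\<lambda>(a, b, c). (b, a, c)"])
      (auto simp: homog_indices_def)
  also have "\<dots> = - (\<Sum>(a, b, c)\<in>homog_indices n. q a b c)"
    unfolding sum_negf[symmetric] by (rule sum.cong) (auto simp: q_def algebra_simps)
  finally have q0: "(\<Sum>(a, b, c)\<in>homog_indices n. q a b c) = 0" by simp
  have "trace_op n (orth_basis n (AX, AX) * orth_basis n (AY, AY) :: 'a endo) = (\<Sum>(a, b, c)\<in>homog_indices n. q a b c)"
    unfolding orth_basis_diag trace_op_diag q_def by simp
  then show *: "trace_op n (orth_basis n (AX, AX) * orth_basis n (AY, AY) :: 'a endo) = 0" using q0 by simp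
  have "hproj n * orth_basis n (AX, AX) = (orth_basis n (AX, AX) :: 'a endo)" "hproj n * orth_basis n (AY, AY) = (orth_basis n (AY, AY) :: 'a endo)"
    by (simp_all only: orth_basis_diag hproj_gl_op)
  then show "trace_op n (orth_basis n (AY, AY) * orth_basis n (AX, AX) :: 'a endo) = 0"
    using trace_op_commute[of n "orth_basis n (AY, AY) :: 'a endo" "orth_basis n (AX, AX)"] * by simp
qed

lemma trace_op_orth_basis:
  assumes "p \<in> sl_index" "q \<in> sl_index" "n > 0"
  shows "trace_op n (orth_basis n p * orth_basis n (snd q, fst q) :: 'a::field_char_0 endo) = 0 \<longleftrightarrow> p \<noteq> q"
proof -
  note t = trace_op_linear distrib_left distrib_right left_diff_distrib right_diff_distrib
    sc_left_commute[of "elem_op n _ _"] mult.assoc trace_op_sum_elem_op trace_op_root_pair[OF _ assms(3)]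
  show ?thesis
    using assms(1,2) unfolding sl_index_def
    by (elim insertE emptyE; hypsubst; simp add: trace_op_cartan[OF assms(3)]; simp add: orth_basis_def t)
qed

lemma sl_orth_basis: "p \<in> sl_index \<Longrightarrow> (orth_basis n p :: 'a::field_char_0 endo) \<in> sl n"
proof -
  define B :: "axis \<Rightarrow> axis \<Rightarrow> 'a" where "B = (\<lambda>i j. if p = (AX, AX) then (if i = j then case i of AX \<Rightarrow> 1 | AY \<Rightarrow> -1 | AZ \<Rightarrow> 0 else 0)
    else if p = (AY, AY) then (if i = j then case i of AX \<Rightarrow> 1 | AY \<Rightarrow> 1 | AZ \<Rightarrow> -2 else 0)
    else if p = (i, j) then 1 else 0)"
  assume "p \<in> sl_index"
  then have "orth_basis n p = gl_op n B" "trace3 B = 0"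
    unfolding sl_index_def by (elim insertE emptyE; hypsubst; simp add: orth_basis_def gl_op_def sum_axis mul_hom B_def trace3_def)+
  then show ?thesis using gl_op_sl by metis
qed

lemma orth_basis_spans:
  fixes B :: "axis \<Rightarrow> axis \<Rightarrow> 'a::field_char_0"
  assumes "trace3 B = 0"
  shows "\<exists>c. gl_op n B = (\<Sum>p\<in>sl_index. sc (c p) * orth_basis n (snd p, fst p))"
proof -
  \<comment> \<open>On the diagonal the coefficients u and v solve u + v = B_xx and v - u = B_yy;
    then -2v = B_zz is the trace condition. Off the diagonal the indices are swapped because the sum
    runs over transposed basis elements.\<close>
  define c where "c p = (if p = (AX, AX) then (B AX AX - B AY AY) / 2
    else if p = (AY, AY) then (B AX AX + B AY AY) / 2 else B (snd p) (fst p))" for p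
  have z: "B AZ AZ = - (B AX AX + B AY AY)"
    using assms by (simp only: trace3_def sum_axis eq_neg_iff_add_eq_0 add_ac)
  have d: "(B AX AX - B AY AY) / 2 + (B AX AX + B AY AY) / 2 = B AX AX"
    "- ((B AX AX - B AY AY) / 2) + (B AX AX + B AY AY) / 2 = B AY AY"
    "(B AX AX + B AY AY) / 2 * 2 = B AX AX + B AY AY"
    by (simp_all add: field_simps)
  have e: "sc u * (X - Y) + sc v * (X + Y - sc 2 * Z) = sc (u + v) * X + sc (- u + v) * Y - sc (v * 2) * Z"
    for u v :: 'a and X Y Z
    by (simp add: sc_mult mul_hom distrib_left distrib_right right_diff_distrib left_diff_distrib algebra_simps del: cst_hom(4))
  have "(\<Sum>p\<in>sl_index. sc (c p) * orth_basis n (snd p, fst p)) =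
    (sc ((B AX AX - B AY AY) / 2) * (elem_op n AX AX - elem_op n AY AY)
      + sc ((B AX AX + B AY AY) / 2) * (elem_op n AX AX + elem_op n AY AY - sc 2 * elem_op n AZ AZ))
    + sc (B AX AY) * elem_op n AX AY + sc (B AX AZ) * elem_op n AX AZ + sc (B AY AX) * elem_op n AY AX
    + sc (B AY AZ) * elem_op n AY AZ + sc (B AZ AX) * elem_op n AZ AX + sc (B AZ AY) * elem_op n AZ AY"
    by (simp add: sl_index_def c_def orth_basis_def add_ac)
  also have "\<dots> = gl_op n B"
    unfolding e d by (simp add: gl_op_def sum_axis z mul_hom algebra_simps)
  finally show ?thesis by metis
qed

text \<open>\<open>A\<close> is the orthogonal projection of \<open>T\<close>, with coefficients
  from the dual basis. All that enters is that the trace form is nondegenerate on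
  \<open>sl n\<close>.\<close>

lemma trace_form_decomposition:
  fixes T :: "'a::field_char_0 endo"
  assumes n: "n > 0"
  shows "\<exists>A\<in>sl n. \<forall>L\<in>sl n. trace_op n ((T - A) * L) = 0"
proof -
  define k where "k p = trace_op n (T * orth_basis n (snd p, fst p)) / trace_op n (orth_basis n p * orth_basis n (snd p, fst p) :: 'a endo)" for p
  define A where "A = (\<Sum>p\<in>sl_index. sc (k p) * orth_basis n p)"
  have fin: "finite sl_index" by (simp add: sl_index_def)
  have tsum: "trace_op n (sum h S) = (\<Sum>x\<in>S. trace_op n (h x))" for h :: "axis \<times> axis \<Rightarrow> 'a endo" and S
  proof -
    have "trace_op n (0 :: 'a endo) = 0" by (simp add: trace_op_def)
    then show ?thesis by (induction S rule: infinite_finite_induct) (simp_all add: trace_op_linear)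
  qed
  have sum_sl: "sum h S \<in> sl n" if "\<And>x. x \<in> S \<Longrightarrow> h x \<in> sl n" for h :: "axis \<times> axis \<Rightarrow> 'a endo" and S
    using that by (induction S rule: infinite_finite_induct) (auto intro: sl_add sl_zero)
  have A: "A \<in> sl n" unfolding A_def by (intro sum_sl sl_sc sl_orth_basis)
  have *: "trace_op n ((T - A) * orth_basis n (snd q, fst q)) = 0" if q: "q \<in> sl_index" for q
  proof -
    have "trace_op n (A * orth_basis n (snd q, fst q)) = (\<Sum>p\<in>sl_index. k p * trace_op n (orth_basis n p * orth_basis n (snd q, fst q)))"
      by (simp add: A_def sum_distrib_right tsum trace_op_linear mult.assoc)
    also have "\<dots> = (\<Sum>p\<in>{q}. k p * trace_op n (orth_basis n p * orth_basis n (snd q, fst q)))"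
      by (rule sum.mono_neutral_right[OF fin]) (use q trace_op_orth_basis[OF _ q n] in auto)
    also have "\<dots> = trace_op n (T * orth_basis n (snd q, fst q))"
      using trace_op_orth_basis[OF q q n, where 'a='a] by (simp add: k_def)
    finally show ?thesis by (simp add: left_diff_distrib trace_op_linear)
  qed
  have "trace_op n ((T - A) * L) = 0" if L: "L \<in> sl n" for L
  proof -
    obtain B where B: "L = gl_op n B" "trace3 B = 0" using L by (rule slE)
    obtain c where c: "gl_op n B = (\<Sum>p\<in>sl_index. sc (c p) * orth_basis n (snd p, fst p))" using orth_basis_spans[OF B(2)] by blast
    have "trace_op n ((T - A) * L) = (\<Sum>p\<in>sl_index. c p * trace_op n ((T - A) * orth_basis n (snd p, fst p)))"
      unfolding B(1) c by (simp add: sum_distrib_left tsum sc_left_commute[of "T - A"] trace_op_linear)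
    then show ?thesis using * by simp
  qed
  with A show ?thesis by blast
qed

section \<open>Highest weight vectors\<close>


text \<open>The iterated commutator expands into terms N^a T N^b with a + b = 2n + 1, so one
  exponent exceeds \<open>n\<close>. The induction carries the outer powers along.\<close>

lemma ad_nilpotent:
  fixes N :: "'r::ring_1"
  assumes N: "N ^ Suc n = 0"
  shows "(ad N ^^ (2 * n + 1)) T = 0"
proof -
  have "N ^ a * (ad N ^^ k) T * N ^ b = 0" if "2 * n + 1 \<le> a + b + k" for a b k
    using that
  proof (induction k arbitrary: a b)
    case 0
    have z: "N ^ c = 0" if "Suc n \<le> c" for c
      using that N power_add[of N "Suc n" "c - Suc n"] by (simp del: power_Suc)
    have "Suc n \<le> a \<or> Suc n \<le> b" using 0 by linarith
    then show ?case using z by auto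
  next
    case (Suc k)
    have 1: "(ad N ^^ Suc k) T = N * (ad N ^^ k) T - (ad N ^^ k) T * N" by (simp add: ad_def)
    have "N ^ a * (ad N ^^ Suc k) T * N ^ b
      = N ^ Suc a * (ad N ^^ k) T * N ^ b - N ^ a * (ad N ^^ k) T * N ^ Suc b"
      unfolding 1 power_Suc2[of N a] power_Suc[of N b]
      by (simp only: left_diff_distrib right_diff_distrib mult.assoc)
    then show ?case using Suc.IH[of "Suc a" b] Suc.IH[of a "Suc b"] Suc.prems
      by (simp del: power_Suc funpow.simps)
  qed
  from this[of 0 0 "2 * n + 1"] show ?thesis by simp
qed

text \<open>The last nonzero iterate of \<open>f\<close> on \<open>T\<close> lies in the
  kernel.\<close>

lemma nilpotent_kernel:
  assumes "T \<in> V" "T \<noteq> 0" "\<And>X. X \<in> V \<Longrightarrow> f X \<in> V" "(f ^^ k) T = 0"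
  shows "\<exists>X\<in>V. X \<noteq> 0 \<and> f X = 0"
  using assms(1,2,4)
proof (induction k arbitrary: T)
  case (Suc k)
  show ?case
  proof (cases "f T = 0")
    case False
    have "(f ^^ k) (f T) = 0" using Suc.prems(3) by (simp add: funpow_swap1)
    then show ?thesis using Suc.IH[of "f T"] False assms(3) Suc.prems(1) by blast
  qed (use Suc.prems in blast)
qed simp

lemma ad_ad: "ad A (ad B T) = ad B (ad A T) + ad (A * B - B * A) T"
  by (simp add: ad_def algebra_simps)

text \<open>Engel's argument for the strictly upper triangular matrices. The central E_xz comes
  first, so that its kernel is stable under the other two; on this kernel E_xy and E_yz act by
  commuting operators, as their commutator is E_xz.\<close>

lemma highest_weight_vector:
  fixes T :: "'a::field_char_0 endo"
  assumes T: "T \<in> rank_neutral_perp m" "T \<noteq> 0" and m: "m > 0"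
  shows "\<exists>X\<in>(rank_neutral_perp m :: 'a endo set). X \<noteq> 0 \<and> ad (elem_op (3 * m) AX AY) X = 0 \<and> ad (elem_op (3 * m) AX AZ) X = 0
    \<and> ad (elem_op (3 * m) AY AZ) X = 0"
proof -
  let ?e = "elem_op (3 * m) :: axis \<Rightarrow> axis \<Rightarrow> 'a endo"
  have nil: "(ad (?e i j) ^^ (2 * (3 * m) + 1)) X = 0" if "i \<noteq> j" for i j X
    by (rule ad_nilpotent[OF elem_op_nilpotent[OF that]])
  note rank_neutral = rank_neutral_perp_ad[OF _ _ m]
  have "\<exists>X\<in>rank_neutral_perp m. X \<noteq> 0 \<and> ad (?e AX AZ) X = 0"
    by (rule nilpotent_kernel[where f = "ad (?e AX AZ)", OF T _ nil]) (simp_all add: rank_neutral)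
  then obtain T1 where T1: "T1 \<in> rank_neutral_perp m" "T1 \<noteq> 0" "ad (?e AX AZ) T1 = 0" by blast
  define V where "V = {X \<in> rank_neutral_perp m. ad (?e AX AZ) X = 0}"
  have ad0: "ad 0 X = 0" for X :: "'a endo" by (simp add: ad_def)
  have c1: "ad (?e AX AZ) (ad (?e AX AY) X) = ad (?e AX AY) (ad (?e AX AZ) X)" for X
    using ad_ad[of "?e AX AZ" "?e AX AY" X] by (simp add: elem_op_commutator ad0)
  have c2: "ad (?e AX AZ) (ad (?e AY AZ) X) = ad (?e AY AZ) (ad (?e AX AZ) X)" for X
    using ad_ad[of "?e AX AZ" "?e AY AZ" X] by (simp add: elem_op_commutator ad0)
  have c3: "ad (?e AX AY) (ad (?e AY AZ) X) = ad (?e AY AZ) (ad (?e AX AY) X) + ad (?e AX AZ) X" for X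
    using ad_ad[of "?e AX AY" "?e AY AZ" X] by (simp add: elem_op_commutator)
  have "T1 \<in> V" using T1 by (simp add: V_def)
  then have "\<exists>X\<in>V. X \<noteq> 0 \<and> ad (?e AX AY) X = 0"
    by (rule nilpotent_kernel[where f = "ad (?e AX AY)", OF _ T1(2) _ nil]) (simp_all add: V_def rank_neutral c1 ad_0)
  then obtain T2 where T2: "T2 \<in> V" "T2 \<noteq> 0" "ad (?e AX AY) T2 = 0" by blast
  define V' where "V' = {X \<in> V. ad (?e AX AY) X = 0}"
  have "T2 \<in> V'" using T2 by (simp add: V'_def)
  then have "\<exists>X\<in>V'. X \<noteq> 0 \<and> ad (?e AY AZ) X = 0"
    by (rule nilpotent_kernel[where f = "ad (?e AY AZ)", OF _ T2(2) _ nil]) (simp_all add: V'_def V_def rank_neutral c2 c3 ad_0)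
  then obtain T3 where "T3 \<in> V'" "T3 \<noteq> 0" "ad (?e AY AZ) T3 = 0" by blast
  then show ?thesis unfolding V'_def V_def by blast
qed

text \<open>An invariant subspace contains the eigencomponents of each of its vectors:
  \<open>ad H\<close> minus one eigenvalue removes that component and rescales the others by nonzero
  factors, which drives the induction.\<close>

lemma eigenvector_separation:
  fixes v :: "'b \<Rightarrow> 'a::field_char_0 endo"
  assumes V: "\<And>S T. S \<in> V \<Longrightarrow> T \<in> V \<Longrightarrow> S + T \<in> V" "\<And>c T. T \<in> V \<Longrightarrow> sc c * T \<in> V"
    and H: "\<And>T. T \<in> V \<Longrightarrow> ad H T \<in> V"
    and fin: "finite S" and inj: "inj_on ev S"
  shows "(\<And>k. k \<in> S \<Longrightarrow> ad H (v k) = sc (ev k) * v k) \<Longrightarrow> (\<Sum>k\<in>S. v k) \<in> V \<Longrightarrow> k \<in> S \<Longrightarrow> v k \<in> V"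
  using fin inj
proof (induction S arbitrary: v k rule: finite_induct)
  case (insert j S)
  let ?X = "\<Sum>k\<in>insert j S. v k"
  have zero: "0 \<in> V" using V(2)[OF insert.prems(2), of 0] by (simp add: mul_hom)
  have Vsum: "(\<And>x. x \<in> F \<Longrightarrow> w x \<in> V) \<Longrightarrow> sum w F \<in> V" for w :: "'b \<Rightarrow> 'a endo" and F
    by (induction F rule: infinite_finite_induct) (auto intro: V zero)
  have adsum: "ad H (sum w F) = (\<Sum>x\<in>F. ad H (w x))" for w :: "'b \<Rightarrow> 'a endo" and F
    by (induction F rule: infinite_finite_induct) (simp_all add: ad_0 ad_add)
  define w where "w k = sc (ev k - ev j) * v k" for k
  have "ad H ?X + sc (- ev j) * ?X = (\<Sum>k\<in>insert j S. sc (ev k) * v k + sc (- ev j) * v k)"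
    unfolding adsum sum_distrib_left sum.distrib using insert.prems(1) by simp
  also have "\<dots> = (\<Sum>k\<in>insert j S. w k)"
    by (rule sum.cong) (simp_all add: w_def mul_hom distrib_right left_diff_distrib)
  also have "\<dots> = (\<Sum>k\<in>S. w k)" using insert.hyps by (simp add: w_def mul_hom)
  finally have "(\<Sum>k\<in>S. w k) \<in> V" using V H insert.prems(2) by metis
  moreover have "ad H (w k) = sc (ev k) * w k" if "k \<in> S" for k
    using insert.prems(1)[of k] that by (simp add: w_def ad_sc sc_mult mult.commute del: cst_hom)
  ultimately have "w k \<in> V" if "k \<in> S" for k
    using insert.IH[of w k] that insert.prems(4) by (simp add: inj_on_insert)
  then have S: "v k \<in> V" if "k \<in> S" for k
  proof -
    have "ev k - ev j \<noteq> 0" using insert.prems(4) insert.hyps that by (auto simp: inj_on_def)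
    then have "v k = sc (1 / (ev k - ev j)) * w k" by (simp add: w_def sc_mult mul_hom del: cst_hom(6))
    then show ?thesis using V(2) \<open>\<And>k. k \<in> S \<Longrightarrow> w k \<in> V\<close>[OF that] by metis
  qed
  have "v j = ?X + sc (-1) * (\<Sum>k\<in>S. v k)" using insert.hyps by (simp add: mul_hom)
  then have "v j \<in> V" using V insert.prems(2) Vsum[of S v] S by metis
  then show ?case using insert.prems(3) S by blast
qed simp

section \<open>Highest weight vectors as combinations of powers of x d/dz\<close>

lemma vfield_mon3:
  "app (vfield AX AZ) (mon3 a b c) = cst (of_nat c) * mon3 (Suc a) b (c - 1)"
  "app (vfield AY AZ) (mon3 a b c) = cst (of_nat c) * mon3 a (Suc b) (c - 1)"
  by (rule poly3_eqI; auto simp: coeff3_vfield coeff3_dvar coeff3_mon3)+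

lemma vfield_power_mon3:
  "k \<le> c \<Longrightarrow> \<exists>\<kappa>::'a::field_char_0. \<kappa> \<noteq> 0 \<and> app (vfield AX AZ ^ k) (mon3 a b c) = cst \<kappa> * mon3 (a + k) b (c - k)"
  "k \<le> c \<Longrightarrow> \<exists>\<kappa>::'a::field_char_0. \<kappa> \<noteq> 0 \<and> app (vfield AY AZ ^ k) (mon3 a b c) = cst \<kappa> * mon3 a (b + k) (c - k)"
proof (induction k)
  case (Suc k)
  { case 1
    then obtain \<kappa> :: 'a where "\<kappa> \<noteq> 0" "app (vfield AX AZ ^ k) (mon3 a b c) = cst \<kappa> * mon3 (a + k) b (c - k)"
      using Suc.IH(1) by auto
    then show ?case using 1 by (intro exI[of _ "\<kappa> * of_nat (c - k)"]) (simp add: vfield_mon3 mult.assoc)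
  next
    case 2
    then obtain \<kappa> :: 'a where "\<kappa> \<noteq> 0" "app (vfield AY AZ ^ k) (mon3 a b c) = cst \<kappa> * mon3 a (b + k) (c - k)"
      using Suc.IH(2) by auto
    then show ?case using 2 by (intro exI[of _ "\<kappa> * of_nat (c - k)"]) (simp add: vfield_mon3 mult.assoc) }
qed (auto intro!: exI[of _ 1])

lemma commute_power: "(x::'r::ring_1) * y = y * x \<Longrightarrow> x * y ^ k = y ^ k * x"
  using power_commuting_commutes[of y x k] by simp

text \<open>The monomial z^n is cyclic for x d/dz and y d/dz: up to nonzero factors they produce
  every monomial of degree \<open>n\<close> from it. So an operator commuting with both is
  determined by its value there.\<close>

lemma commutant_cyclic:
  fixes D :: "'a::field_char_0 endo"
  assumes D: "D \<in> corner n" and c: "D * vfield AX AZ = vfield AX AZ * D" "D * vfield AY AZ = vfield AY AZ * D"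
    and z: "app D (mon3 0 0 n) = 0"
  shows "D = 0"
proof (rule corner_eqI[of D n 0])
  fix x y assume "x \<in> homog_indices n"
  then obtain a b c where x: "x = (a, b, c)" "a + b + c = n" by (auto simp: homog_indices_def)
  obtain \<kappa>1 :: 'a where k1: "\<kappa>1 \<noteq> 0" "app (vfield AY AZ ^ b) (mon3 0 0 n) = cst \<kappa>1 * mon3 0 b (n - b)"
    using vfield_power_mon3(2)[of b n 0 0] x by auto
  obtain \<kappa>2 :: 'a where k2: "\<kappa>2 \<noteq> 0" "app (vfield AX AZ ^ a) (mon3 0 b (n - b)) = cst \<kappa>2 * mon3 a b c"
    using vfield_power_mon3(1)[of a "n - b" 0 b] x by (auto simp: diff_diff_left)
  have "D * (vfield AX AZ ^ a * vfield AY AZ ^ b) = vfield AX AZ ^ a * vfield AY AZ ^ b * D"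
  proof -
    have "D * (vfield AX AZ ^ a * vfield AY AZ ^ b) = D * vfield AX AZ ^ a * vfield AY AZ ^ b" by (simp only: mult.assoc)
    also have "\<dots> = vfield AX AZ ^ a * (D * vfield AY AZ ^ b)" unfolding commute_power[OF c(1)] by (simp only: mult.assoc)
    finally show ?thesis unfolding commute_power[OF c(2)] by (simp only: mult.assoc)
  qed
  then have "app (D * (vfield AX AZ ^ a * vfield AY AZ ^ b)) (mon3 0 0 n) = 0" using z by simp
  then have "cst \<kappa>1 * (cst \<kappa>2 * app D (mon3 a b c)) = 0" by (simp add: k1 k2)
  then have "app D (mon3 a b c) = 0" using k1(1) k2(1) by simp
  then show "coeff_at (app D (mon_at x)) y = coeff_at (app 0 (mon_at x)) y" by (simp add: mon_at_def x)
qed (use D in \<open>simp_all add: corner_def\<close>)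

lemma commutes_vfield:
  assumes "T \<in> corner n" "ad (elem_op n i j) T = 0"
  shows "T * vfield i j = vfield i j * T"
proof -
  have "T * vfield i j = T * (hproj n * vfield i j)" using assms(1) by (simp add: corner_def mult.assoc[symmetric])
  also have "\<dots> = T * elem_op n i j" by (simp add: hproj_vfield elem_op_def)
  also have "\<dots> = elem_op n i j * T" using assms(2) by (simp add: ad_def)
  also have "\<dots> = vfield i j * T" using assms(1) by (simp add: elem_op_def mult.assoc corner_def)
  finally show ?thesis .
qed

lemma vfield_commute_nilradical: "vfield AX AZ * vfield AY AZ = vfield AY AZ * vfield AX AZ"
  using vfield_commutator[of AX AZ AY AZ] by simp

text \<open>The value \<open>u\<close> of \<open>T\<close> at z^n determines \<open>T\<close>. Since
  x d/dy kills z^n and commutes with \<open>T\<close>, it kills \<open>u\<close>, which therefore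
  does not involve y. So \<open>u\<close> is a combination of the x^k z^(n - k), and these are, up
  to nonzero factors, the values of the powers of x d/dz at z^n.\<close>

lemma commutant_nilradical:
  fixes T :: "'a::field_char_0 endo"
  assumes T: "T \<in> corner n" "ad (elem_op n AX AY) T = 0" "ad (elem_op n AX AZ) T = 0" "ad (elem_op n AY AZ) T = 0"
  shows "\<exists>c. T = (\<Sum>k\<le>n. sc (c k) * (vfield AX AZ ^ k * hproj n))"
proof -
  define u where "u = app T (mon3 0 0 n)"
  have u0: "coeff3 u a b c = 0" if "a + b + c \<noteq> n" for a b c
  proof -
    have "u = app (hproj n) u" using T(1) app_ring_ops(6)[of "hproj n" T "mon3 0 0 n"] by (simp add: u_def corner_def)
    then show ?thesis using that coeff3_hproj[of n u a b c] by simp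
  qed
  have "app (vfield AX AY) (mon3 0 0 n) = (0 :: 'a poly3)"
    by (rule poly3_eqI) (auto simp: coeff3_vfield coeff3_dvar coeff3_mon3)
  then have "app (T * vfield AX AY) (mon3 0 0 n) = 0" by simp
  then have "app (vfield AX AY) u = 0" unfolding commutes_vfield[OF T(1,2)] by (simp add: u_def)
  then have "coeff3 (app (vfield AX AY) u) (Suc a) b c = 0" for a b c by simp
  then have "of_nat (Suc b) * coeff3 u a (Suc b) c = 0" for a b c
    by (simp add: coeff3_vfield coeff3_dvar)
  then have ub: "coeff3 u a (Suc b) c = 0" for a b c
    by (simp only: mult_eq_0_iff of_nat_eq_0_iff) simp
  have "\<exists>\<kappa>::'a. k \<le> n \<longrightarrow> \<kappa> \<noteq> 0 \<and> app (vfield AX AZ ^ k) (mon3 0 0 n) = cst \<kappa> * mon3 k 0 (n - k)" for k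
    using vfield_power_mon3(1)[of k n 0 0] by auto
  then have "\<exists>\<kappa>. \<forall>k. k \<le> n \<longrightarrow> \<kappa> k \<noteq> 0 \<and>
      app (vfield AX AZ ^ k) (mon3 0 0 n) = cst (\<kappa> k :: 'a) * mon3 k 0 (n - k)"
    by (intro choice allI)
  then obtain \<kappa> where "\<forall>k. k \<le> n \<longrightarrow> \<kappa> k \<noteq> 0 \<and>
      app (vfield AX AZ ^ k) (mon3 0 0 n) = cst (\<kappa> k :: 'a) * mon3 k 0 (n - k)" ..
  then have \<kappa>: "\<And>k. k \<le> n \<Longrightarrow> \<kappa> k \<noteq> 0"
    "\<And>k. k \<le> n \<Longrightarrow> app (vfield AX AZ ^ k) (mon3 0 0 n) = cst (\<kappa> k) * mon3 k 0 (n - k)"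
    by simp_all
  define c where "c k = coeff3 u k 0 (n - k) / \<kappa> k" for k
  define S where "S = (\<Sum>k\<le>n. sc (c k) * (vfield AX AZ ^ k * hproj n))"
  have prz: "app (hproj n) (mon3 0 0 n) = (mon3 0 0 n :: 'a poly3)"
    by (rule poly3_eqI) (auto simp: coeff3_hproj coeff3_mon3)
  have "app S (mon3 0 0 n) = (\<Sum>k\<le>n. cst (coeff3 u k 0 (n - k)) * mon3 k 0 (n - k))"
    unfolding S_def app_sum_left
  proof (rule sum.cong[OF refl])
    fix k assume "k \<in> {..n}"
    then have k: "k \<le> n" by simp
    have "app (sc (c k) * (vfield AX AZ ^ k * hproj n)) (mon3 0 0 n) = cst (c k) * (cst (\<kappa> k) * mon3 k 0 (n - k))"
      by (simp add: prz \<kappa>(2)[OF k])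
    also have "\<dots> = cst (c k * \<kappa> k) * mon3 k 0 (n - k)" by (simp add: mult.assoc)
    finally show "app (sc (c k) * (vfield AX AZ ^ k * hproj n)) (mon3 0 0 n) = cst (coeff3 u k 0 (n - k)) * mon3 k 0 (n - k)"
      using \<kappa>(1)[OF k] by (simp add: c_def)
  qed
  also have "\<dots> = u"
  proof (rule poly3_eqI)
    fix x y z
    have "coeff3 (\<Sum>k\<le>n. cst (coeff3 u k 0 (n - k)) * mon3 k 0 (n - k)) x y z
      = (\<Sum>k\<le>n. if k = x then (if y = 0 \<and> n - x = z then coeff3 u x 0 (n - x) else 0) else 0)"
      unfolding coeff3_sum by (rule sum.cong) (simp_all add: coeff3_mon3)
    also have "\<dots> = coeff3 u x y z"
    proof (cases "y = 0 \<and> x + z = n")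
      case True
      then have "n - x = z" "x \<le> n" by auto
      then show ?thesis using True by simp
    next
      case False
      then have "coeff3 u x y z = 0" using u0[of x y z] ub[of x _ z] by (cases y) auto
      moreover have "\<not> (x \<le> n \<and> y = 0 \<and> n - x = z)" using False by auto
      ultimately show ?thesis by (cases "x \<le> n") (auto simp: sum.delta)
    qed
    finally show "coeff3 (\<Sum>k\<le>n. cst (coeff3 u k 0 (n - k)) * mon3 k 0 (n - k)) x y z = coeff3 u x y z" .
  qed
  finally have agree: "app (T - S) (mon3 0 0 n) = 0" by (simp add: u_def)
  let ?F = "vfield AX AZ :: 'a endo"
  have Sc: "S * X = X * S" if "?F * X = X * ?F" "hproj n * X = X * hproj n" for X
  proof -
    have "(?F ^ k * hproj n) * X = X * (?F ^ k * hproj n)" for k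
    proof -
      have "(?F ^ k * hproj n) * X = ?F ^ k * X * hproj n" using that(2) by (simp only: mult.assoc)
      also have "?F ^ k * X = X * ?F ^ k" by (rule commute_power[OF that(1)[symmetric], symmetric])
      finally show ?thesis by (simp only: mult.assoc)
    qed
    then show ?thesis
      by (simp add: S_def sum_distrib_left sum_distrib_right mult.assoc sc_left_commute[of X])
  qed
  have "T - S = 0"
  proof (rule commutant_cyclic[OF _ _ _ agree])
    have "S * hproj n = S" by (simp add: S_def sum_distrib_right mult.assoc hproj_idem)
    moreover have "S * hproj n = hproj n * S" by (rule Sc) (simp_all add: hproj_vfield)
    ultimately show "T - S \<in> corner n" by (intro corner_diff T(1)) (simp add: corner_def)
    show "(T - S) * vfield AX AZ = vfield AX AZ * (T - S)"
      using commutes_vfield[OF T(1,3)] Sc[of ?F] hproj_vfield[of n AX AZ] by (simp add: left_diff_distrib right_diff_distrib)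
    show "(T - S) * vfield AY AZ = vfield AY AZ * (T - S)"
      using commutes_vfield[OF T(1,4)] Sc[of "vfield AY AZ"] hproj_vfield[of n AY AZ] vfield_commute_nilradical
      by (simp add: left_diff_distrib right_diff_distrib)
  qed
  then show ?thesis unfolding S_def by auto
qed

text \<open>The powers have distinct weights 2k under E_xx - E_zz, which makes them separable inside
  an invariant subspace.\<close>

lemma ad_cartan_power:
  fixes n k :: nat
  defines "F \<equiv> vfield AX AZ :: 'a::field_char_0 endo"
  shows "ad (elem_op n AX AX - elem_op n AZ AZ) (F ^ k * hproj n) = sc (of_nat (2 * k)) * (F ^ k * hproj n)"
proof -
  define H where "H = (vfield AX AX - vfield AZ AZ :: 'a endo)"
  have HF: "H * F = F * H + sc 2 * F"
    using vfield_commutator[of AX AX AX AZ, where 'a='a] vfield_commutator[of AZ AZ AX AZ, where 'a='a]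
    by (simp add: H_def F_def sc_2 algebra_simps)
  have HFk: "H * F ^ k = F ^ k * H + sc (of_nat (2 * k)) * F ^ k" for k
  proof (induction k)
    case (Suc k)
    have "H * F ^ Suc k = (F * H + sc 2 * F) * F ^ k" by (simp add: mult.assoc[symmetric] HF)
    also have "\<dots> = F * (F ^ k * H + sc (of_nat (2 * k)) * F ^ k) + sc 2 * F ^ Suc k"
      by (simp only: distrib_right mult.assoc Suc power_Suc)
    also have "\<dots> = F ^ Suc k * H + (sc (of_nat (2 * k)) + sc 2) * F ^ Suc k"
      by (simp add: distrib_left distrib_right sc_left_commute[of F] mult.assoc add.assoc del: cst_hom)
    also have "sc (of_nat (2 * k)) + sc 2 = (sc (of_nat (2 * Suc k)) :: 'a endo)"
      unfolding mul_hom(3)[symmetric] cst_hom(3)[symmetric] by (simp add: algebra_simps del: cst_hom)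
    finally show ?case .
  qed (simp add: mul_hom)
  have prF: "hproj n * F ^ k = F ^ k * hproj n" unfolding F_def by (rule vfield_power_hproj)
  have prH: "hproj n * H = H * hproj n" by (simp add: H_def left_diff_distrib right_diff_distrib hproj_vfield)
  have h: "elem_op n AX AX - elem_op n AZ AZ = H * hproj n" by (simp add: H_def elem_op_def left_diff_distrib)
  have "ad (H * hproj n) (F ^ k * hproj n) = H * (hproj n * F ^ k) * hproj n - F ^ k * (hproj n * H) * hproj n"
    by (simp add: ad_def mult.assoc hproj_idem)
  also have "\<dots> = (H * F ^ k - F ^ k * H) * hproj n"
    unfolding prF prH by (simp add: mult.assoc hproj_idem left_diff_distrib)
  also have "\<dots> = sc (of_nat (2 * k)) * (F ^ k * hproj n)" unfolding HFk by (simp add: mult.assoc)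
  finally show ?thesis unfolding h .
qed

lemma rank_neutral_perp_power:
  fixes T :: "'a::field_char_0 endo"
  assumes "T \<in> rank_neutral_perp m" "T \<noteq> 0" "m > 0"
  shows "\<exists>k\<le>3 * m. vfield AX AZ ^ k * hproj (3 * m) \<in> (rank_neutral_perp m :: 'a endo set)"
proof -
  let ?n = "3 * m"
  obtain X :: "'a endo" where X: "X \<in> rank_neutral_perp m" "X \<noteq> 0" "ad (elem_op ?n AX AY) X = 0" "ad (elem_op ?n AX AZ) X = 0" "ad (elem_op ?n AY AZ) X = 0"
    using highest_weight_vector[OF assms] by blast
  obtain c :: "nat \<Rightarrow> 'a" where c: "X = (\<Sum>k\<le>?n. sc (c k) * (vfield AX AZ ^ k * hproj ?n))"
    using commutant_nilradical[OF rank_neutral_perp_corner[OF X(1)] X(3-5)] by blast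
  have "\<exists>k\<le>?n. c k \<noteq> 0"
  proof (rule ccontr)
    assume "\<not> ?thesis"
    then have "X = 0" unfolding c by (intro sum.neutral) (auto simp: mul_hom)
    with X(2) show False by simp
  qed
  then obtain k where k: "k \<le> ?n" "c k \<noteq> 0" by blast
  define v :: "nat \<Rightarrow> 'a endo" where "v k = sc (c k) * (vfield AX AZ ^ k * hproj ?n)" for k
  have inj: "inj_on (\<lambda>k. of_nat (2 * k) :: 'a) {..?n}" by (auto simp: inj_on_def simp del: of_nat_mult)
  have eig: "ad (elem_op ?n AX AX - elem_op ?n AZ AZ) (v k) = sc (of_nat (2 * k)) * v k" for k
    unfolding v_def ad_sc ad_cartan_power by (rule sc_left_commute)
  have H: "ad (elem_op ?n AX AX - elem_op ?n AZ AZ) S \<in> rank_neutral_perp m" if "S \<in> rank_neutral_perp m" for S :: "'a endo"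
    by (rule rank_neutral_perp_ad_cartan[OF that _ assms(3)]) simp
  have sumv: "(\<Sum>k\<le>?n. v k) \<in> rank_neutral_perp m" using X(1) c by (simp add: v_def)
  have "v k \<in> rank_neutral_perp m"
    by (rule eigenvector_separation[where H = "elem_op ?n AX AX - elem_op ?n AZ AZ" and S = "{..?n}" and ev = "\<lambda>k. of_nat (2 * k)"])
      (use rank_neutral_perp_add rank_neutral_perp_sc H inj eig k(1) sumv in auto)
  then have "sc (c k) * (vfield AX AZ ^ k * hproj ?n) \<in> rank_neutral_perp m" by (simp add: v_def)
  then have "sc (1 / c k) * (sc (c k) * (vfield AX AZ ^ k * hproj ?n)) \<in> rank_neutral_perp m" by (rule rank_neutral_perp_sc)
  also have "sc (1 / c k) * (sc (c k) * (vfield AX AZ ^ k * hproj ?n)) = vfield AX AZ ^ k * hproj ?n"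
    unfolding sc_mult using k(2) by (simp add: mul_hom)
  finally show ?thesis using k(1) by blast
qed

section \<open>The test function on powers of a root vector\<close>


text \<open>For \<open>i \<noteq> j\<close> this is exp(t ad E_ij) applied to A, exact at order
  two.\<close>

definition conj_mat :: "axis \<Rightarrow> axis \<Rightarrow> 'a::field_char_0 \<Rightarrow> (axis \<Rightarrow> axis \<Rightarrow> 'a) \<Rightarrow> axis \<Rightarrow> axis \<Rightarrow> 'a" where
  "conj_mat i j t A k l = A k l + t * ad_mat i j A k l + t ^ 2 / 2 * ad_mat i j (ad_mat i j A) k l"

lemma trace3_conj_mat: "trace3 (conj_mat i j t A) = trace3 A"
  using trace3_ad_mat[of i j A] trace3_ad_mat[of i j "ad_mat i j A"]
  by (simp add: conj_mat_def trace3_def sum.distrib sum_distrib_left[symmetric] sum_divide_distrib[symmetric])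

text \<open>The factor \<open>hproj n\<close> matters at \<open>k = 0\<close>, where the bare power
  is the identity of the whole ring and not of the corner.\<close>

lemma conj_op_gl_op_power:
  fixes A :: "axis \<Rightarrow> axis \<Rightarrow> 'a::field_char_0"
  assumes ij: "i \<noteq> j" and tr: "trace3 A = 0"
  shows "conj_op n (i, j, t) (gl_op n A ^ k * hproj n) = gl_op n (conj_mat i j t A) ^ k * hproj n"
proof -
  let ?X = "exp_op n (elem_op n i j) t :: 'a endo" and ?Y = "exp_op n (elem_op n i j) (- t) :: 'a endo"
  have nil: "elem_op n i j ^ Suc n = (0 :: 'a endo)" by (rule elem_op_nilpotent[OF ij])
  have "gl_op n A + sc t * ad (elem_op n i j) (gl_op n A) + sc (t ^ 2 / 2) * ad (elem_op n i j) (ad (elem_op n i j) (gl_op n A))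
      = gl_op n (conj_mat i j t A)"
    by (simp only: ad_gl_op gl_op_sc gl_op_add conj_mat_def[abs_def])
  then have 1: "?X * gl_op n A = gl_op n (conj_mat i j t A) * ?X"
    using exp_op_times[OF nil ad_sl_cube[OF ij gl_op_sl[OF tr]], of t] by simp
  have "?X * gl_op n A ^ k = gl_op n (conj_mat i j t A) ^ k * ?X"
  proof (induction k)
    case (Suc k)
    have "?X * gl_op n A ^ Suc k = ?X * gl_op n A * gl_op n A ^ k" by (simp only: power_Suc mult.assoc)
    also have "\<dots> = gl_op n (conj_mat i j t A) * (?X * gl_op n A ^ k)" unfolding 1 by (simp only: mult.assoc)
    finally show ?case unfolding Suc by (simp only: power_Suc mult.assoc)
  qed simp
  then have "?X * (gl_op n A ^ k * hproj n) * ?Y = gl_op n (conj_mat i j t A) ^ k * (?X * hproj n) * ?Y"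
    by (simp only: mult.assoc[symmetric])
  also have "\<dots> = gl_op n (conj_mat i j t A) ^ k * hproj n * (?X * ?Y)"
    unfolding exp_op_hproj[symmetric] by (simp only: mult.assoc)
  finally show ?thesis using ij by (simp add: conj_op_def exp_op_inverse(1)[OF nil])
qed

text \<open>All rows are equal because the operator is x + y + z times a constant field. The
  coefficients p, q, r with sum zero are scaled to r = 1, leaving q = t free.\<close>

definition rank1 :: "'a::field_char_0 \<Rightarrow> axis \<Rightarrow> axis \<Rightarrow> 'a" where
  "rank1 t i j = (case j of AX \<Rightarrow> - 1 - t | AY \<Rightarrow> t | AZ \<Rightarrow> 1)"

text \<open>Three unipotent substitutions conjugate \<open>x \<partial>\<^sub>z\<close> to
  \<open>(x + y + z) (- (1 + t) \<partial>\<^sub>x + t \<partial>\<^sub>y + \<partial>\<^sub>z)\<close>.\<close>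

lemma conj_mat_rank1:
  "conj_mat AZ AX 1 (conj_mat AY AX 1 (conj_mat AZ AY (- t) (\<lambda>i j. if i = AX \<and> j = AZ then 1 else 0))) = rank1 t"
proof (intro ext)
  fix i j
  show "conj_mat AZ AX 1 (conj_mat AY AX 1 (conj_mat AZ AY (- t) (\<lambda>i j. if i = AX \<and> j = AZ then 1 else 0))) i j = rank1 t i j"
    by (cases i; cases j; simp add: conj_mat_def ad_mat_def rank1_def)
qed

lemma rank_neutral_rank1:
  assumes "vfield AX AZ ^ k * hproj (3 * m) \<in> (rank_neutral m :: 'a::field_char_0 endo set)"
  shows "gl_op (3 * m) (rank1 t) ^ k * hproj (3 * m) \<in> (rank_neutral m :: 'a endo set)"
proof -
  let ?A = "\<lambda>i j. if i = AX \<and> j = AZ then 1 else (0::'a)"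
  have tr: "trace3 ?A = 0" by (simp add: trace3_def sum_axis)
  have "gl_op (3 * m) ?A = elem_op (3 * m) AX AZ" by (simp add: gl_op_def sum_axis mul_hom)
  then have "gl_op (3 * m) ?A ^ k * hproj (3 * m) \<in> rank_neutral m" using assms by (simp add: elem_op_power)
  then have "conj_op (3 * m) (AZ, AX, 1) (conj_op (3 * m) (AY, AX, 1) (conj_op (3 * m) (AZ, AY, - t)
      (gl_op (3 * m) ?A ^ k * hproj (3 * m)))) \<in> rank_neutral m"
    by (intro rank_neutral_conj_op)
  then show ?thesis by (simp add: conj_op_gl_op_power trace3_conj_mat tr conj_mat_rank1)
qed

section \<open>The middle entry of a power of the conjugated root vector\<close>

definition const_field :: "(axis \<Rightarrow> 'a) \<Rightarrow> 'a::field_char_0 endo" where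
  "const_field p = (\<Sum>j\<in>UNIV. sc (p j) * dd j)"

lemma coeff3_const_field:
  "coeff3 (app (const_field p) f) a b c = p AX * (of_nat (a + 1) * coeff3 f (a + 1) b c)
    + p AY * (of_nat (b + 1) * coeff3 f a (b + 1) c) + p AZ * (of_nat (c + 1) * coeff3 f a b (c + 1))"
  by (simp add: const_field_def app_sum_left sum_axis coeff3_dvar)

text \<open>Expanding the k-th power multinomially, (p d/dx)^i x^m / i! = (m choose i) p^i x^(m -
  i), and likewise in y and z; so k! and three binomials remain. Exponents above \<open>m\<close>
  are covered by vanishing binomials.\<close>

lemma coeff3_const_field_power:
  fixes p :: "axis \<Rightarrow> 'a::field_char_0"
  shows "coeff3 (app (const_field p ^ k) (mon3 m m m)) a b c = (if a + b + c + k = 3 * m then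
    fact k * (of_nat (m choose a) * p AX ^ (m - a)) * (of_nat (m choose b) * p AY ^ (m - b))
     * (of_nat (m choose c) * p AZ ^ (m - c)) else 0)"
proof (induction k arbitrary: a b c)
  case 0
  show ?case
  proof (cases "a \<le> m \<and> b \<le> m \<and> c \<le> m")
    case True
    then have "a + b + c = 3 * m \<longleftrightarrow> m = a \<and> m = b \<and> m = c" by auto
    then show ?thesis by (auto simp: coeff3_mon3)
  next
    case False
    then have "of_nat (m choose a) = (0::'a) \<or> of_nat (m choose b) = (0::'a) \<or> of_nat (m choose c) = (0::'a)"
      by (auto simp: binomial_eq_0)
    then show ?thesis using False by (auto simp: coeff3_mon3)
  qed
next
  case (Suc k)
  define g where "g q a = of_nat (m choose a) * q ^ (m - a)" for q :: 'a and a
  have step: "q * (of_nat (a + 1) * g q (a + 1)) = of_nat (m - a) * g q a" for q a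
  proof (cases "a < m")
    case True
    have "(a + 1) * (m choose (a + 1)) = (m - a) * (m choose a)"
      using binomial_absorb_comp[of m a] binomial_absorption[of a m] by simp
    then have "(of_nat ((a + 1) * (m choose (a + 1))) :: 'a) = of_nat ((m - a) * (m choose a))" by (simp only:)
    then have "of_nat (a + 1) * of_nat (m choose (a + 1)) = (of_nat (m - a) * of_nat (m choose a) :: 'a)"
      by (simp only: of_nat_mult)
    moreover have "q ^ (m - a) = q * q ^ (m - (a + 1))"
      using True power_Suc[of q "m - (a + 1)"] by (simp add: Suc_diff_Suc del: power_Suc)
    moreover have "q * (of_nat (a + 1) * g q (a + 1))
      = of_nat (a + 1) * of_nat (m choose (a + 1)) * (q * q ^ (m - (a + 1)))"
      unfolding g_def by (simp only: mult_ac)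
    ultimately show ?thesis by (simp only: g_def mult.assoc)
  qed (simp add: g_def binomial_eq_0)
  have IH: "coeff3 (app (const_field p ^ k) (mon3 m m m)) a b c = (if a + b + c + k = 3 * m then
    fact k * g (p AX) a * g (p AY) b * g (p AZ) c else 0)" for a b c
    unfolding Suc.IH g_def ..
  have "coeff3 (app (const_field p ^ Suc k) (mon3 m m m)) a b c
    = (if a + b + c + Suc k = 3 * m then
        fact k * ((p AX * (of_nat (a + 1) * g (p AX) (a + 1))) * g (p AY) b * g (p AZ) c
          + (p AY * (of_nat (b + 1) * g (p AY) (b + 1))) * g (p AX) a * g (p AZ) c
          + (p AZ * (of_nat (c + 1) * g (p AZ) (c + 1))) * g (p AX) a * g (p AY) b) else 0)"
    by (simp add: coeff3_const_field IH) (simp add: algebra_simps)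
  also have "\<dots> = (if a + b + c + Suc k = 3 * m then
        fact k * of_nat ((m - a) + (m - b) + (m - c)) * g (p AX) a * g (p AY) b * g (p AZ) c else 0)"
    unfolding step by (simp add: algebra_simps)
  \<comment> \<open>The exponents removed from the three variables add up to k + 1, which turns k!
    into (k + 1)!.\<close>
  also have "\<dots> = (if a + b + c + Suc k = 3 * m then fact (Suc k) * g (p AX) a * g (p AY) b * g (p AZ) c else 0)"
  proof (cases "a \<le> m \<and> b \<le> m \<and> c \<le> m")
    case True
    then have "a + b + c + Suc k = 3 * m \<Longrightarrow> (m - a) + (m - b) + (m - c) = Suc k" by linarith
    then show ?thesis by (simp only: fact_Suc mult.commute cong: if_cong) 
  next
    case False
    then have "g (p AX) a = 0 \<or> g (p AY) b = 0 \<or> g (p AZ) c = 0"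
      by (auto simp: g_def binomial_eq_0)
    then show ?thesis by auto
  qed
  finally show ?case unfolding g_def .
qed

lemma coeff3_var_power:
  "coeff3 (var AX ^ i * f) a b c = (if i \<le> a then coeff3 f (a - i) b c else 0)"
  "coeff3 (var AY ^ i * f) a b c = (if i \<le> b then coeff3 f a (b - i) c else 0)"
  "coeff3 (var AZ ^ i * f) a b c = (if i \<le> c then coeff3 f a b (c - i) else 0)"
proof -
  show "coeff3 (var AX ^ i * f) a b c = (if i \<le> a then coeff3 f (a - i) b c else 0)"
    by (induction i arbitrary: a) (auto simp: mult.assoc coeff3_var diff_diff_left)
  show "coeff3 (var AY ^ i * f) a b c = (if i \<le> b then coeff3 f a (b - i) c else 0)"
    by (induction i arbitrary: b) (auto simp: mult.assoc coeff3_var diff_diff_left)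
  show "coeff3 (var AZ ^ i * f) a b c = (if i \<le> c then coeff3 f a b (c - i) else 0)"
    by (induction i arbitrary: c) (auto simp: mult.assoc coeff3_var diff_diff_left)
qed

text \<open>Because p + q + r = 0, the constant field d annihilates l = x + y + z and commutes with
  multiplication by it; hence (l d)^k = l^k d^k.\<close>

lemma gl_op_rank1_power:
  fixes t :: "'a::field_char_0"
  shows "gl_op n (rank1 t) ^ k * hproj n = mul ((var AX + (var AY + var AZ)) ^ k) * const_field (rank1 t AX) ^ k * hproj n"
proof -
  let ?l = "mul (var AX + (var AY + var AZ)) :: 'a endo" and ?d = "const_field (rank1 t AX) :: 'a endo"
  have gl_field: "gl_field (rank1 t) = ?l * ?d"
  proof -
    have "rank1 t = (\<lambda>i. rank1 t AX)" by (simp add: rank1_def fun_eq_iff)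
    then have "gl_field (rank1 t) = gl_field (\<lambda>i. rank1 t AX)" by (rule arg_cong)
    then show ?thesis
      unfolding gl_field_def by (simp add: const_field_def vfield_def sum_axis mul_hom(3) distrib_left distrib_right
          sc_left_commute[of "mm _"] mult.assoc add_ac)
  qed
  have hproj: "hproj n * gl_field (rank1 t) = gl_field (rank1 t) * hproj n"
    unfolding gl_field_def by (simp add: sum_distrib_left sum_distrib_right hproj_sc_left hproj_vfield mult.assoc)
  have c: "?d * ?l = ?l * ?d"
  proof (rule endo_eqI)
    fix f :: "'a poly3"
    define g where "g = (var AX + (var AY + var AZ) :: 'a poly3)"
    have "dvar j g = 1" for j by (cases j) (simp_all add: g_def dvar_add dvar_var)
    then have "app ?d (g * f) = (\<Sum>j\<in>UNIV. cst (rank1 t AX j)) * f + g * app ?d f"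
      by (simp add: const_field_def app_sum_left dvar_mult sum_axis algebra_simps del: cst_hom)
    also have "(\<Sum>j\<in>UNIV. cst (rank1 t AX j)) = 0" by (simp add: sum_axis rank1_def)
    finally show "app (?d * ?l) f = app (?l * ?d) f" by (simp add: g_def)
  qed
  have "gl_field (rank1 t) ^ k = ?l ^ k * ?d ^ k"
  proof (induction k)
    case (Suc k)
    have "gl_field (rank1 t) ^ Suc k = ?l * (?d * ?l ^ k) * ?d ^ k"
      by (simp only: power_Suc Suc) (simp only: gl_field mult.assoc)
    also have "\<dots> = ?l ^ Suc k * ?d ^ Suc k"
      unfolding commute_power[OF c] by (simp only: power_Suc mult.assoc)
    finally show ?case .
  qed simp
  moreover have "gl_op n (rank1 t) ^ k * hproj n = gl_field (rank1 t) ^ k * hproj n"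
  proof (induction k)
    case (Suc k)
    have "gl_op n (rank1 t) ^ Suc k * hproj n = gl_field (rank1 t) * hproj n * (gl_field (rank1 t) ^ k * hproj n)"
      by (simp only: power_Suc mult.assoc Suc) (simp only: gl_op_gl_field mult.assoc)
    also have "\<dots> = gl_field (rank1 t) * (hproj n * gl_field (rank1 t) ^ k) * hproj n" by (simp only: mult.assoc)
    also have "\<dots> = gl_field (rank1 t) ^ Suc k * hproj n"
      unfolding commute_power[OF hproj] by (simp only: power_Suc mult.assoc hproj_idem)
    finally show ?case .
  qed simp
  ultimately show ?thesis by (simp add: mul_power)
qed

text \<open>The power of the constant field contributes k! and three binomials, the power of x + y +
  z a multinomial coefficient, that is k! over three factorials. Each binomial joins one factorial
  to form a Laguerre coefficient.\<close>

lemma middle_entry_rank1: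
  fixes t :: "'a::field_char_0"
  shows "middle_entry m (gl_op (3 * m) (rank1 t) ^ k * hproj (3 * m)) = fact k * fact k *
    (\<Sum>i\<le>k. \<Sum>j\<le>k-i. laguerre m i * laguerre m j * laguerre m (k - i - j) * ((- 1 - t) ^ i * t ^ j))"
proof -
  let ?x = "var AX :: 'a poly3" and ?y = "var AY :: 'a poly3" and ?z = "var AZ :: 'a poly3"
  let ?f = "app (const_field (rank1 t AX) ^ k) (mon3 m m m)"
  have "(m, m, m) \<in> homog_indices (3 * m)" by (simp add: homog_indices_def)
  then have prm: "app (hproj (3 * m)) (mon_at (m, m, m)) = (mon_at (m, m, m) :: 'a poly3)"
    by (intro coeff_at_eqI) (auto simp: coeff_at_hproj coeff_at_mon_at)
  have "middle_entry m (gl_op (3 * m) (rank1 t) ^ k * hproj (3 * m)) = coeff3 ((?x + (?y + ?z)) ^ k * ?f) m m m"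
    unfolding middle_entry_def gl_op_rank1_power by (simp add: prm) (simp add: coeff_at_def mon_at_def)
  also have "(?x + (?y + ?z)) ^ k = (\<Sum>i\<le>k. \<Sum>j\<le>k-i. cst (of_nat (k choose i) * of_nat (k - i choose j))
      * (?x ^ i * (?y ^ j * ?z ^ (k - i - j))))"
  proof -
    have o: "cst (of_nat q) = (of_nat q :: 'a poly3)" for q by (induction q) simp_all
    show ?thesis
      unfolding binomial_ring[of ?x] binomial_ring[of ?y] by (simp add: sum_distrib_left o mult_ac)
  qed
  also have "coeff3 ((\<Sum>i\<le>k. \<Sum>j\<le>k-i. cst (of_nat (k choose i) * of_nat (k - i choose j))
      * (?x ^ i * (?y ^ j * ?z ^ (k - i - j)))) * ?f) m m m
     = (\<Sum>i\<le>k. \<Sum>j\<le>k-i. of_nat (k choose i) * of_nat (k - i choose j) *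
        coeff3 (?x ^ i * (?y ^ j * (?z ^ (k - i - j) * ?f))) m m m)"
    by (simp add: sum_distrib_right coeff3_sum mult.assoc del: cst_hom)
  also have "\<dots> = (\<Sum>i\<le>k. \<Sum>j\<le>k-i. fact k * fact k * (laguerre m i * laguerre m j * laguerre m (k - i - j) * ((- 1 - t) ^ i * t ^ j)))"
  proof (intro sum.cong refl)
    fix i j assume "i \<in> {..k}" and "j \<in> {..k-i}"
    then have ij: "i \<le> k" "j \<le> k - i" by auto
    define l where "l = k - i - j"
    have k: "k = i + j + l" using ij by (simp add: l_def)
    have mult: "of_nat (k choose i) * of_nat (k - i choose j) = (fact k / (fact i * fact j * fact l) :: 'a)"
    proof -
      have a: "of_nat (k choose i) = (fact k / (fact i * fact (j + l)) :: 'a)"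
        using binomial_fact[of i k, where 'a='a] by (simp add: k add.assoc)
      have b: "of_nat (k - i choose j) = (fact (j + l) / (fact j * fact l) :: 'a)"
        using binomial_fact[of j "j + l", where 'a='a] by (simp add: k add.assoc)
      show ?thesis unfolding a b by (simp add: field_simps)
    qed
    have "coeff3 (?x ^ i * (?y ^ j * (?z ^ l * ?f))) m m m
      = fact k * (of_nat (m choose i) * (- 1 - t) ^ i) * (of_nat (m choose j) * t ^ j) * of_nat (m choose l)"
    proof (cases "i \<le> m \<and> j \<le> m \<and> l \<le> m")
      case True
      then have "m - i + (m - j) + (m - l) + k = 3 * m" using k by simp
      moreover have "m choose (m - q) = m choose q" if "q \<le> m" for q using binomial_symmetric[OF that] by simp
      ultimately show ?thesis using True by (simp add: coeff3_var_power coeff3_const_field_power rank1_def)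
    next
      case False
      then have "of_nat (m choose i) = (0::'a) \<or> of_nat (m choose j) = (0::'a) \<or> of_nat (m choose l) = (0::'a)"
        by (auto simp: binomial_eq_0)
      then show ?thesis using False by (auto simp: coeff3_var_power)
    qed
    then show "of_nat (k choose i) * of_nat (k - i choose j) * coeff3 (?x ^ i * (?y ^ j * (?z ^ (k - i - j) * ?f))) m m m
      = fact k * fact k * (laguerre m i * laguerre m j * laguerre m (k - i - j) * ((- 1 - t) ^ i * t ^ j))"
      unfolding mult l_def[symmetric] by (simp add: laguerre_def field_simps)
  qed
  finally show ?thesis by (simp add: sum_distrib_left)
qed

lemma rank_neutral_perp_trivial:
  fixes T :: "'a::field_char_0 endo"
  assumes T: "T \<in> rank_neutral_perp m" and m: "m > 0"
  shows "T = 0"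
proof (rule ccontr)
  assume "T \<noteq> 0"
  then obtain k where k: "k \<le> 3 * m" "vfield AX AZ ^ k * hproj (3 * m) \<in> (rank_neutral_perp m :: 'a endo set)"
    using rank_neutral_perp_power[OF T _ m] by blast
  \<comment> \<open>Here the test function gives nothing, and orthogonality to A decides: x d/dz
    pairs nontrivially with z d/dx.\<close>
  have "k \<noteq> 1"
  proof
    assume "k = 1"
    then have "elem_op (3 * m) AX AZ \<in> (rank_neutral_perp m :: 'a endo set)" using k(2) by (simp add: elem_op_def)
    moreover have "elem_op (3 * m) AZ AX \<in> (sl (3 * m) :: 'a endo set)"
    proof -
      have "elem_op (3 * m) AZ AX = gl_op (3 * m) (\<lambda>i j. if i = AZ \<and> j = AX then 1 else (0::'a))"
        by (simp add: gl_op_def sum_axis mul_hom)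
      then show ?thesis by (simp add: gl_op_sl trace3_def sum_axis)
    qed
    ultimately have "trace_op (3 * m) (elem_op (3 * m) AX AZ * elem_op (3 * m) AZ AX :: 'a endo) = 0"
      by (simp add: rank_neutral_perp_def)
    then show False using trace_op_root_pair[of AX AZ "3 * m", where 'a='a] m by simp
  qed
  then obtain t :: 'a where t: "(\<Sum>i\<le>k. \<Sum>j\<le>k-i.
      laguerre m i * laguerre m j * laguerre m (k - i - j) * ((- 1 - t) ^ i * t ^ j)) \<noteq> 0"
    using laguerre_triple_nonzero[OF k(1)] by blast
  have "vfield AX AZ ^ k * hproj (3 * m) \<in> (rank_neutral m :: 'a endo set)" using k(2) by (simp add: rank_neutral_perp_def)
  then have "middle_entry m (gl_op (3 * m) (rank1 t) ^ k * hproj (3 * m)) = 0" by (intro rank_neutral_middle_entry rank_neutral_rank1)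
  then show False using t by (simp add: middle_entry_rank1)
qed

section \<open>The maximal singular space\<close>


lemma card_homog_indices: "card (homog_indices k) = (k + 2) choose 2"
proof -
  have "homog_indices k = (\<lambda>(a, b). (a, b, k - a - b)) ` (SIGMA a:{..k}. {..k - a})"
    by (auto simp: homog_indices_def image_iff)
  moreover have "inj_on (\<lambda>(a, b). (a, b, k - a - b)) (SIGMA a:{..k}. {..k - a})"
    by (auto simp: inj_on_def)
  ultimately have "card (homog_indices k) = (\<Sum>a\<le>k. Suc (k - a))"
    by (simp add: card_image)
  also have "\<dots> = (k + 2) choose 2"
  proof (induction k)
    case (Suc k)
    have "(\<Sum>a\<le>Suc k. Suc (Suc k - a)) = Suc (Suc k) + (\<Sum>a\<le>k. Suc (k - a))"
      by (subst sum.atMost_Suc_shift) simp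
    then show ?case unfolding Suc by (simp add: numeral_2_eq_2)
  qed (simp add: numeral_2_eq_2)
  finally show ?thesis .
qed

lemma invertible_mat_iff_det:
  fixes M :: "'a::field mat"
  assumes M: "M \<in> carrier_mat n n"
  shows "invertible_mat M \<longleftrightarrow> det M \<noteq> 0"
proof
  assume "invertible_mat M"
  then obtain B where B: "M * B = 1\<^sub>m n" "B * M = 1\<^sub>m (dim_row B)"
    using M unfolding invertible_mat_def inverts_mat_def by auto
  \<comment> \<open>Invertibility leaves the shape of \<open>B\<close> open; its dimensions are read
    off from the two products.\<close>
  have "dim_row B = n" using arg_cong[OF B(2), of dim_col] M by simp
  moreover have "dim_col B = n" using arg_cong[OF B(1), of dim_col] by simp
  ultimately have "B \<in> carrier_mat n n" by auto
  then have "det M * det B = 1" using det_mult[OF M, of B] B(1) by simp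
  then show "det M \<noteq> 0" by auto
next
  assume "det M \<noteq> 0"
  then obtain B where "B \<in> carrier_mat n n" "B * M = 1\<^sub>m n" "M * B = 1\<^sub>m n"
    using det_non_zero_imp_unit[OF M, where b = "()"]
    by (auto simp: Units_def ring_mat_def)
  then show "invertible_mat M"
    using M unfolding invertible_mat_def inverts_mat_def square_mat.simps by auto
qed

text \<open>The images of x^n, y^n and z^n reveal the columns of \<open>A\<close> up to the factor
  \<open>n\<close>, nonzero in characteristic zero.\<close>

lemma gl_op_eq_0:
  fixes A :: "axis \<Rightarrow> axis \<Rightarrow> 'a::field_char_0"
  assumes z: "gl_op n A = 0" and n: "n > 0"
  shows "A i j = 0"
proof -
  have c: "coeff3 (app (gl_field A) (mon3 a b c)) x y z = 0" if "a + b + c = n" for a b c x y z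
  proof -
    have "app (hproj n) (mon3 a b c) = (mon3 a b c :: 'a poly3)"
      by (rule poly3_eqI) (use that in \<open>auto simp: coeff3_hproj coeff3_mon3\<close>)
    then have "app (gl_field A) (mon3 a b c) = app (gl_op n A) (mon3 a b c)" by (simp add: gl_op_gl_field)
    then show ?thesis by (simp add: z)
  qed
  obtain k where k: "n = Suc k" using n by (cases n) auto
  have nz: "1 + of_nat k \<noteq> (0::'a)" using of_nat_neq_0[of k] by simp
  show ?thesis
    using c[of n 0 0 n 0 0] c[of n 0 0 k 1 0] c[of n 0 0 k 0 1]
      c[of 0 n 0 1 k 0] c[of 0 n 0 0 n 0] c[of 0 n 0 0 k 1]
      c[of 0 0 n 1 0 k] c[of 0 0 n 0 1 k] c[of 0 0 n 0 0 n] nz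
    by (cases i; cases j; cases k) (simp_all add: app_gl_field sum_axis coeff3_var coeff3_dvar coeff3_mon3 k)
qed

text \<open>A basis whose coordinates are matrix entries, for the dimension count;
  \<open>orth_basis\<close> is adapted to the trace form instead.\<close>

definition coord_basis :: "nat \<Rightarrow> axis \<times> axis \<Rightarrow> 'a::field_char_0 endo" where
  "coord_basis n p = gl_op n (coord_mat (\<lambda>q. if q = p then 1 else 0))"

lemma trace3_coord_mat: "trace3 (coord_mat c) = 0"
  by (simp add: trace3_def sum_axis coord_mat_def)

lemma sum_coord_basis: "(\<Sum>p\<in>sl_index. sc (c p) * coord_basis n p) = gl_op n (coord_mat c)"
proof -
  have "(\<Sum>p\<in>sl_index. sc (c p) * coord_basis n p) = gl_op n (\<lambda>i j. \<Sum>p\<in>sl_index. c p * coord_mat (\<lambda>q. if q = p then 1 else 0) i j)"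
    by (simp add: sl_index_def coord_basis_def gl_op_sc gl_op_add)
  also have "(\<lambda>i j. \<Sum>p\<in>sl_index. c p * coord_mat (\<lambda>q. if q = p then 1 else 0) i j) = coord_mat c"
  proof (intro ext)
    fix i j show "(\<Sum>p\<in>sl_index. c p * coord_mat (\<lambda>q. if q = p then 1 else 0) i j) = coord_mat c i j"
      by (cases i; cases j; simp add: sl_index_def coord_mat_def)
  qed
  finally show ?thesis .
qed

lemma sl_eq_coord_mat: "sl n = range (\<lambda>c. gl_op n (coord_mat c) :: 'a::field_char_0 endo)"
proof
  show "sl n \<subseteq> range (\<lambda>c. gl_op n (coord_mat c) :: 'a endo)"
  proof
    fix L :: "'a endo" assume "L \<in> sl n"
    then obtain A where A: "L = gl_op n A" "trace3 A = 0" by (rule slE)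
    have z: "A AZ AZ = - (A AX AX + A AY AY)"
      using A(2) by (simp only: trace3_def sum_axis eq_neg_iff_add_eq_0 add_ac)
    have "coord_mat (\<lambda>(i, j). A i j) = A"
    proof (intro ext)
      fix i j show "coord_mat (\<lambda>(i, j). A i j) i j = A i j" by (cases i; cases j; simp add: coord_mat_def z)
    qed
    then show "L \<in> range (\<lambda>c. gl_op n (coord_mat c))" using A(1) by (metis rangeI)
  qed
qed (auto intro: gl_op_sl trace3_coord_mat)

lemma gl_op_coord_mat_eq_0:
  assumes "gl_op n (coord_mat c) = (0 :: 'a::field_char_0 endo)" "n > 0" "p \<in> sl_index"
  shows "c p = 0"
proof -
  have "coord_mat c (fst p) (snd p) = 0" by (rule gl_op_eq_0[OF assms(1,2)])
  then show ?thesis using assms(3) by (auto simp: sl_index_def coord_mat_def)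
qed

definition sl_mats :: "nat \<Rightarrow> 'a::field_char_0 mat set" where
  "sl_mats n = mat_of n ` sl n"

lemma sl_mats_subspace:
  "VectorSpace.subspace class_ring (sl_mats n) (module_mat TYPE('a::field_char_0) (ndim n) (ndim n))"
proof -
  interpret V: vectorspace "class_ring :: 'a ring" "module_mat TYPE('a) (ndim n) (ndim n)"
    by (rule matrix_vs)
  have "submodule class_ring (sl_mats n) (module_mat TYPE('a) (ndim n) (ndim n))"
  proof (rule submodule.intro)
    show "module class_ring (module_mat TYPE('a) (ndim n) (ndim n))" by (rule V.module_axioms)
    show "sl_mats n \<subseteq> carrier (module_mat TYPE('a) (ndim n) (ndim n))"
      by (auto simp: sl_mats_def module_mat_simps)
    show "v \<oplus>\<^bsub>module_mat TYPE('a) (ndim n) (ndim n)\<^esub> w \<in> sl_mats n" if "v \<in> sl_mats n" "w \<in> sl_mats n" for v w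
      using that by (auto simp: sl_mats_def module_mat_simps mat_of_linear(1)[symmetric] intro: sl_add)
    show "\<zero>\<^bsub>module_mat TYPE('a) (ndim n) (ndim n)\<^esub> \<in> sl_mats n"
    proof -
      have "mat_of n 0 \<in> (sl_mats n :: 'a mat set)" unfolding sl_mats_def by (intro imageI sl_zero)
      then show ?thesis by (simp add: module_mat_simps mat_of_linear(3))
    qed
    show "c \<odot>\<^bsub>module_mat TYPE('a) (ndim n) (ndim n)\<^esub> v \<in> sl_mats n" if "v \<in> sl_mats n" for c v
      using that by (auto simp: sl_mats_def module_mat_simps mat_of_linear(2)[symmetric] intro: sl_sc)
  qed
  then show ?thesis by (intro subspace.intro matrix_vs)
qed

lemma sl_mats_dim:
  assumes n: "n > 0"
  shows "mat_subspace_dim (ndim n) (sl_mats n :: 'a::field_char_0 mat set) = 8"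
proof -
  let ?V = "module_mat TYPE('a) (ndim n) (ndim n)"
  let ?S = "sl_mats n :: 'a mat set"
  let ?b = "\<lambda>p. mat_of n (coord_basis n p) :: 'a mat"
  interpret V: vectorspace "class_ring :: 'a ring" ?V by (rule matrix_vs)
  have sub: "VectorSpace.subspace class_ring ?S ?V" by (rule sl_mats_subspace)
  then have submod: "submodule class_ring ?S ?V" by (rule V.is_module)
  interpret S: vectorspace "class_ring :: 'a ring" "?V\<lparr>carrier := ?S\<rparr>"
    by (rule V.subspace_is_vs[OF sub])
  have fin: "finite sl_index" by (simp add: sl_index_def)
  have inS: "?b p \<in> ?S" for p
    unfolding sl_mats_def coord_basis_def by (intro imageI gl_op_sl trace3_coord_mat)
  have bV: "?b p \<in> carrier ?V" for p by (simp add: module_mat_simps)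
  have inj: "inj_on ?b sl_index"
  proof (rule inj_onI)
    fix p q assume pq: "p \<in> sl_index" "q \<in> sl_index" "?b p = ?b q"
    have corner: "coord_basis n r * hproj n = coord_basis n r" "hproj n * coord_basis n r = coord_basis n r" for r by (simp_all add: coord_basis_def)
    have "coord_basis n p = (coord_basis n q :: 'a endo)"
      using op_of_mat_of[OF corner[of p]] op_of_mat_of[OF corner[of q]] pq(3) by metis
    then have "gl_op n (coord_mat (\<lambda>r. (if r = p then 1 else 0) + (-1) * (if r = q then 1 else 0))) = (0 :: 'a endo)"
    proof -
      assume eq: "coord_basis n p = (coord_basis n q :: 'a endo)"
      have "gl_op n (coord_mat (\<lambda>r. (if r = p then 1 else 0) + (-1) * (if r = q then 1 else 0))) = coord_basis n p + sc (-1) * (coord_basis n q :: 'a endo)"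
        unfolding coord_basis_def gl_op_sc gl_op_add by (rule arg_cong[where f = "gl_op n"]) (auto simp: coord_mat_def fun_eq_iff)
      then show ?thesis unfolding eq by (simp add: mul_hom)
    qed
    from gl_op_coord_mat_eq_0[OF this n pq(1)] show "p = q" by (auto split: if_splits)
  qed
  \<comment> \<open>Linear combinations in the module are indexed by vectors; injectivity of the
    basis map turns them into sums over labels. A general subset \<open>R\<close> makes the
    induction possible.\<close>
  have fs: "finsum ?V (\<lambda>v. a v \<odot>\<^bsub>?V\<^esub> v) (?b ` R) = mat_of n (\<Sum>p\<in>R. sc (a (?b p)) * coord_basis n p)"
    if "R \<subseteq> sl_index" for a R
  proof -
    have "finite R" using that fin by (rule finite_subset)
    then show ?thesis using that
    proof (induction R rule: finite_induct)
      case empty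
      show ?case by (simp add: mat_of_linear(3) module_mat_simps)
    next
      case (insert p R)
      have nin: "?b p \<notin> ?b ` R" using insert.hyps insert.prems inj by (auto simp: inj_on_def)
      have "finsum ?V (\<lambda>v. a v \<odot>\<^bsub>?V\<^esub> v) (insert (?b p) (?b ` R))
        = a (?b p) \<odot>\<^bsub>?V\<^esub> ?b p \<oplus>\<^bsub>?V\<^esub> finsum ?V (\<lambda>v. a v \<odot>\<^bsub>?V\<^esub> v) (?b ` R)"
        by (rule V.finsum_insert) (use insert.hyps nin in \<open>auto simp: module_mat_simps\<close>)
      also have "\<dots> = mat_of n (\<Sum>p\<in>insert p R. sc (a (?b p)) * coord_basis n p)"
        using insert by (simp add: module_mat_simps mat_of_linear)
      finally show ?case by simp
    qed
  qed
  have lc: "V.lincomb a (?b ` sl_index) = mat_of n (gl_op n (coord_mat (\<lambda>p. a (?b p))))" for a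
    using fs[OF order_refl, of a] by (simp add: V.lincomb_def sum_coord_basis)
  have li: "V.lin_indpt (?b ` sl_index)"
  proof (rule V.finite_lin_indpt2)
    show "finite (?b ` sl_index)" using fin by simp
    show "?b ` sl_index \<subseteq> carrier ?V" using bV by blast
    fix a assume "V.lincomb a (?b ` sl_index) = \<zero>\<^bsub>?V\<^esub>"
    then have "mat_of n (gl_op n (coord_mat (\<lambda>p. a (?b p)))) = mat_of n 0"
      by (simp add: lc module_mat_simps mat_of_linear(3))
    then have "gl_op n (coord_mat (\<lambda>p. a (?b p))) = 0"
      using op_of_mat_of[of "gl_op n (coord_mat (\<lambda>p. a (?b p)))" n] op_of_mat_of[of "0 :: 'a endo" n] by simp
    then show "\<forall>v\<in>?b ` sl_index. a v = \<zero>\<^bsub>class_ring\<^esub>" using gl_op_coord_mat_eq_0[OF _ n] by auto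
  qed
  have span: "V.span (?b ` sl_index) = ?S"
  proof -
    have "V.span (?b ` sl_index) = {V.lincomb a (?b ` sl_index) | a. a \<in> ?b ` sl_index \<rightarrow> carrier class_ring}"
      by (rule V.finite_span) (use fin bV in auto)
    also have "\<dots> = range (\<lambda>a. mat_of n (gl_op n (coord_mat (\<lambda>p. a (?b p)))))" by (auto simp: lc)
    also have "\<dots> = mat_of n ` range (\<lambda>c. gl_op n (coord_mat c))"
    proof (intro equalityI subsetI)
      fix M assume "M \<in> mat_of n ` range (\<lambda>c. gl_op n (coord_mat c) :: 'a endo)"
      then obtain c where M: "M = mat_of n (gl_op n (coord_mat c))" by auto
      \<comment> \<open>Coefficients given on labels have to become a function on matrices.\<close>
      define a where "a v = c (the_inv_into sl_index ?b v)" for v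
      have ab: "a (?b p) = c p" if "p \<in> sl_index" for p using the_inv_into_f_f[OF inj that] by (simp add: a_def)
      have "coord_mat (\<lambda>p. a (?b p)) = coord_mat c"
      proof (intro ext)
        fix k l show "coord_mat (\<lambda>p. a (?b p)) k l = coord_mat c k l"
          by (cases k; cases l; simp add: coord_mat_def ab sl_index_def)
      qed
      then show "M \<in> range (\<lambda>a. mat_of n (gl_op n (coord_mat (\<lambda>p. a (?b p)))))" unfolding M by (metis rangeI)
    qed auto
    finally show ?thesis by (simp add: sl_mats_def sl_eq_coord_mat)
  qed
  have sub_b: "?b ` sl_index \<subseteq> ?S" using inS by blast
  have "S.basis (?b ` sl_index)"
    unfolding S.basis_def using V.span_li_not_depend[OF sub_b submod] li span sub_b by simp
  then have "S.dim = card (?b ` sl_index)" using fin by (intro S.dim_basis) simp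
  also have "\<dots> = 8" unfolding card_image[OF inj] by (simp add: sl_index_def)
  finally show ?thesis by (simp add: mat_subspace_dim_def)
qed

lemma sl_mats_singular:
  fixes M :: "'a::field_char_0 mat"
  assumes "M \<in> sl_mats (3 * m)"
  shows "\<not> invertible_mat M"
  using assms det_sl[where m = m and 'a = 'a] by (auto simp: sl_mats_def invertible_mat_iff_det[OF mat_of_carrier])

text \<open>Needed to keep \<open>T\<close> minus its projection to \<open>sl\<close> inside
  \<open>rank_neutral\<close>. It holds because the span of A and one of its elements is A, which is
  singular.\<close>

lemma sl_subset_rank_neutral:
  fixes L :: "'a::field_char_0 endo"
  assumes L: "L \<in> sl (3 * m)"
  shows "L \<in> rank_neutral m"
proof (rule sl_singular_rank_neutral)
  show "L \<in> corner (3 * m)" by (rule sl_corner[OF L])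
  show "sl_singular (3 * m) L"
    unfolding sl_singular_def
  proof (intro ballI allI)
    fix L' :: "'a endo" and s assume "L' \<in> sl (3 * m)"
    then have s: "sc s * L + L' \<in> sl (3 * m)" by (intro sl_add sl_sc L)
    then show "sing (3 * m) (sc s * L + L')"
      using sing_iff_det[of "sc s * L + L'" "3 * m"] sl_corner[OF s] det_sl[OF s] by (simp add: corner_def)
  qed
qed

lemma sl_mats_maximal:
  fixes B :: "'a::field_char_0 mat set"
  assumes m: "m > 0" and sub: "sl_mats (3 * m) \<subseteq> B" and B: "singular_subspace (ndim (3 * m)) B"
  shows "B \<subseteq> sl_mats (3 * m)"
proof
  let ?n = "3 * m" and ?N = "ndim (3 * m)"
  fix M assume M: "M \<in> B"
  have sm: "submodule class_ring B (module_mat TYPE('a) ?N ?N)"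
    using B unfolding singular_subspace_def VectorSpace.subspace_def by blast
  have Bc: "P \<in> carrier_mat ?N ?N" if "P \<in> B" for P
    using submodule.subset[OF sm] that by (auto simp: module_mat_simps)
  have Badd: "P + Q \<in> B" if "P \<in> B" "Q \<in> B" for P Q
    using submodule.m_closed[OF sm that] by (simp add: module_mat_simps)
  have Bsc: "s \<cdot>\<^sub>m P \<in> B" if "P \<in> B" for s P
    using submodule.smult_closed[OF sm _ that, of s] by (simp add: module_mat_simps)
  have Bdet: "det P = 0" if "P \<in> B" for P
    using B that invertible_mat_iff_det[OF Bc[OF that]] unfolding singular_subspace_def by blast
  define T where "T = op_of ?n M"
  have TM: "mat_of ?n T = M" unfolding T_def by (rule mat_of_op_of[OF Bc[OF M]])
  have Tc: "T \<in> corner ?n" by (simp add: T_def corner_def op_of_corner)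
  have "sl_singular ?n T"
    unfolding sl_singular_def
  proof (intro ballI allI)
    fix L :: "'a endo" and s assume L: "L \<in> sl ?n"
    have "mat_of ?n (sc s * T + L) = s \<cdot>\<^sub>m M + mat_of ?n L" by (simp add: mat_of_linear TM)
    also have "\<dots> \<in> B" using L sub by (intro Badd Bsc M) (auto simp: sl_mats_def)
    finally have "det (mat_of ?n (sc s * T + L)) = 0" by (rule Bdet)
    moreover have "sc s * T + L \<in> corner ?n" by (intro corner_add corner_sc Tc sl_corner L)
    ultimately show "sing ?n (sc s * T + L)"
      using sing_iff_det[of "sc s * T + L" ?n] by (simp add: corner_def)
  qed
  then have TW: "T \<in> rank_neutral m" using Tc by (rule sl_singular_rank_neutral)
  obtain A where A: "A \<in> sl ?n" "\<And>L. L \<in> sl ?n \<Longrightarrow> trace_op ?n ((T - A) * L) = 0"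
    using trace_form_decomposition[of ?n T] m by auto
  have "T - A = T + sc (-1) * A" by (simp add: mul_hom)
  then have "T - A \<in> rank_neutral m" using rank_neutral_add[OF TW rank_neutral_sc[OF sl_subset_rank_neutral[OF A(1)]]] by metis
  then have "T - A \<in> rank_neutral_perp m" using A(2) by (simp add: rank_neutral_perp_def)
  then have "T - A = 0" using m by (rule rank_neutral_perp_trivial)
  then have "T \<in> sl ?n" using A(1) by simp
  then show "M \<in> sl_mats ?n" using TM by (auto simp: sl_mats_def)
qed

theorem mainTheorem2:
  fixes e n :: nat
  assumes "e > 1" and "n = (3 * e + 2) choose 2"
  shows "\<exists>A :: 'a :: field_char_0 mat set.
    maximal_singular_subspace n A \<and> mat_subspace_dim n A = 8"
proof (intro exI conjI)
  have n: "n = ndim (3 * e)" using assms(2) by (simp add: ndim_def card_homog_indices)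
  have "singular_subspace n (sl_mats (3 * e) :: 'a mat set)"
    unfolding singular_subspace_def n using sl_mats_subspace sl_mats_singular by blast
  moreover have "\<not> (sl_mats (3 * e) \<subset> B \<and> singular_subspace n B)" for B :: "'a mat set"
    using sl_mats_maximal[of e B] assms(1) unfolding n by auto
  ultimately show "maximal_singular_subspace n (sl_mats (3 * e) :: 'a mat set)"
    unfolding maximal_singular_subspace_def by blast
  show "mat_subspace_dim n (sl_mats (3 * e) :: 'a mat set) = 8"
    unfolding n using assms(1) by (intro sl_mats_dim) simp
qed

end
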